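(* Let $R$ be a commutative ring, $u\colon R\to U$ a (non-trivial) flat injective ring epimorphism of commutative rings with associated Gabriel topology $\mathcal{G}$, and suppose that the $R$-module $R$ has a $\mathcal{D}_{\mathcal{G}}$-envelope. Then the projective dimension of $U$ as an $R$-module is at most $1$.
   Context: A flat injective ring epimorphism $u\colon R\to U$ is an injective ring homomorphism which is an epimorphism in the category of unital rings and makes $U$ a flat $R$-module; non-trivial means that $u$ is not an isomorphism. The associated Gabriel topology is $\mathcal{G}=\{J\le R : JU=U\}$ (a set of ideals of $R$). $\mathcal{D}_{\mathcal{G}}$ is the class of $R$-modules $M$ with $JM=M$ for every $J\in\mathcal{G}$. For a class $\mathcal{C}$ of $R$-modules, a homomorphism $\mu\colon N\to C$ with $C\in\mathcal{C}$ is a $\mathcal{C}$-preenvelope of $N$ if every homomorphism $N\to C'$ with $C'\in\mathcal{C}$ factors through $\mu$; it is a $\mathcal{C}$-envelope if in addition every endomorphism $f$ of $C$ with $f\mu=\mu$ is an automorphism. *)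

theory Defs
  imports "HOL-Algebra.Algebra" "HOL-Library.Extended_Nat"
begin

text \<open>
  Several notions below quantify over all modules (or rings), of any size. A HOL formula can only
  quantify over structures carried by one fixed type, so in each definition the test structures
  live on a type that is large enough for the choice not to matter. The last section proves this:
  from the definition as stated, the property follows for test structures on an arbitrary type.
\<close>

section \<open>Modules\<close>

definition module_hom ::
    "('r, 'x) ring_scheme \<Rightarrow> ('r, 'a) module \<Rightarrow> ('r, 'b) module \<Rightarrow> ('a \<Rightarrow> 'b) set" where
  "module_hom R M N =
    {f \<in> hom (add_monoid M) (add_monoid N).
      \<forall>r\<in>carrier R. \<forall>x\<in>carrier M. f (r \<odot>\<^bsub>M\<^esub> x) = r \<odot>\<^bsub>N\<^esub> f x}"

definition restrict_scalars :: "'u ring \<Rightarrow> ('r \<Rightarrow> 'u) \<Rightarrow> ('r, 'u) module" where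
  "restrict_scalars U u = \<lparr>carrier = carrier U, monoid.mult = monoid.mult U, one = one U,
     ring.zero = ring.zero U, add = add U, smult = (\<lambda>r x. u r \<otimes>\<^bsub>U\<^esub> x)\<rparr>"

definition regular_module :: "'r ring \<Rightarrow> ('r, 'r) module" where
  "regular_module R = restrict_scalars R id"

definition ideal_times :: "'r set \<Rightarrow> ('r, 'a) module \<Rightarrow> 'a set" where
  "ideal_times J M = generate (add_monoid M) {r \<odot>\<^bsub>M\<^esub> x | r x. r \<in> J \<and> x \<in> carrier M}"

section \<open>Tensor products and flatness\<close>

definition tensor_relations ::
    "('r, 'x) ring_scheme \<Rightarrow> ('r, 'a) module \<Rightarrow> ('r, 'b) module \<Rightarrow> ('a \<times> 'b \<Rightarrow>\<^sub>0 int) set" where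
  "tensor_relations R M N =
     {frag_of (x \<oplus>\<^bsub>M\<^esub> x', y) - frag_of (x, y) - frag_of (x', y) | x x' y.
        x \<in> carrier M \<and> x' \<in> carrier M \<and> y \<in> carrier N}
   \<union> {frag_of (x, y \<oplus>\<^bsub>N\<^esub> y') - frag_of (x, y) - frag_of (x, y') | x y y'.
        x \<in> carrier M \<and> y \<in> carrier N \<and> y' \<in> carrier N}
   \<union> {frag_of (r \<odot>\<^bsub>M\<^esub> x, y) - frag_of (x, r \<odot>\<^bsub>N\<^esub> y) | r x y.
        r \<in> carrier R \<and> x \<in> carrier M \<and> y \<in> carrier N}"

definition tensor_kernel ::
    "('r, 'x) ring_scheme \<Rightarrow> ('r, 'a) module \<Rightarrow> ('r, 'b) module \<Rightarrow> ('a \<times> 'b \<Rightarrow>\<^sub>0 int) set" where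
  "tensor_kernel R M N =
     generate (free_Abelian_group (carrier M \<times> carrier N)) (tensor_relations R M N)"

text \<open>The underlying abelian group of the tensor product of $M$ and $N$ over $R$.\<close>

definition tensor_product ::
    "('r, 'x) ring_scheme \<Rightarrow> ('r, 'a) module \<Rightarrow> ('r, 'b) module \<Rightarrow> ('a \<times> 'b \<Rightarrow>\<^sub>0 int) set monoid" where
  "tensor_product R M N = free_Abelian_group (carrier M \<times> carrier N) Mod tensor_kernel R M N"

text \<open>The map induced on tensor products with $M$ by a homomorphism $f$ from $A$ to $B$; the
  elements of the tensor products are cosets.\<close>

definition tensor_push :: "('a \<Rightarrow> 'b) \<Rightarrow> ('a \<times> 'm \<Rightarrow>\<^sub>0 int) \<Rightarrow> ('b \<times> 'm \<Rightarrow>\<^sub>0 int)" where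
  "tensor_push f = frag_extend (\<lambda>(a, m). frag_of (f a, m))"

definition tensor_map ::
    "('r, 'x) ring_scheme \<Rightarrow> ('r, 'b) module \<Rightarrow> ('r, 'm) module \<Rightarrow> ('a \<Rightarrow> 'b) \<Rightarrow>
      ('a \<times> 'm \<Rightarrow>\<^sub>0 int) set \<Rightarrow> ('b \<times> 'm \<Rightarrow>\<^sub>0 int) set" where
  "tensor_map R B M f T =
     (\<Union>c\<in>T. tensor_kernel R B M #>\<^bsub>free_Abelian_group (carrier B \<times> carrier M)\<^esub> tensor_push f c)"

text \<open>Test modules on finite lists of ring elements suffice, because an equality in a tensor
  product already holds over a finitely generated submodule (lemma \<open>flat_moduleD\<close>).\<close>

definition flat_module :: "'r ring \<Rightarrow> ('r, 'm) module \<Rightarrow> bool" where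
  "flat_module R M \<longleftrightarrow> module R M \<and>
    (\<forall>(A :: ('r, 'r list) module) (B :: ('r, 'r list) module). \<forall>f\<in>module_hom R A B.
       module R A \<longrightarrow> module R B \<longrightarrow> inj_on f (carrier A) \<longrightarrow>
       inj_on (tensor_map R B M f) (carrier (tensor_product R A M)))"

section \<open>Ring epimorphisms\<close>

text \<open>The test rings are arbitrary unital rings, not necessarily commutative. Given two maps from
  \<open>U\<close>, the subring generated by their images consists of finite sums of finite words, hence the
  type of lists of lists (lemma \<open>ring_epimorphismD\<close>).\<close>

definition ring_epimorphism :: "'r ring \<Rightarrow> 'u ring \<Rightarrow> ('r \<Rightarrow> 'u) \<Rightarrow> bool" where
  "ring_epimorphism R U u \<longleftrightarrow> u \<in> ring_hom R U \<and>
    (\<forall>S :: 'u list list ring. ring S \<longrightarrow>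
      (\<forall>f\<in>ring_hom U S. \<forall>g\<in>ring_hom U S.
        (\<forall>r\<in>carrier R. f (u r) = g (u r)) \<longrightarrow> (\<forall>x\<in>carrier U. f x = g x)))"

definition flat_injective_ring_epimorphism :: "'r ring \<Rightarrow> 'u ring \<Rightarrow> ('r \<Rightarrow> 'u) \<Rightarrow> bool" where
  "flat_injective_ring_epimorphism R U u \<longleftrightarrow>
    ring_epimorphism R U u \<and> inj_on u (carrier R) \<and> flat_module R (restrict_scalars U u)"

section \<open>Divisible modules, preenvelopes and envelopes\<close>

definition gabriel_topology :: "'r ring \<Rightarrow> 'u ring \<Rightarrow> ('r \<Rightarrow> 'u) \<Rightarrow> 'r set set" where
  "gabriel_topology R U u = {J. ideal J R \<and> ideal_times J (restrict_scalars U u) = carrier U}"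

definition divisible_modules :: "'r ring \<Rightarrow> 'r set set \<Rightarrow> ('r, 'a) module set" where
  "divisible_modules R \<G> = {M. module R M \<and> (\<forall>J\<in>\<G>. ideal_times J M = carrier M)}"

definition preenvelope ::
    "'r ring \<Rightarrow> ('r, 'c) module set \<Rightarrow> ('r, 'n) module \<Rightarrow> ('r, 'c) module \<Rightarrow> ('n \<Rightarrow> 'c) \<Rightarrow> bool" where
  "preenvelope R \<C> N C \<mu> \<longleftrightarrow> C \<in> \<C> \<and> \<mu> \<in> module_hom R N C \<and>
    (\<forall>C'\<in>\<C>. \<forall>f\<in>module_hom R N C'. \<exists>g\<in>module_hom R C C'. \<forall>x\<in>carrier N. g (\<mu> x) = f x)"

definition envelope ::
    "'r ring \<Rightarrow> ('r, 'c) module set \<Rightarrow> ('r, 'n) module \<Rightarrow> ('r, 'c) module \<Rightarrow> ('n \<Rightarrow> 'c) \<Rightarrow> bool" where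
  "envelope R \<C> N C \<mu> \<longleftrightarrow> preenvelope R \<C> N C \<mu> \<and>
    (\<forall>f\<in>module_hom R C C. (\<forall>x\<in>carrier N. f (\<mu> x) = \<mu> x) \<longrightarrow> bij_betw f (carrier C) (carrier C))"

text \<open>
  A universe of modules over a ring on \<open>'r\<close>. The parameter \<open>'m\<close> makes it as large as desired (any
  module on \<open>'m\<close> has a copy in it, by \<open>Inl\<close>); the summand \<open>('r + nat) list\<close> ensures that it is never too small: every element of a
  \<open>\<G>\<close>-divisible module lies in a \<open>\<G>\<close>-divisible submodule of cardinality at most that of
  \<open>('r + nat) list\<close> (lemma \<open>divisible_preenvelopeD\<close>).
\<close>

type_synonym ('r, 'm) univ = "'m + ('r + nat) list"

section \<open>Projective dimension\<close>

text \<open>The free module on the set \<open>carrier P\<close> is carried by the type \<open>'p \<Rightarrow> 'r\<close>, and lifting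
  \<open>P \<rightarrow> P\<close> along its projection onto \<open>P\<close> gives all other liftings (lemma \<open>projective_moduleD\<close>).\<close>

definition projective_module :: "'r ring \<Rightarrow> ('r, 'p) module \<Rightarrow> bool" where
  "projective_module R P \<longleftrightarrow> module R P \<and>
    (\<forall>(A :: ('r, 'p \<Rightarrow> 'r) module) (B :: ('r, 'p) module). \<forall>g\<in>module_hom R A B. \<forall>f\<in>module_hom R P B.
       module R A \<longrightarrow> module R B \<longrightarrow> g ` carrier A = carrier B \<longrightarrow>
       (\<exists>h\<in>module_hom R P A. \<forall>x\<in>carrier P. g (h x) = f x))"

definition projective_resolution ::
    "'r ring \<Rightarrow> ('r, 'a) module \<Rightarrow> (nat \<Rightarrow> ('r, 'p) module) \<Rightarrow> ('p \<Rightarrow> 'a) \<Rightarrow> (nat \<Rightarrow> 'p \<Rightarrow> 'p) \<Rightarrow> bool" where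
  "projective_resolution R M P \<epsilon> d \<longleftrightarrow>
     (\<forall>i. projective_module R (P i)) \<and>
     \<epsilon> \<in> module_hom R (P 0) M \<and> \<epsilon> ` carrier (P 0) = carrier M \<and>
     (\<forall>i. d i \<in> module_hom R (P (Suc i)) (P i)) \<and>
     d 0 ` carrier (P 1) = {x \<in> carrier (P 0). \<epsilon> x = \<zero>\<^bsub>M\<^esub>} \<and>
     (\<forall>i. d (Suc i) ` carrier (P (Suc (Suc i))) = {x \<in> carrier (P (Suc i)). d i x = \<zero>\<^bsub>P i\<^esub>})"

text \<open>The type \<open>'a + nat \<Rightarrow> 'r\<close> has room for the free module on \<open>M\<close>, the free module on its
  kernel, and so on. The infimum of the empty set is \<open>\<infinity>\<close>.\<close>

definition projective_dimension :: "'r ring \<Rightarrow> ('r, 'a) module \<Rightarrow> enat" where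
  "projective_dimension R M = Inf {enat n | n.
     \<exists>(P :: nat \<Rightarrow> ('r, 'a + nat \<Rightarrow> 'r) module) \<epsilon> d.
       projective_resolution R M P \<epsilon> d \<and> (\<forall>i>n. carrier (P i) = {\<zero>\<^bsub>P i\<^esub>})}"

section \<open>Independence of the types of the test structures\<close>

subsection \<open>Homomorphisms and copies\<close>

lemma module_homI:
  assumes "\<And>x. x \<in> carrier M \<Longrightarrow> f x \<in> carrier N"
    and "\<And>x y. x \<in> carrier M \<Longrightarrow> y \<in> carrier M \<Longrightarrow> f (x \<oplus>\<^bsub>M\<^esub> y) = f x \<oplus>\<^bsub>N\<^esub> f y"
    and "\<And>r x. r \<in> carrier R \<Longrightarrow> x \<in> carrier M \<Longrightarrow> f (r \<odot>\<^bsub>M\<^esub> x) = r \<odot>\<^bsub>N\<^esub> f x"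
  shows "f \<in> module_hom R M N"
  using assms by (simp add: module_hom_def hom_def)

lemma module_homD:
  assumes "f \<in> module_hom R M N"
  shows "x \<in> carrier M \<Longrightarrow> f x \<in> carrier N"
    and "x \<in> carrier M \<Longrightarrow> y \<in> carrier M \<Longrightarrow> f (x \<oplus>\<^bsub>M\<^esub> y) = f x \<oplus>\<^bsub>N\<^esub> f y"
    and "r \<in> carrier R \<Longrightarrow> x \<in> carrier M \<Longrightarrow> f (r \<odot>\<^bsub>M\<^esub> x) = r \<odot>\<^bsub>N\<^esub> f x"
  using assms by (auto simp: module_hom_def hom_def)

lemma module_hom_comp:
  assumes "f \<in> module_hom R L M" and "g \<in> module_hom R M N"
  shows "g \<circ> f \<in> module_hom R L N"
  using module_homD[OF assms(1)] module_homD[OF assms(2)] by (intro module_homI) auto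

lemma module_hom_zero:
  assumes "module R M" "module R N" "f \<in> module_hom R M N"
  shows "f \<zero>\<^bsub>M\<^esub> = \<zero>\<^bsub>N\<^esub>"
proof -
  interpret M: module R M by fact
  interpret N: module R N by fact
  have "f (\<zero>\<^bsub>R\<^esub> \<odot>\<^bsub>M\<^esub> \<zero>\<^bsub>M\<^esub>) = \<zero>\<^bsub>R\<^esub> \<odot>\<^bsub>N\<^esub> f \<zero>\<^bsub>M\<^esub>"
    by (rule module_homD(3)[OF assms(3)]) auto
  then show ?thesis using module_homD(1)[OF assms(3), of "\<zero>\<^bsub>M\<^esub>"] by simp
qed

definition copy_module :: "('a \<Rightarrow> 'b) \<Rightarrow> ('r, 'a) module \<Rightarrow> ('r, 'b) module" where
  "copy_module \<phi> M = (let \<psi> = inv_into (carrier M) \<phi> in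
     \<lparr>carrier = \<phi> ` carrier M, monoid.mult = undefined, one = undefined,
      ring.zero = \<phi> \<zero>\<^bsub>M\<^esub>, add = (\<lambda>x y. \<phi> (\<psi> x \<oplus>\<^bsub>M\<^esub> \<psi> y)), smult = (\<lambda>r x. \<phi> (r \<odot>\<^bsub>M\<^esub> \<psi> x))\<rparr>)"

lemma copy_module:
  assumes M: "module R M" and inj: "inj_on \<phi> (carrier M)"
  shows "module R (copy_module \<phi> M)"
    and "\<phi> \<in> module_hom R M (copy_module \<phi> M)"
    and "inv_into (carrier M) \<phi> \<in> module_hom R (copy_module \<phi> M) M"
    and "carrier (copy_module \<phi> M) = \<phi> ` carrier M"
proof -
  interpret module R M by fact
  define \<psi> where "\<psi> = inv_into (carrier M) \<phi>"
  have \<psi>: "\<psi> (\<phi> x) = x" if "x \<in> carrier M" for x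
    using that inj by (simp add: \<psi>_def)
  let ?C = "copy_module \<phi> M"
  have [simp]: "carrier ?C = \<phi> ` carrier M" "\<zero>\<^bsub>?C\<^esub> = \<phi> \<zero>\<^bsub>M\<^esub>"
    "x \<oplus>\<^bsub>?C\<^esub> y = \<phi> (\<psi> x \<oplus>\<^bsub>M\<^esub> \<psi> y)" "r \<odot>\<^bsub>?C\<^esub> x = \<phi> (r \<odot>\<^bsub>M\<^esub> \<psi> x)" for x y r
    by (simp_all add: copy_module_def \<psi>_def Let_def)
  have ab: "abelian_group ?C"
  proof (rule abelian_groupI)
    fix x assume "x \<in> carrier ?C"
    then obtain a where "a \<in> carrier M" "x = \<phi> a" by auto
    then show "\<exists>y\<in>carrier ?C. y \<oplus>\<^bsub>?C\<^esub> x = \<zero>\<^bsub>?C\<^esub>"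
      by (intro bexI[of _ "\<phi> (\<ominus>\<^bsub>M\<^esub> a)"]) (auto simp: \<psi> M.l_neg)
  qed (auto simp: \<psi> M.a_ac)
  show "module R ?C"
    by (rule moduleI) (auto simp: \<psi> ab R.is_cring smult_l_distr smult_r_distr smult_assoc1)
  show "\<phi> \<in> module_hom R M ?C" by (rule module_homI) (auto simp: \<psi>)
  show "inv_into (carrier M) \<phi> \<in> module_hom R ?C M"
    unfolding \<psi>_def[symmetric] by (rule module_homI) (auto simp: \<psi>)
  show "carrier ?C = \<phi> ` carrier M" by simp
qed

subsection \<open>Projectivity\<close>

lemma module_hom_finsum:
  assumes M: "module R M" and N: "module R N" and f: "f \<in> module_hom R M N" and "finite A" and "g \<in> A \<rightarrow> carrier M"
  shows "f (finsum M g A) = finsum N (\<lambda>x. f (g x)) A"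
proof -
  interpret M: module R M by fact
  interpret N: module R N by fact
  from \<open>finite A\<close> \<open>g \<in> A \<rightarrow> carrier M\<close> show ?thesis
  proof (induction A)
    case empty
    show ?case using module_hom_zero[OF M N f] by simp
  next
    case (insert a A)
    then have "g \<in> A \<rightarrow> carrier M" "g a \<in> carrier M" by auto
    then show ?case using insert module_homD[OF f]
      by (simp add: Pi_def)
  qed
qed

definition free_module :: "'r ring \<Rightarrow> 'p set \<Rightarrow> ('r, 'p \<Rightarrow> 'r) module" where
  "free_module R V = \<lparr>carrier = {c. (\<forall>x. c x \<in> carrier R) \<and> (\<forall>x. x \<notin> V \<longrightarrow> c x = \<zero>\<^bsub>R\<^esub>) \<and>
       finite {x. c x \<noteq> \<zero>\<^bsub>R\<^esub>}},
     monoid.mult = undefined, one = undefined, ring.zero = (\<lambda>_. \<zero>\<^bsub>R\<^esub>),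
     add = (\<lambda>c d x. c x \<oplus>\<^bsub>R\<^esub> d x), smult = (\<lambda>r c x. r \<otimes>\<^bsub>R\<^esub> c x)\<rparr>"

definition free_eval :: "'r ring \<Rightarrow> ('r, 'a) module \<Rightarrow> ('p \<Rightarrow> 'a) \<Rightarrow> ('p \<Rightarrow> 'r) \<Rightarrow> 'a" where
  "free_eval R A \<phi> c = (\<Oplus>\<^bsub>A\<^esub>x\<in>{x. c x \<noteq> \<zero>\<^bsub>R\<^esub>}. c x \<odot>\<^bsub>A\<^esub> \<phi> x)"

lemma module_free_module:
  assumes "cring R" shows "module R (free_module R V)"
proof -
  interpret cring R by fact
  let ?F = "free_module R V"
  have fin: "finite {x. c x \<oplus>\<^bsub>R\<^esub> d x \<noteq> \<zero>\<^bsub>R\<^esub>}"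
    if "finite {x. c x \<noteq> \<zero>\<^bsub>R\<^esub>}" "finite {x. d x \<noteq> \<zero>\<^bsub>R\<^esub>}" for c d :: "'b \<Rightarrow> 'a"
    by (rule finite_subset[OF _ finite_UnI[OF that]]) auto
  have fin2: "finite {x. r \<otimes>\<^bsub>R\<^esub> c x \<noteq> \<zero>\<^bsub>R\<^esub>}"
    if "finite {x. c x \<noteq> \<zero>\<^bsub>R\<^esub>}" "r \<in> carrier R" for c :: "'b \<Rightarrow> 'a" and r
    by (rule finite_subset[OF _ that(1)]) (use that in auto)
  have fin3: "finite {x. \<ominus>\<^bsub>R\<^esub> c x \<noteq> \<zero>\<^bsub>R\<^esub>}"
    if "finite {x. c x \<noteq> \<zero>\<^bsub>R\<^esub>}" for c :: "'b \<Rightarrow> 'a"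
    by (rule finite_subset[OF _ that(1)]) auto
  have "abelian_group ?F"
  proof (rule abelian_groupI)
    fix c assume "c \<in> carrier ?F"
    then show "\<exists>d\<in>carrier ?F. d \<oplus>\<^bsub>?F\<^esub> c = \<zero>\<^bsub>?F\<^esub>"
      by (intro bexI[of _ "\<lambda>x. \<ominus>\<^bsub>R\<^esub> c x"]) (auto simp: free_module_def l_neg fin3)
  qed (auto simp: free_module_def fin a_ac)
  then show ?thesis
    by (rule moduleI[OF assms]) (auto simp: free_module_def fin2 l_distr r_distr m_assoc)
qed

lemma free_eval_superset:
  assumes "module R A" "c \<in> carrier (free_module R V)" "\<phi> \<in> V \<rightarrow> carrier A"
    and "finite S" "{x. c x \<noteq> \<zero>\<^bsub>R\<^esub>} \<subseteq> S" "S \<subseteq> V"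
  shows "free_eval R A \<phi> c = (\<Oplus>\<^bsub>A\<^esub>x\<in>S. c x \<odot>\<^bsub>A\<^esub> \<phi> x)"
proof -
  interpret module R A by fact
  show ?thesis unfolding free_eval_def
    using assms by (intro M.add.finprod_mono_neutral_cong_left) (auto simp: free_module_def Pi_def)
qed

lemma free_eval_hom:
  fixes R (structure)
  assumes A: "module R A" and \<phi>: "\<phi> \<in> V \<rightarrow> carrier A"
  shows "free_eval R A \<phi> \<in> module_hom R (free_module R V) A"
proof -
  interpret module R A by fact
  note sup = free_eval_superset[OF A _ \<phi>]
  have mem: "c x \<odot>\<^bsub>A\<^esub> \<phi> x \<in> carrier A" if "c \<in> carrier (free_module R V)" "x \<in> V" for c x
    using that \<phi> by (auto simp: free_module_def)
  have sub: "{x. c x \<noteq> \<zero>} \<subseteq> V" "finite {x. c x \<noteq> \<zero>}" "\<And>x. c x \<in> carrier R"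
    if "c \<in> carrier (free_module R V)" for c
    using that by (auto simp: free_module_def)
  interpret F: module R "free_module R V" using module_free_module R.is_cring .
  show ?thesis
  proof (rule module_homI)
    fix c assume c: "c \<in> carrier (free_module R V)"
    show "free_eval R A \<phi> c \<in> carrier A"
      unfolding free_eval_def using mem[OF c] sub[OF c] by (intro M.finsum_closed) auto
    fix d assume d: "d \<in> carrier (free_module R V)"
    let ?T = "{x. c x \<noteq> \<zero>} \<union> {x. d x \<noteq> \<zero>}"
    have T: "finite ?T" "?T \<subseteq> V" using sub[OF c] sub[OF d] by auto
    have e: "(c \<oplus>\<^bsub>free_module R V\<^esub> d) x = c x \<oplus> d x" for x by (simp add: free_module_def)
    have "free_eval R A \<phi> (c \<oplus>\<^bsub>free_module R V\<^esub> d) = (\<Oplus>\<^bsub>A\<^esub>x\<in>?T. (c x \<oplus> d x) \<odot>\<^bsub>A\<^esub> \<phi> x)"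
    proof -
      have "{x. (c \<oplus>\<^bsub>free_module R V\<^esub> d) x \<noteq> \<zero>} \<subseteq> ?T" by (auto simp: e)
      from sup[OF F.M.a_closed[OF c d] T(1) this T(2)] show ?thesis by (simp add: free_module_def)
    qed
    also have "\<dots> = (\<Oplus>\<^bsub>A\<^esub>x\<in>?T. c x \<odot>\<^bsub>A\<^esub> \<phi> x \<oplus>\<^bsub>A\<^esub> d x \<odot>\<^bsub>A\<^esub> \<phi> x)"
      using sub[OF c] sub[OF d] T(2) \<phi> by (intro M.finsum_cong') (auto simp: smult_l_distr Pi_def subset_iff)
    also have "\<dots> = (\<Oplus>\<^bsub>A\<^esub>x\<in>?T. c x \<odot>\<^bsub>A\<^esub> \<phi> x) \<oplus>\<^bsub>A\<^esub> (\<Oplus>\<^bsub>A\<^esub>x\<in>?T. d x \<odot>\<^bsub>A\<^esub> \<phi> x)"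
      using T(2) mem[OF c] mem[OF d] by (intro M.finsum_addf) (auto simp: Pi_def)
    also have "\<dots> = free_eval R A \<phi> c \<oplus>\<^bsub>A\<^esub> free_eval R A \<phi> d"
      using sup[OF c T(1) _ T(2)] sup[OF d T(1) _ T(2)] by auto
    finally show "free_eval R A \<phi> (c \<oplus>\<^bsub>free_module R V\<^esub> d) = free_eval R A \<phi> c \<oplus>\<^bsub>A\<^esub> free_eval R A \<phi> d" .
  next
    fix r c assume r: "r \<in> carrier R" and c: "c \<in> carrier (free_module R V)"
    let ?T = "{x. c x \<noteq> \<zero>}"
    have T: "finite ?T" "?T \<subseteq> V" using sub[OF c] by auto
    have e: "(r \<odot>\<^bsub>free_module R V\<^esub> c) x = r \<otimes> c x" for x by (simp add: free_module_def)
    have "free_eval R A \<phi> (r \<odot>\<^bsub>free_module R V\<^esub> c) = (\<Oplus>\<^bsub>A\<^esub>x\<in>?T. (r \<otimes> c x) \<odot>\<^bsub>A\<^esub> \<phi> x)"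
    proof -
      have "{x. (r \<odot>\<^bsub>free_module R V\<^esub> c) x \<noteq> \<zero>} \<subseteq> ?T" using r by (auto simp: e)
      from sup[OF F.smult_closed[OF r c] T(1) this T(2)] show ?thesis by (simp add: free_module_def)
    qed
    also have "\<dots> = (\<Oplus>\<^bsub>A\<^esub>x\<in>?T. r \<odot>\<^bsub>A\<^esub> (c x \<odot>\<^bsub>A\<^esub> \<phi> x))"
      using sub[OF c] T(2) \<phi> r by (intro M.finsum_cong') (auto simp: smult_assoc1 Pi_def subset_iff)
    also have "\<dots> = r \<odot>\<^bsub>A\<^esub> free_eval R A \<phi> c"
      unfolding free_eval_def using finsum_smult_ldistr[OF T(1) r, of "\<lambda>x. c x \<odot>\<^bsub>A\<^esub> \<phi> x"] T(2) mem[OF c]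
      by (simp add: Pi_def subset_iff)
    finally show "free_eval R A \<phi> (r \<odot>\<^bsub>free_module R V\<^esub> c) = r \<odot>\<^bsub>A\<^esub> free_eval R A \<phi> c" .
  qed
qed

lemma projective_moduleD:
  fixes P :: "('r, 'p) module" and A :: "('r, 'a) module" and B :: "('r, 'b) module"
  assumes P: "projective_module R P" and A: "module R A" and B: "module R B"
    and g: "g \<in> module_hom R A B" and f: "f \<in> module_hom R P B" and surj: "g ` carrier A = carrier B"
  shows "\<exists>h\<in>module_hom R P A. \<forall>x\<in>carrier P. g (h x) = f x"
proof -
  have mP: "module R P" using P by (simp add: projective_module_def)
  then interpret P: module R P .
  interpret A: module R A by fact
  let ?F = "free_module R (carrier P)" and ?\<pi> = "free_eval R P (\<lambda>x. x)"
  have F: "module R ?F" using P.R.is_cring by (rule module_free_module)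
  have \<pi>: "?\<pi> \<in> module_hom R ?F P" using mP by (rule free_eval_hom) auto
  have "x \<in> ?\<pi> ` carrier ?F" if x: "x \<in> carrier P" for x
  proof (rule image_eqI)
    let ?c = "\<lambda>y. if y = x then \<one>\<^bsub>R\<^esub> else \<zero>\<^bsub>R\<^esub>"
    show c: "?c \<in> carrier ?F" using x by (auto simp: free_module_def)
    show "x = ?\<pi> ?c"
      using x by (subst free_eval_superset[OF mP c, of _ "{x}"]) auto
  qed
  then have surj\<pi>: "?\<pi> ` carrier ?F = carrier P" using module_homD(1)[OF \<pi>] by auto
  have idP: "(\<lambda>x. x) \<in> module_hom R P P" by (rule module_homI) auto
  obtain s where s: "s \<in> module_hom R P ?F" "\<And>x. x \<in> carrier P \<Longrightarrow> ?\<pi> (s x) = x"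
    using P[unfolded projective_module_def, THEN conjunct2, rule_format, OF \<pi> idP F mP surj\<pi>] by blast
  define \<phi> where "\<phi> x = inv_into (carrier A) g (f x)" for x
  have \<phi>: "\<phi> x \<in> carrier A" "g (\<phi> x) = f x" if "x \<in> carrier P" for x
  proof -
    have "f x \<in> g ` carrier A" using surj module_homD(1)[OF f that] by simp
    then show "\<phi> x \<in> carrier A" "g (\<phi> x) = f x"
      unfolding \<phi>_def by (rule inv_into_into, rule f_inv_into_f)
  qed
  have ev: "free_eval R A \<phi> \<in> module_hom R ?F A" using A by (rule free_eval_hom) (auto simp: \<phi>)
  have "g (free_eval R A \<phi> c) = f (?\<pi> c)" if c: "c \<in> carrier ?F" for c
  proof -
    let ?T = "{x. c x \<noteq> \<zero>\<^bsub>R\<^esub>}"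
    have T: "finite ?T" "?T \<subseteq> carrier P" "\<And>x. c x \<in> carrier R" using c by (auto simp: free_module_def)
    interpret B: module R B by fact
    have "g (free_eval R A \<phi> c) = (\<Oplus>\<^bsub>B\<^esub>x\<in>?T. g (c x \<odot>\<^bsub>A\<^esub> \<phi> x))"
      unfolding free_eval_def using T \<phi> by (intro module_hom_finsum[OF A B g]) auto
    also have "\<dots> = (\<Oplus>\<^bsub>B\<^esub>x\<in>?T. f (c x \<odot>\<^bsub>P\<^esub> x))"
      using T \<phi> module_homD[OF f] module_homD[OF g] by (intro B.M.finsum_cong') (auto simp: subset_iff)
    also have "\<dots> = f (?\<pi> c)"
      unfolding free_eval_def using T by (intro module_hom_finsum[OF mP B f, symmetric]) auto
    finally show ?thesis .
  qed
  then have "\<forall>x\<in>carrier P. g ((free_eval R A \<phi> \<circ> s) x) = f x"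
    using s(2) module_homD(1)[OF s(1)] by simp
  then show ?thesis using module_hom_comp[OF s(1) ev] by blast
qed

subsection \<open>Flatness\<close>

lemma keys_frag_of_diff3: "Poly_Mapping.keys (frag_of a - frag_of b - frag_of c) \<subseteq> {a, b, c}"
  by (rule order_trans[OF keys_diff]) (use keys_diff[of "frag_of a" "frag_of b"] in auto)

lemma keys_frag_of_diff2: "Poly_Mapping.keys (frag_of a - frag_of b) \<subseteq> {a, b}"
  by (rule order_trans[OF keys_diff]) auto

lemma tensor_kernel_props:
  assumes A: "module R A" and M: "module R M"
  shows tensor_kernel_keys: "c \<in> tensor_kernel R A M \<Longrightarrow> Poly_Mapping.keys c \<subseteq> carrier A \<times> carrier M"
    and tensor_kernel_zero: "0 \<in> tensor_kernel R A M"
    and tensor_kernel_rel: "c \<in> tensor_relations R A M \<Longrightarrow> c \<in> tensor_kernel R A M"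
    and tensor_kernel_uminus: "c \<in> tensor_kernel R A M \<Longrightarrow> - c \<in> tensor_kernel R A M"
    and tensor_kernel_add: "c \<in> tensor_kernel R A M \<Longrightarrow> d \<in> tensor_kernel R A M \<Longrightarrow> c + d \<in> tensor_kernel R A M"
proof -
  interpret A: module R A by fact
  interpret M: module R M by fact
  let ?F = "free_Abelian_group (carrier A \<times> carrier M)"
  interpret F: comm_group ?F by (rule abelian_free_Abelian_group)
  have rel: "tensor_relations R A M \<subseteq> carrier ?F"
  proof
    fix c assume "c \<in> tensor_relations R A M"
    then have "Poly_Mapping.keys c \<subseteq> carrier A \<times> carrier M"
      unfolding tensor_relations_def
    proof (elim UnE CollectE exE conjE)
    qed (erule ssubst, rule order_trans[OF keys_frag_of_diff3] order_trans[OF keys_frag_of_diff2], simp)+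
    then show "c \<in> carrier ?F" by simp
  qed
  have sub: "subgroup (tensor_kernel R A M) ?F"
    unfolding tensor_kernel_def by (rule F.generate_is_subgroup[OF rel])
  then interpret K: subgroup "tensor_kernel R A M" ?F .
  show keys: "Poly_Mapping.keys c \<subseteq> carrier A \<times> carrier M" if "c \<in> tensor_kernel R A M" for c
    using K.mem_carrier[OF that] by simp
  show "0 \<in> tensor_kernel R A M" using K.one_closed by simp
  show "c \<in> tensor_relations R A M \<Longrightarrow> c \<in> tensor_kernel R A M"
    unfolding tensor_kernel_def by (rule generate.incl)
  show "c \<in> tensor_kernel R A M \<Longrightarrow> - c \<in> tensor_kernel R A M"
    using K.m_inv_closed[of c] keys[of c] by simp
  show "c \<in> tensor_kernel R A M \<Longrightarrow> d \<in> tensor_kernel R A M \<Longrightarrow> c + d \<in> tensor_kernel R A M"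
    using K.m_closed[of c d] by simp
qed

lemma tensor_kernel_induct [consumes 3, case_names zero rel uminus add]:
  assumes A: "module R A" and M: "module R M" and c: "c \<in> tensor_kernel R A M"
    and "P 0" and "\<And>c. c \<in> tensor_relations R A M \<Longrightarrow> P c"
    and "\<And>c. P c \<Longrightarrow> P (- c)" and "\<And>c d. P c \<Longrightarrow> P d \<Longrightarrow> P (c + d)"
  shows "P c"
  using c unfolding tensor_kernel_def
proof (induction rule: generate.induct)
  case (inv h)
  then have "h \<in> tensor_kernel R A M" using tensor_kernel_rel[OF A M] by simp
  then show ?case using inv assms(5,6) tensor_kernel_keys[OF A M] by simp
qed (use assms in auto)

lemma tensor_push_simps:
  "tensor_push f 0 = 0" "tensor_push f (- c) = - tensor_push f c"
  "tensor_push f (c + d) = tensor_push f c + tensor_push f d"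
  "tensor_push f (c - d) = tensor_push f c - tensor_push f d"
  "tensor_push f (frag_of (a, m)) = frag_of (f a, m)"
  by (simp_all add: tensor_push_def frag_extend_minus frag_extend_add frag_extend_diff)

lemma tensor_push_push: "tensor_push g (tensor_push f c) = tensor_push (g \<circ> f) c"
proof -
  have "Poly_Mapping.keys c \<subseteq> UNIV" by simp
  then show ?thesis
    by (induction c rule: frag_induction) (auto simp: tensor_push_simps)
qed

lemma tensor_push_cong:
  assumes "Poly_Mapping.keys c \<subseteq> S \<times> T" "\<And>a. a \<in> S \<Longrightarrow> f a = g a"
  shows "tensor_push f c = tensor_push g c"
  unfolding tensor_push_def using assms by (intro frag_extend_eq) auto

lemma tensor_push_id: "tensor_push (\<lambda>a. a) c = c"
proof -
  have "(\<lambda>(a, m). frag_of (a, m)) = (frag_of :: 'a \<times> 'b \<Rightarrow> _)" by auto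
  then show ?thesis using frag_expansion[of c] by (simp add: tensor_push_def)
qed

lemma tensor_push_keys:
  assumes "Poly_Mapping.keys c \<subseteq> S \<times> T"
  shows "Poly_Mapping.keys (tensor_push f c) \<subseteq> f ` S \<times> T"
  using keys_frag_extend[of "\<lambda>(a, m). frag_of (f a, m)" c] assms
  by (fastforce simp: tensor_push_def)

lemma tensor_push_kernel:
  assumes A: "module R A" and B: "module R B" and M: "module R M" and f: "f \<in> module_hom R A B"
    and c: "c \<in> tensor_kernel R A M"
  shows "tensor_push f c \<in> tensor_kernel R B M"
  using A M c
proof (induction rule: tensor_kernel_induct)
  case (rel c)
  note h = module_homD[OF f]
  from rel have "tensor_push f c \<in> tensor_relations R B M"
    unfolding tensor_relations_def
    apply (elim UnE CollectE exE conjE)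
    subgoal by (simp add: tensor_push_simps h) (use h in blast)
    subgoal by (simp add: tensor_push_simps h) (use h in blast)
    subgoal by (simp add: tensor_push_simps h) (use h in blast)
    done
  then show ?case by (rule tensor_kernel_rel[OF B M])
qed (simp_all add: tensor_push_simps tensor_kernel_props[OF B M])

lemma inj_on_tensor_map_iff:
  assumes A: "module R A" and B: "module R B" and M: "module R M" and f: "f \<in> module_hom R A B"
  shows "inj_on (tensor_map R B M f) (carrier (tensor_product R A M)) \<longleftrightarrow>
    (\<forall>c. Poly_Mapping.keys c \<subseteq> carrier A \<times> carrier M \<longrightarrow>
       tensor_push f c \<in> tensor_kernel R B M \<longrightarrow> c \<in> tensor_kernel R A M)"
proof -
  let ?FA = "free_Abelian_group (carrier A \<times> carrier M)" and ?FB = "free_Abelian_group (carrier B \<times> carrier M)"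
  let ?KA = "tensor_kernel R A M" and ?KB = "tensor_kernel R B M"
  note KA = tensor_kernel_props[OF A M] and KB = tensor_kernel_props[OF B M]
  have cosA: "x \<in> ?KA #>\<^bsub>?FA\<^esub> c \<longleftrightarrow> x - c \<in> ?KA" for x c
    by (auto simp: r_coset_def intro: bexI[of _ "x - c"])
  have cosB: "x \<in> ?KB #>\<^bsub>?FB\<^esub> c \<longleftrightarrow> x - c \<in> ?KB" for x c
    by (auto simp: r_coset_def intro: bexI[of _ "x - c"])
  have eqA: "?KA #>\<^bsub>?FA\<^esub> c = ?KA #>\<^bsub>?FA\<^esub> d \<longleftrightarrow> c - d \<in> ?KA" for c d
  proof
    assume "?KA #>\<^bsub>?FA\<^esub> c = ?KA #>\<^bsub>?FA\<^esub> d"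
    then show "c - d \<in> ?KA" using cosA[of c c] cosA[of c d] KA(2) by simp
  next
    assume cd: "c - d \<in> ?KA"
    then have dc: "d - c \<in> ?KA" using KA(4)[of "c - d"] by simp
    have "x - c \<in> ?KA \<longleftrightarrow> x - d \<in> ?KA" for x
      using KA(5)[of "x - c" "c - d"] KA(5)[of "x - d" "d - c"] cd dc by auto
    then show "?KA #>\<^bsub>?FA\<^esub> c = ?KA #>\<^bsub>?FA\<^esub> d" using cosA by blast
  qed
  have eqB: "?KB #>\<^bsub>?FB\<^esub> c = ?KB #>\<^bsub>?FB\<^esub> d \<longleftrightarrow> c - d \<in> ?KB" for c d
  proof
    assume "?KB #>\<^bsub>?FB\<^esub> c = ?KB #>\<^bsub>?FB\<^esub> d"
    then show "c - d \<in> ?KB" using cosB[of c c] cosB[of c d] KB(2) by simp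
  next
    assume cd: "c - d \<in> ?KB"
    then have dc: "d - c \<in> ?KB" using KB(4)[of "c - d"] by simp
    have "x - c \<in> ?KB \<longleftrightarrow> x - d \<in> ?KB" for x
      using KB(5)[of "x - c" "c - d"] KB(5)[of "x - d" "d - c"] cd dc by auto
    then show "?KB #>\<^bsub>?FB\<^esub> c = ?KB #>\<^bsub>?FB\<^esub> d" using cosB by blast
  qed
  have map: "tensor_map R B M f (?KA #>\<^bsub>?FA\<^esub> c) = ?KB #>\<^bsub>?FB\<^esub> tensor_push f c" for c
  proof -
    have "?KB #>\<^bsub>?FB\<^esub> tensor_push f d = ?KB #>\<^bsub>?FB\<^esub> tensor_push f c" if "d \<in> ?KA #>\<^bsub>?FA\<^esub> c" for d
      using that tensor_push_kernel[OF A B M f, of "d - c"] by (simp add: cosA eqB tensor_push_simps)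
    moreover have "c \<in> ?KA #>\<^bsub>?FA\<^esub> c" using KA(2) by (simp add: cosA)
    ultimately show ?thesis unfolding tensor_map_def by blast
  qed
  have car: "carrier (tensor_product R A M) =
      {?KA #>\<^bsub>?FA\<^esub> c | c. Poly_Mapping.keys c \<subseteq> carrier A \<times> carrier M}"
  proof -
    have "carrier ?FA = {c. Poly_Mapping.keys c \<subseteq> carrier A \<times> carrier M}"
      by (rule Set.set_eqI) simp
    then show ?thesis by (simp add: tensor_product_def carrier_FactGroup setcompr_eq_image)
  qed
  show ?thesis
  proof (intro iffI allI impI)
    fix c assume inj: "inj_on (tensor_map R B M f) (carrier (tensor_product R A M))"
      and c: "Poly_Mapping.keys c \<subseteq> carrier A \<times> carrier M" "tensor_push f c \<in> ?KB"
    have "tensor_map R B M f (?KA #>\<^bsub>?FA\<^esub> c) = tensor_map R B M f (?KA #>\<^bsub>?FA\<^esub> 0)"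
      using c(2) by (simp add: map eqB tensor_push_simps)
    moreover have "?KA #>\<^bsub>?FA\<^esub> c \<in> carrier (tensor_product R A M)"
      "?KA #>\<^bsub>?FA\<^esub> 0 \<in> carrier (tensor_product R A M)"
      unfolding car by (rule CollectI, rule exI[of _ c], simp add: c, rule CollectI, rule exI[of _ 0], simp)
    ultimately have "?KA #>\<^bsub>?FA\<^esub> c = ?KA #>\<^bsub>?FA\<^esub> 0" using inj by (blast dest: inj_onD)
    then show "c \<in> ?KA" by (simp add: eqA)
  next
    assume *: "\<forall>c. Poly_Mapping.keys c \<subseteq> carrier A \<times> carrier M \<longrightarrow> tensor_push f c \<in> ?KB \<longrightarrow> c \<in> ?KA"
    have "?KA #>\<^bsub>?FA\<^esub> c = ?KA #>\<^bsub>?FA\<^esub> d"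
      if "Poly_Mapping.keys c \<subseteq> carrier A \<times> carrier M" "Poly_Mapping.keys d \<subseteq> carrier A \<times> carrier M"
        "tensor_map R B M f (?KA #>\<^bsub>?FA\<^esub> c) = tensor_map R B M f (?KA #>\<^bsub>?FA\<^esub> d)" for c d
    proof -
      have "Poly_Mapping.keys (c - d) \<subseteq> carrier A \<times> carrier M"
        using keys_diff[of c d] that by blast
      then show ?thesis using * that(3) by (simp add: map eqA eqB tensor_push_simps)
    qed
    then show "inj_on (tensor_map R B M f) (carrier (tensor_product R A M))"
      unfolding car inj_on_def by blast
  qed
qed

fun lin_comb :: "('r, 'b) module \<Rightarrow> 'r list \<Rightarrow> 'b list \<Rightarrow> 'b" where
  "lin_comb B (r # rs) (b # bs) = r \<odot>\<^bsub>B\<^esub> b \<oplus>\<^bsub>B\<^esub> lin_comb B rs bs"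
| "lin_comb B _ _ = \<zero>\<^bsub>B\<^esub>"

lemma fg_submodule:
  fixes B :: "('r, 'b) module"
  assumes B: "module R B" and S: "finite S" "S \<subseteq> carrier B"
  obtains H and \<rho> :: "'b \<Rightarrow> 'r list" where "submodule H R B" "S \<subseteq> H" "inj_on \<rho> H"
proof -
  interpret module R B by fact
  obtain bs where bs: "set bs = S" using S(1) finite_list by blast
  let ?e = "\<lambda>rs. lin_comb B rs bs" and ?L = "lists (carrier R)"
  have closed: "lin_comb B rs cs \<in> carrier B" if "set cs \<subseteq> carrier B" "rs \<in> ?L" for rs cs
    using that
  proof (induction cs arbitrary: rs)
    case (Cons c cs)
    then show ?case by (cases rs) auto
  qed simp
  have add: "\<exists>ts\<in>?L. lin_comb B rs cs \<oplus>\<^bsub>B\<^esub> lin_comb B ss cs = lin_comb B ts cs"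
    if "set cs \<subseteq> carrier B" "rs \<in> ?L" "ss \<in> ?L" for rs ss cs
    using that
  proof (induction cs arbitrary: rs ss)
    case Nil
    then show ?case by (intro bexI[of _ "[]"]) auto
  next
    case (Cons c cs)
    show ?case
    proof (cases "rs = [] \<or> ss = []")
      case True
      then show ?thesis using Cons.prems closed[of "c # cs" rs] closed[of "c # cs" ss] by auto
    next
      case False
      then obtain r rs' s ss' where rs: "rs = r # rs'" "ss = s # ss'" by (cases rs; cases ss; auto)
      then obtain ts where ts: "ts \<in> ?L" "lin_comb B rs' cs \<oplus>\<^bsub>B\<^esub> lin_comb B ss' cs = lin_comb B ts cs"
      proof -
        have "rs' \<in> ?L" "ss' \<in> ?L" "set cs \<subseteq> carrier B" using Cons.prems rs by auto
        then show ?thesis using Cons.IH[of rs' ss'] that by blast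
      qed
      have "lin_comb B rs' cs \<in> carrier B" "lin_comb B ss' cs \<in> carrier B" "c \<in> carrier B"
        "r \<in> carrier R" "s \<in> carrier R"
        using Cons.prems closed rs by auto
      then show ?thesis using ts rs
        by (intro bexI[of _ "(r \<oplus>\<^bsub>R\<^esub> s) # ts"]) (auto simp: smult_l_distr M.a_ac simp flip: ts(2))
    qed
  qed
  have smult: "r \<odot>\<^bsub>B\<^esub> lin_comb B rs cs = lin_comb B (map (\<lambda>s. r \<otimes>\<^bsub>R\<^esub> s) rs) cs"
    if "set cs \<subseteq> carrier B" "rs \<in> ?L" "r \<in> carrier R" for r rs cs
    using that
  proof (induction cs arbitrary: rs)
    case (Cons c cs)
    then show ?case using closed by (cases rs) (auto simp: smult_r_distr smult_assoc1)
  qed simp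
  have incl: "\<exists>rs\<in>?L. lin_comb B rs cs = b" if "set cs \<subseteq> carrier B" "b \<in> set cs" for b cs
    using that
  proof (induction cs)
    case (Cons c cs)
    show ?case
    proof (cases "b = c")
      case True
      then show ?thesis using Cons.prems by (intro bexI[of _ "[\<one>\<^bsub>R\<^esub>]"]) auto
    next
      case False
      then obtain rs where rs: "rs \<in> ?L" "lin_comb B rs cs = b" using Cons by auto
      then have "b \<in> carrier B" using closed[of cs rs] Cons.prems by auto
      then show ?thesis using rs Cons.prems by (intro bexI[of _ "\<zero>\<^bsub>R\<^esub> # rs"]) auto
    qed
  qed simp
  let ?H = "?e ` ?L"
  have H: "set bs \<subseteq> carrier B" using bs S by simp
  have sm: "r \<odot>\<^bsub>B\<^esub> b \<in> ?H" if "r \<in> carrier R" "b \<in> ?H" for r b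
    using that smult[OF H] by (auto intro!: image_eqI[of _ _ "map _ _"])
  have "submodule ?H R B"
  proof (rule submoduleI)
    show "?H \<subseteq> carrier B" using closed H by auto
    show "\<zero>\<^bsub>B\<^esub> \<in> ?H" by (intro image_eqI[of _ _ "[]"]) auto
    show "\<ominus>\<^bsub>B\<^esub> b \<in> ?H" if "b \<in> ?H" for b
    proof -
      have "b \<in> carrier B" using that closed H by auto
      then have "\<ominus>\<^bsub>B\<^esub> b = (\<ominus>\<^bsub>R\<^esub> \<one>\<^bsub>R\<^esub>) \<odot>\<^bsub>B\<^esub> b" by (simp add: smult_l_minus)
      then show ?thesis using sm[OF _ that, of "\<ominus>\<^bsub>R\<^esub> \<one>\<^bsub>R\<^esub>"] by simp
    qed
    show "a \<oplus>\<^bsub>B\<^esub> b \<in> ?H" if "a \<in> ?H" "b \<in> ?H" for a b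
      using that add[OF H] by fastforce
  qed (rule sm)
  moreover have "S \<subseteq> ?H" using incl[OF H] bs by force
  moreover have "inj_on (inv_into ?L ?e) ?H" by (simp add: inj_on_inv_into)
  ultimately show thesis using that by blast
qed

lemma tensor_kernel_finite_support:
  assumes B: "module R B" and M: "module R M" and c: "c \<in> tensor_kernel R B M"
  shows "\<exists>S. finite S \<and> S \<subseteq> carrier B \<and>
    (\<forall>H. submodule H R B \<longrightarrow> S \<subseteq> H \<longrightarrow> c \<in> tensor_kernel R (B\<lparr>carrier := H\<rparr>) M)"
  using B M c
proof (induction rule: tensor_kernel_induct)
  case zero
  show ?case using tensor_kernel_zero[OF submodule.submodule_is_module[OF _ B] M]
    by (intro exI[of _ "{}"]) auto
next
  case (rel c)
  interpret B: module R B by fact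
  interpret M: module R M by fact
  have main: "\<exists>S. finite S \<and> S \<subseteq> carrier B \<and>
      (\<forall>H. submodule H R B \<longrightarrow> S \<subseteq> H \<longrightarrow> c \<in> tensor_relations R (B\<lparr>carrier := H\<rparr>) M)"
    using rel[unfolded tensor_relations_def]
  proof (elim UnE CollectE exE conjE)
    fix x x' y assume "c = frag_of (x \<oplus>\<^bsub>B\<^esub> x', y) - frag_of (x, y) - frag_of (x', y)"
      "x \<in> carrier B" "x' \<in> carrier B" "y \<in> carrier M"
    then show ?thesis unfolding tensor_relations_def by (intro exI[of _ "{x, x'}"]) auto
  next
    fix x y y' assume "c = frag_of (x, y \<oplus>\<^bsub>M\<^esub> y') - frag_of (x, y) - frag_of (x, y')"
      "x \<in> carrier B" "y \<in> carrier M" "y' \<in> carrier M"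
    then show ?thesis unfolding tensor_relations_def by (intro exI[of _ "{x}"]) auto
  next
    fix r x y assume "c = frag_of (r \<odot>\<^bsub>B\<^esub> x, y) - frag_of (x, r \<odot>\<^bsub>M\<^esub> y)"
      "r \<in> carrier R" "x \<in> carrier B" "y \<in> carrier M"
    then show ?thesis unfolding tensor_relations_def by (intro exI[of _ "{x}"]) auto
  qed
  then show ?case using tensor_kernel_rel[OF submodule.submodule_is_module[OF _ B] M] by meson
next
  case (uminus c)
  then show ?case using tensor_kernel_uminus[OF submodule.submodule_is_module[OF _ B] M] by meson
next
  case (add c d)
  then obtain S T where "finite S" "S \<subseteq> carrier B" "finite T" "T \<subseteq> carrier B"
    "\<And>H. submodule H R B \<Longrightarrow> S \<subseteq> H \<Longrightarrow> c \<in> tensor_kernel R (B\<lparr>carrier := H\<rparr>) M"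
    "\<And>H. submodule H R B \<Longrightarrow> T \<subseteq> H \<Longrightarrow> d \<in> tensor_kernel R (B\<lparr>carrier := H\<rparr>) M"
    by blast
  then show ?case using tensor_kernel_add[OF submodule.submodule_is_module[OF _ B] M]
    by (intro exI[of _ "S \<union> T"]) auto
qed

lemma flat_moduleD:
  fixes M :: "('r, 'm) module" and A :: "('r, 'a) module" and B :: "('r, 'b) module"
  assumes flat: "flat_module R M" and A: "module R A" and B: "module R B"
    and f: "f \<in> module_hom R A B" and inj: "inj_on f (carrier A)"
  shows "inj_on (tensor_map R B M f) (carrier (tensor_product R A M))"
proof -
  have M: "module R M" using flat by (simp add: flat_module_def)
  interpret A: module R A by fact
  interpret B: module R B by fact
  note h = module_homD[OF f]
  have "c \<in> tensor_kernel R A M"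
    if c: "Poly_Mapping.keys c \<subseteq> carrier A \<times> carrier M" and fc: "tensor_push f c \<in> tensor_kernel R B M" for c
  proof -
    obtain S where S: "finite S" "S \<subseteq> carrier B"
      "\<And>H. submodule H R B \<Longrightarrow> S \<subseteq> H \<Longrightarrow> tensor_push f c \<in> tensor_kernel R (B\<lparr>carrier := H\<rparr>) M"
      using tensor_kernel_finite_support[OF B M fc] by blast
    let ?S = "S \<union> f ` fst ` Poly_Mapping.keys c"
    have "?S \<subseteq> carrier B" using S(2) c h by auto
    then obtain H and \<rho> :: "'b \<Rightarrow> 'r list" where H: "submodule H R B" "?S \<subseteq> H" "inj_on \<rho> H"
      using fg_submodule[OF B, of ?S] S(1) by auto
    note HE = B.submoduleE[OF H(1)]
    define A' where "A' = {a \<in> carrier A. f a \<in> H}"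
    have A'sub: "submodule A' R A"
    proof (rule A.submoduleI)
      show "\<zero>\<^bsub>A\<^esub> \<in> A'"
        using module_hom_zero[OF A B f] subgroup.one_closed[OF submodule.axioms(1)[OF H(1)]] by (simp add: A'_def)
      show "\<ominus>\<^bsub>A\<^esub> a \<in> A'" if "a \<in> A'" for a
      proof -
        have "a \<in> carrier A" "f a \<in> H" using that by (auto simp: A'_def)
        moreover from this have "\<ominus>\<^bsub>A\<^esub> a = (\<ominus>\<^bsub>R\<^esub> \<one>\<^bsub>R\<^esub>) \<odot>\<^bsub>A\<^esub> a" by (simp add: A.smult_l_minus)
        ultimately show ?thesis using h HE(4) by (auto simp: A'_def)
      qed
    qed (use h HE(4,5) in \<open>auto simp: A'_def\<close>)
    let ?A = "A\<lparr>carrier := A'\<rparr>" and ?B = "B\<lparr>carrier := H\<rparr>"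
    have mA: "module R ?A" using submodule.submodule_is_module[OF A'sub A] .
    have mB: "module R ?B" using submodule.submodule_is_module[OF H(1) B] .
    have f': "f \<in> module_hom R ?A ?B" using h by (intro module_homI) (auto simp: A'_def)
    have injA: "inj_on (\<rho> \<circ> f) (carrier ?A)"
      using inj H(3) by (auto simp: A'_def inj_on_def)
    have injB: "inj_on \<rho> (carrier ?B)" using H(3) by simp
    define \<alpha> where "\<alpha> = inv_into (carrier ?A) (\<rho> \<circ> f)"
    note cA = copy_module[OF mA injA, folded \<alpha>_def] and cB = copy_module[OF mB injB]
    let ?A' = "copy_module (\<rho> \<circ> f) ?A" and ?B' = "copy_module \<rho> ?B"
    have \<alpha>: "\<alpha> (\<rho> (f a)) = a" if "a \<in> A'" for a
      using inv_into_f_f[OF injA, of a] that by (simp add: \<alpha>_def)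
    have hom: "\<rho> \<circ> f \<circ> \<alpha> \<in> module_hom R ?A' ?B'"
      using module_hom_comp[OF module_hom_comp[OF cA(3) f'] cB(2)] by (simp add: comp_assoc)
    have "inj_on (\<rho> \<circ> f \<circ> \<alpha>) (carrier ?A')"
      unfolding cA(4) by (auto simp: inj_on_def \<alpha>)
    then have "inj_on (tensor_map R ?B' M (\<rho> \<circ> f \<circ> \<alpha>)) (carrier (tensor_product R ?A' M))"
      using flat[unfolded flat_module_def, THEN conjunct2, rule_format, OF hom cA(1) cB(1)] by blast
    note key = this[unfolded inj_on_tensor_map_iff[OF cA(1) cB(1) M hom], rule_format]
    have keys: "Poly_Mapping.keys c \<subseteq> A' \<times> carrier M" using c H(2) unfolding A'_def by force
    define c' where "c' = tensor_push (\<rho> \<circ> f) c"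
    have "tensor_push (\<rho> \<circ> f \<circ> \<alpha>) c' = tensor_push \<rho> (tensor_push f c)"
      unfolding c'_def tensor_push_push using keys by (rule tensor_push_cong) (simp add: \<alpha>)
    also have "\<dots> \<in> tensor_kernel R ?B' M"
      using tensor_push_kernel[OF mB cB(1) M cB(2)] S(3)[OF H(1)] H(2) by blast
    finally have "c' \<in> tensor_kernel R ?A' M"
      using key[of c'] tensor_push_keys[OF keys, of "\<rho> \<circ> f"] cA(4) by (simp add: c'_def)
    then have "tensor_push \<alpha> c' \<in> tensor_kernel R ?A M"
      by (rule tensor_push_kernel[OF cA(1) mA M cA(3)])
    moreover have "tensor_push \<alpha> c' = tensor_push (\<lambda>a. a) c"
      unfolding c'_def tensor_push_push using keys by (rule tensor_push_cong) (simp add: \<alpha>)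
    ultimately have "c \<in> tensor_kernel R ?A M" by (simp add: tensor_push_id)
    moreover have "(\<lambda>a. a) \<in> module_hom R ?A A" by (rule module_homI) (auto simp: A'_def)
    ultimately show ?thesis using tensor_push_kernel[OF mA A M, of "\<lambda>a. a" c] by (simp add: tensor_push_id)
  qed
  then show ?thesis unfolding inj_on_tensor_map_iff[OF A B M f] by blast
qed

subsection \<open>Ring epimorphisms\<close>

fun word_eval :: "('s, 'x) ring_scheme \<Rightarrow> ('u \<Rightarrow> 's) \<Rightarrow> ('u \<Rightarrow> 's) \<Rightarrow> 'u list \<Rightarrow> 's" where
  "word_eval S f g [] = \<one>\<^bsub>S\<^esub>"
| "word_eval S f g (a # w) = f a \<otimes>\<^bsub>S\<^esub> word_eval S g f w"

definition words_eval :: "('s, 'x) ring_scheme \<Rightarrow> ('u \<Rightarrow> 's) \<Rightarrow> ('u \<Rightarrow> 's) \<Rightarrow> 'u list list \<Rightarrow> 's" where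
  "words_eval S f g ws = foldr (\<lambda>w s. word_eval S f g w \<oplus>\<^bsub>S\<^esub> s) ws \<zero>\<^bsub>S\<^esub>"

lemma ring_epimorphismD:
  fixes S :: "'s ring" and U :: "'u ring"
  assumes epi: "ring_epimorphism R U u" and U: "ring U" and S: "ring S"
    and f: "f \<in> ring_hom U S" and g: "g \<in> ring_hom U S"
    and fg: "\<forall>r\<in>carrier R. f (u r) = g (u r)" and x: "x \<in> carrier U"
  shows "f x = g x"
proof -
  interpret S: ring S by fact
  interpret U: ring U by fact
  have closed: "f a \<in> carrier S" "g a \<in> carrier S" if "a \<in> carrier U" for a
    using that f g by (auto simp: ring_hom_def)
  have one: "f \<one>\<^bsub>U\<^esub> = \<one>\<^bsub>S\<^esub>" "g \<one>\<^bsub>U\<^esub> = \<one>\<^bsub>S\<^esub>"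
    using f g by (auto simp: ring_hom_def)
  let ?W = "lists (carrier U)"
  have wc: "word_eval S p q w \<in> carrier S"
    if "w \<in> ?W" "\<And>a. a \<in> carrier U \<Longrightarrow> p a \<in> carrier S" "\<And>a. a \<in> carrier U \<Longrightarrow> q a \<in> carrier S" for p q w
    using that by (induction w arbitrary: p q) auto
  have wm: "\<exists>w''\<in>?W. word_eval S p q w \<otimes>\<^bsub>S\<^esub> word_eval S f g w' = word_eval S p q w''"
    if "w \<in> ?W" "w' \<in> ?W" "(p = f \<and> q = g) \<or> (p = g \<and> q = f)" for p q w w'
    using that
  proof (induction w arbitrary: p q)
    case Nil
    show ?case
    proof (cases "p = f \<and> q = g")
      case True
      then show ?thesis using Nil closed wc[of w' f g] by (intro bexI[of _ w']) auto
    next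
      case False
      then show ?thesis using Nil closed one wc[of w' f g]
        by (intro bexI[of _ "\<one>\<^bsub>U\<^esub> # w'"]) auto
    qed
  next
    case (Cons a w)
    then obtain w'' where w'': "w'' \<in> ?W"
        "word_eval S q p w \<otimes>\<^bsub>S\<^esub> word_eval S f g w' = word_eval S q p w''"
    proof -
      show ?thesis using Cons.IH[of q p] Cons.prems that by blast
    qed
    have "p a \<in> carrier S" "word_eval S q p w \<in> carrier S" "word_eval S f g w' \<in> carrier S"
      using Cons.hyps Cons.prems closed wc[of w q p] wc[of w' f g] by auto
    then show ?case using Cons.hyps Cons.prems closed w'' by (intro bexI[of _ "a # w''"]) (auto simp: S.m_assoc)
  qed
  let ?w = "word_eval S f g" and ?e = "words_eval S f g"
  have e_simps [simp]: "?e [] = \<zero>\<^bsub>S\<^esub>" "?e (w # ws) = ?w w \<oplus>\<^bsub>S\<^esub> ?e ws" for w ws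
    by (simp_all add: words_eval_def)
  have wc [simp]: "?w w \<in> carrier S" if "w \<in> ?W" for w
    using that wc closed by blast
  have ec [simp]: "?e ws \<in> carrier S" if "ws \<in> lists ?W" for ws
    using that by (induction ws) auto
  have app: "?e (ws @ vs) = ?e ws \<oplus>\<^bsub>S\<^esub> ?e vs" if "ws \<in> lists ?W" "vs \<in> lists ?W" for ws vs
    using that by (induction ws) (auto simp: S.a_assoc)
  define T where "T = ?e ` lists ?W"
  have T_carrier: "T \<subseteq> carrier S" unfolding T_def using ec by blast
  have T_word: "?w w \<in> T" if "w \<in> ?W" for w
    unfolding T_def using that by (intro image_eqI[of _ _ "[w]"]) auto
  have T_zero: "\<zero>\<^bsub>S\<^esub> \<in> T" unfolding T_def by (intro image_eqI[of _ _ "[]"]) auto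
  have T_add: "a \<oplus>\<^bsub>S\<^esub> b \<in> T" if "a \<in> T" "b \<in> T" for a b
  proof -
    obtain ws vs where *: "ws \<in> lists ?W" "vs \<in> lists ?W" "a = ?e ws" "b = ?e vs"
      using \<open>a \<in> T\<close> \<open>b \<in> T\<close> unfolding T_def by (elim imageE)
    show ?thesis unfolding T_def *(3,4) app[OF *(1,2), symmetric]
      by (rule imageI) (simp only: append_in_lists_conv *(1,2) simp_thms)
  qed
  have T_wm: "?w w \<otimes>\<^bsub>S\<^esub> ?e vs \<in> T" if "w \<in> ?W" "vs \<in> lists ?W" for w vs
    using that(2)
  proof (induction vs)
    case Nil
    then show ?case using that T_zero by simp
  next
    case (Cons v vs)
    obtain v' where "v' \<in> ?W" "?w w \<otimes>\<^bsub>S\<^esub> ?w v = ?w v'"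
      using wm[of w v f g] \<open>w \<in> ?W\<close> Cons.hyps by blast
    then show ?case using Cons that T_word T_add by (simp add: S.r_distr)
  qed
  have T_mult: "a \<otimes>\<^bsub>S\<^esub> b \<in> T" if "a \<in> T" "b \<in> T" for a b
  proof -
    obtain ws vs where *: "ws \<in> lists ?W" "vs \<in> lists ?W" "a = ?e ws" "b = ?e vs"
      using \<open>a \<in> T\<close> \<open>b \<in> T\<close> unfolding T_def by (elim imageE)
    from *(1) have "?e ws \<otimes>\<^bsub>S\<^esub> ?e vs \<in> T"
      using *(2) T_zero by (induction ws) (auto simp: S.l_distr T_wm T_add)
    then show ?thesis using * by simp
  qed
  have T_f: "f a \<in> T" if "a \<in> carrier U" for a
    using T_word[of "[a]"] that closed by simp
  have T_g: "g a \<in> T" if "a \<in> carrier U" for a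
    using T_word[of "[\<one>\<^bsub>U\<^esub>, a]"] that closed one by simp
  have neg: "f (\<ominus>\<^bsub>U\<^esub> \<one>\<^bsub>U\<^esub>) = \<ominus>\<^bsub>S\<^esub> \<one>\<^bsub>S\<^esub>"
  proof -
    have "f (\<ominus>\<^bsub>U\<^esub> \<one>\<^bsub>U\<^esub>) \<oplus>\<^bsub>S\<^esub> f \<one>\<^bsub>U\<^esub> = f (\<ominus>\<^bsub>U\<^esub> \<one>\<^bsub>U\<^esub> \<oplus>\<^bsub>U\<^esub> \<one>\<^bsub>U\<^esub>)"
      using f by (simp add: ring_hom_add)
    also have "\<dots> = \<zero>\<^bsub>S\<^esub>" using ring_hom_zero[OF f U S] by (simp add: U.l_neg)
    finally show ?thesis using one closed by (metis S.minus_equality S.one_closed U.a_inv_closed U.one_closed)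
  qed
  have T_neg: "\<ominus>\<^bsub>S\<^esub> a \<in> T" if "a \<in> T" for a
    using T_mult[OF T_f[of "\<ominus>\<^bsub>U\<^esub> \<one>\<^bsub>U\<^esub>"] that] that T_carrier neg by (auto simp: S.l_minus)
  have "subring T S"
    using T_carrier T_f[of "\<one>\<^bsub>U\<^esub>"] one T_neg T_mult T_add by (intro S.subringI) auto
  then interpret T: ring "S\<lparr>carrier := T\<rparr>" by (rule S.subring_is_ring)
  define \<phi> where "\<phi> = inv_into (lists ?W) ?e"
  have inj: "inj_on \<phi> (carrier (S\<lparr>carrier := T\<rparr>))"
    unfolding \<phi>_def T_def by (simp add: inj_on_inv_into)
  let ?S = "image_ring \<phi> (S\<lparr>carrier := T\<rparr>)"
  have S': "ring ?S" using T.inj_imp_image_ring_is_ring[OF inj] .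
  have \<phi>: "\<phi> \<in> ring_hom (S\<lparr>carrier := T\<rparr>) ?S"
    using inj_imp_image_ring_iso[OF inj] by (simp add: ring_iso_def)
  have "f \<in> ring_hom U (S\<lparr>carrier := T\<rparr>)" "g \<in> ring_hom U (S\<lparr>carrier := T\<rparr>)"
    using f g T_f T_g by (auto simp: ring_hom_def)
  then have hom: "\<phi> \<circ> f \<in> ring_hom U ?S" "\<phi> \<circ> g \<in> ring_hom U ?S"
    using \<phi> by (auto intro: ring_hom_trans)
  have "(\<phi> \<circ> f) x = (\<phi> \<circ> g) x"
    using epi[unfolded ring_epimorphism_def, THEN conjunct2, rule_format, OF S' hom _ x] fg by simp
  then show ?thesis using inj T_f[OF x] T_g[OF x] by (auto dest: inj_onD)
qed

subsection \<open>Divisible preenvelopes\<close>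

definition pair_sum :: "('r, 'a) module \<Rightarrow> ('r \<times> 'a) list \<Rightarrow> 'a" where
  "pair_sum M ps = foldr (\<lambda>(r, x) y. r \<odot>\<^bsub>M\<^esub> x \<oplus>\<^bsub>M\<^esub> y) ps \<zero>\<^bsub>M\<^esub>"

lemma pair_sum_simps [simp]:
  "pair_sum M [] = \<zero>\<^bsub>M\<^esub>" "pair_sum M ((r, x) # ps) = r \<odot>\<^bsub>M\<^esub> x \<oplus>\<^bsub>M\<^esub> pair_sum M ps"
  by (simp_all add: pair_sum_def)

lemma pair_sum_closed:
  assumes "module R M" "set ps \<subseteq> carrier R \<times> carrier M"
  shows "pair_sum M ps \<in> carrier M"
proof -
  interpret module R M by fact
  show ?thesis using assms(2) by (induction ps) auto
qed

lemma pair_sum_append: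
  assumes "module R M" "set ps \<subseteq> carrier R \<times> carrier M" "set qs \<subseteq> carrier R \<times> carrier M"
  shows "pair_sum M (ps @ qs) = pair_sum M ps \<oplus>\<^bsub>M\<^esub> pair_sum M qs"
proof -
  interpret module R M by fact
  show ?thesis using assms(2,3)
    by (induction ps) (auto simp: M.a_assoc pair_sum_closed[OF assms(1)])
qed

lemma pair_sum_smult:
  assumes "module R M" "set ps \<subseteq> carrier R \<times> carrier M" "r \<in> carrier R"
  shows "r \<odot>\<^bsub>M\<^esub> pair_sum M ps = pair_sum M (map (\<lambda>(s, x). (r \<otimes>\<^bsub>R\<^esub> s, x)) ps)"
proof -
  interpret module R M by fact
  show ?thesis using assms(2,3)
    by (induction ps) (auto simp: smult_r_distr smult_assoc1 pair_sum_closed[OF assms(1)])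
qed

lemma pair_sum_hom:
  assumes "module R M" "module R N" "h \<in> module_hom R M N" "set ps \<subseteq> carrier R \<times> carrier M"
  shows "h (pair_sum M ps) = pair_sum N (map (\<lambda>(s, x). (s, h x)) ps)"
proof -
  interpret M: module R M by fact
  show ?thesis using assms(4)
    by (induction ps)
      (auto simp: module_hom_zero[OF assms(1-3)] module_homD[OF assms(3)] pair_sum_closed[OF assms(1)])
qed

lemma ideal_times_iff:
  assumes M: "module R M" and J: "ideal J R"
  shows "y \<in> ideal_times J M \<longleftrightarrow> (\<exists>ps. set ps \<subseteq> J \<times> carrier M \<and> y = pair_sum M ps)"
proof -
  interpret module R M by fact
  interpret J: ideal J R by fact
  let ?G = "{r \<odot>\<^bsub>M\<^esub> x | r x. r \<in> J \<and> x \<in> carrier M}"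
  have JR: "J \<times> carrier M \<subseteq> carrier R \<times> carrier M" using J.a_subset by auto
  show ?thesis
  proof
    assume "y \<in> ideal_times J M"
    then show "\<exists>ps. set ps \<subseteq> J \<times> carrier M \<and> y = pair_sum M ps"
      unfolding ideal_times_def
    proof (induction rule: generate.induct)
      case one
      show ?case by (intro exI[of _ "[]"]) auto
    next
      case (incl h)
      then obtain r x where "r \<in> J" "x \<in> carrier M" "h = r \<odot>\<^bsub>M\<^esub> x" by auto
      then show ?case using J.a_subset by (intro exI[of _ "[(r, x)]"]) auto
    next
      case (inv h)
      then obtain r x where rx: "r \<in> J" "x \<in> carrier M" "h = r \<odot>\<^bsub>M\<^esub> x" by auto
      have "\<ominus>\<^bsub>M\<^esub> h = (\<ominus>\<^bsub>R\<^esub> r) \<odot>\<^bsub>M\<^esub> x" using rx J.a_subset by (auto simp: smult_l_minus)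
      then show ?case using J.a_subset rx
        by (intro exI[of _ "[(\<ominus>\<^bsub>R\<^esub> r, x)]"]) (auto simp: a_inv_def[of M, symmetric])
    next
      case (eng h1 h2)
      then obtain ps qs where "set ps \<subseteq> J \<times> carrier M" "h1 = pair_sum M ps"
        "set qs \<subseteq> J \<times> carrier M" "h2 = pair_sum M qs" by blast
      then show ?case using pair_sum_append[OF M, of ps qs] JR by (intro exI[of _ "ps @ qs"]) auto
    qed
  next
    assume "\<exists>ps. set ps \<subseteq> J \<times> carrier M \<and> y = pair_sum M ps"
    then obtain ps where ps: "set ps \<subseteq> J \<times> carrier M" and y: "y = pair_sum M ps" by auto
    from ps show "y \<in> ideal_times J M" unfolding y ideal_times_def
    proof (induction ps)
      case Nil
      show ?case using generate.one[of "add_monoid M" ?G] by simp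
    next
      case (Cons p ps)
      obtain r x where p: "p = (r, x)" by (cases p)
      have "r \<odot>\<^bsub>M\<^esub> x \<in> generate (add_monoid M) ?G" using Cons.prems p by (intro generate.incl) auto
      then show ?case using generate.eng[of "r \<odot>\<^bsub>M\<^esub> x" "add_monoid M" ?G] Cons p by simp
    qed
  qed
qed

lemma ideal_times_eq_iff:
  assumes M: "module R M" and J: "ideal J R"
  shows "ideal_times J M = carrier M \<longleftrightarrow>
    (\<forall>y\<in>carrier M. \<exists>ps. set ps \<subseteq> J \<times> carrier M \<and> y = pair_sum M ps)"
proof -
  have "J \<subseteq> carrier R" using additive_subgroup.a_subset[OF ideal.axioms(1)[OF J]] .
  then have "pair_sum M ps \<in> carrier M" if "set ps \<subseteq> J \<times> carrier M" for ps
    using that by (intro pair_sum_closed[OF M]) auto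
  then have "ideal_times J M \<subseteq> carrier M"
    using ideal_times_iff[OF M J] by (intro subsetI) auto
  then show ?thesis using ideal_times_iff[OF M J] by blast
qed

lemma divisible_surj:
  assumes \<G>: "\<And>J. J \<in> \<G> \<Longrightarrow> ideal J R"
    and M: "M \<in> divisible_modules R \<G>" and N: "module R N"
    and h: "h \<in> module_hom R M N" and surj: "carrier N \<subseteq> h ` carrier M"
  shows "N \<in> divisible_modules R \<G>"
proof -
  have M': "module R M" using M by (simp add: divisible_modules_def)
  have "ideal_times J N = carrier N" if J: "J \<in> \<G>" for J
    unfolding ideal_times_eq_iff[OF N \<G>[OF J]]
  proof
    fix y assume "y \<in> carrier N"
    then obtain x where x: "x \<in> carrier M" "y = h x" using surj by auto
    obtain ps where ps: "set ps \<subseteq> J \<times> carrier M" "x = pair_sum M ps"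
      using x M J ideal_times_eq_iff[OF M' \<G>[OF J]] by (auto simp: divisible_modules_def)
    have JR: "J \<subseteq> carrier R" using additive_subgroup.a_subset[OF ideal.axioms(1)[OF \<G>[OF J]]] .
    have "y = pair_sum N (map (\<lambda>(s, x). (s, h x)) ps)"
      using ps x JR by (auto intro!: pair_sum_hom[OF M' N h])
    moreover have "set (map (\<lambda>(s, x). (s, h x)) ps) \<subseteq> J \<times> carrier N"
      using ps module_homD(1)[OF h] by auto
    ultimately show "\<exists>ps. set ps \<subseteq> J \<times> carrier N \<and> y = pair_sum N ps" by blast
  qed
  then show ?thesis using N by (simp add: divisible_modules_def)
qed

lemma restrict_scalars_simps [simp]:
  "carrier (restrict_scalars U u) = carrier U" "\<zero>\<^bsub>restrict_scalars U u\<^esub> = \<zero>\<^bsub>U\<^esub>"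
  "x \<oplus>\<^bsub>restrict_scalars U u\<^esub> y = x \<oplus>\<^bsub>U\<^esub> y" "r \<odot>\<^bsub>restrict_scalars U u\<^esub> x = u r \<otimes>\<^bsub>U\<^esub> x"
  by (simp_all add: restrict_scalars_def)

lemma module_restrict_scalars:
  assumes "cring R" "cring U" "u \<in> ring_hom R U"
  shows "module R (restrict_scalars U u)"
proof -
  interpret R: cring R by fact
  interpret U: cring U by fact
  note h = ring_hom_closed[OF assms(3)] ring_hom_add[OF assms(3)] ring_hom_mult[OF assms(3)] ring_hom_one[OF assms(3)]
  have "abelian_group (restrict_scalars U u)"
  proof (rule abelian_groupI)
    fix x assume "x \<in> carrier (restrict_scalars U u)"
    then show "\<exists>y\<in>carrier (restrict_scalars U u). y \<oplus>\<^bsub>restrict_scalars U u\<^esub> x = \<zero>\<^bsub>restrict_scalars U u\<^esub>"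
      by (intro bexI[of _ "\<ominus>\<^bsub>U\<^esub> x"]) (auto simp: U.l_neg)
  qed (auto simp: U.a_ac)
  then show ?thesis
    by (rule moduleI[OF assms(1)]) (auto simp: h U.l_distr U.r_distr U.m_assoc)
qed

text \<open>The ideals in the Gabriel topology contain finitely generated ones.\<close>

lemma gabriel_fg:
  assumes R: "cring R" and U: "cring U" and u: "u \<in> ring_hom R U" and J: "J \<in> gabriel_topology R U u"
  shows "\<exists>js. set js \<subseteq> J \<and> genideal R (set js) \<in> gabriel_topology R U u"
proof -
  interpret R: cring R by fact
  interpret U: cring U by fact
  let ?U = "restrict_scalars U u"
  have M: "module R ?U" by (rule module_restrict_scalars[OF R U u])
  have idJ: "ideal J R" using J by (simp add: gabriel_topology_def)
  have JR: "J \<subseteq> carrier R" using additive_subgroup.a_subset[OF ideal.axioms(1)[OF idJ]] .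
  have "ideal_times J ?U = carrier ?U" using J by (simp add: gabriel_topology_def)
  then have "\<exists>ps. set ps \<subseteq> J \<times> carrier ?U \<and> \<one>\<^bsub>U\<^esub> = pair_sum ?U ps"
    unfolding ideal_times_eq_iff[OF M idJ] by (rule bspec) simp
  then obtain ps where ps: "set ps \<subseteq> J \<times> carrier U" "\<one>\<^bsub>U\<^esub> = pair_sum ?U ps"
    by auto
  define js where "js = map fst ps"
  have js: "set js \<subseteq> J" using ps by (auto simp: js_def)
  then have jsR: "set js \<subseteq> carrier R" using JR by auto
  have idI: "ideal (genideal R (set js)) R" by (rule R.genideal_ideal[OF jsR])
  have ps': "set ps \<subseteq> genideal R (set js) \<times> carrier U"
    using ps R.genideal_self[OF jsR] by (auto simp: js_def)
  have "\<exists>qs. set qs \<subseteq> genideal R (set js) \<times> carrier ?U \<and> y = pair_sum ?U qs" if y: "y \<in> carrier U" for y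
  proof -
    have "(\<lambda>v. v \<otimes>\<^bsub>U\<^esub> y) \<in> module_hom R ?U ?U"
      using y ring_hom_closed[OF u] by (intro module_homI) (auto simp: U.l_distr U.m_assoc)
    moreover have "set ps \<subseteq> carrier R \<times> carrier ?U" using ps(1) JR by auto
    ultimately have "pair_sum ?U ps \<otimes>\<^bsub>U\<^esub> y = pair_sum ?U (map (\<lambda>(s, x). (s, x \<otimes>\<^bsub>U\<^esub> y)) ps)"
      by (rule pair_sum_hom[OF M M])
    then have "y = pair_sum ?U (map (\<lambda>(s, x). (s, x \<otimes>\<^bsub>U\<^esub> y)) ps)"
      using y by (simp flip: ps(2))
    moreover have "set (map (\<lambda>(s, x). (s, x \<otimes>\<^bsub>U\<^esub> y)) ps) \<subseteq> genideal R (set js) \<times> carrier ?U"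
      using ps' y by auto
    ultimately show ?thesis by blast
  qed
  then have "ideal_times (genideal R (set js)) ?U = carrier ?U"
    unfolding ideal_times_eq_iff[OF M idI] by simp
  then show ?thesis using js idI by (auto simp: gabriel_topology_def)
qed

text \<open>A divisible submodule generated by \<open>x\<close>. Its elements are the results of programs for a stack
  machine: the first component of the state is a stack of module elements, the second a register
  of ring elements, and \<open>W y js\<close> writes \<open>y\<close> as a combination over the ideal generated by \<open>js\<close>.\<close>

fun machine :: "('r, 'a) module \<Rightarrow> 'a \<Rightarrow> ('a \<Rightarrow> 'r list \<Rightarrow> ('r \<times> 'a) list) \<Rightarrow>
    'a list \<times> 'r list \<Rightarrow> 'r + nat \<Rightarrow> 'a list \<times> 'r list" where
  "machine M x W (s, q) (Inl r) = (s, r # q)"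
| "machine M x W (s, q) (Inr 0) = (x # s, q)"
| "machine M x W (a # b # s, q) (Inr (Suc 0)) = ((b \<oplus>\<^bsub>M\<^esub> a) # s, q)"
| "machine M x W (a # s, r # q) (Inr (Suc (Suc 0))) = ((r \<odot>\<^bsub>M\<^esub> a) # s, q)"
| "machine M x W (a # s, q) (Inr (Suc (Suc (Suc k)))) = (snd (W a q ! k) # s, [])"
| "machine M x W st i = st"

lemma divisible_hull:
  fixes M :: "('r, 'a) module"
  assumes R: "cring R" and U: "cring U" and u: "u \<in> ring_hom R U"
    and M: "M \<in> divisible_modules R (gabriel_topology R U u)" and x: "x \<in> carrier M"
  obtains H and \<rho> :: "'a \<Rightarrow> ('r + nat) list" where "submodule H R M" "x \<in> H"
    "M\<lparr>carrier := H\<rparr> \<in> divisible_modules R (gabriel_topology R U u)" "inj_on \<rho> H"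
proof -
  let ?G = "gabriel_topology R U u"
  have M': "module R M" using M by (simp add: divisible_modules_def)
  interpret module R M by fact
  define W where "W y js = (SOME ps. set ps \<subseteq> genideal R (set js) \<times> carrier M \<and> y = pair_sum M ps)" for y js
  define run where "run l st = foldl (machine M x W) st l" for l st
  have run_append: "run (l @ l') st = run l' (run l st)" for l l' st by (simp add: run_def)
  have run_Inl: "run (map Inl rs) (s, q) = (s, rev rs @ q)" for rs s q
    by (induction rs arbitrary: q) (auto simp: run_def)
  define good where "good z = (\<exists>l. \<forall>s. run l (s, []) = (z # s, []))" for z
  define H where "H = {z \<in> carrier M. good z}"
  have good_x: "good x" unfolding good_def by (intro exI[of _ "[Inr 0]"]) (simp add: run_def)
  have good_add: "good (a \<oplus>\<^bsub>M\<^esub> b)" if "good a" "good b" for a b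
  proof -
    obtain k l where "\<And>s. run k (s, []) = (a # s, [])" "\<And>s. run l (s, []) = (b # s, [])"
      using \<open>good a\<close> \<open>good b\<close> unfolding good_def by blast
    then have "run (k @ l @ [Inr (Suc 0)]) (s, []) = ((a \<oplus>\<^bsub>M\<^esub> b) # s, [])" for s
      by (simp add: run_append) (simp add: run_def)
    then show ?thesis unfolding good_def by blast
  qed
  have good_smult: "good (r \<odot>\<^bsub>M\<^esub> a)" if "good a" for r a
  proof -
    obtain k where "\<And>s. run k (s, []) = (a # s, [])" using \<open>good a\<close> unfolding good_def by blast
    then have "run (k @ [Inl r, Inr (Suc (Suc 0))]) (s, []) = ((r \<odot>\<^bsub>M\<^esub> a) # s, [])" for s
      by (simp add: run_append) (simp add: run_def)
    then show ?thesis unfolding good_def by blast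
  qed
  have good_W: "good (snd (W a js ! n))" if "good a" for a js n
  proof -
    obtain k where "\<And>s. run k (s, []) = (a # s, [])" using \<open>good a\<close> unfolding good_def by blast
    then have "run (k @ map Inl (rev js) @ [Inr (Suc (Suc (Suc n)))]) (s, []) = (snd (W a js ! n) # s, [])" for s
      by (simp add: run_append run_Inl) (simp add: run_def)
    then show ?thesis unfolding good_def by blast
  qed
  have sub: "submodule H R M"
  proof (rule submoduleI)
    have "\<zero>\<^bsub>R\<^esub> \<odot>\<^bsub>M\<^esub> x = \<zero>\<^bsub>M\<^esub>" using x by simp
    then show "\<zero>\<^bsub>M\<^esub> \<in> H" using good_smult[OF good_x, of "\<zero>\<^bsub>R\<^esub>"] by (simp add: H_def)
    show "\<ominus>\<^bsub>M\<^esub> a \<in> H" if "a \<in> H" for a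
    proof -
      have a: "a \<in> carrier M" "good a" using that by (auto simp: H_def)
      then have "\<ominus>\<^bsub>M\<^esub> a = (\<ominus>\<^bsub>R\<^esub> \<one>\<^bsub>R\<^esub>) \<odot>\<^bsub>M\<^esub> a" by (simp add: smult_l_minus)
      then show ?thesis using a good_smult[OF a(2), of "\<ominus>\<^bsub>R\<^esub> \<one>\<^bsub>R\<^esub>"] by (simp add: H_def)
    qed
  qed (auto simp: H_def good_add good_smult)
  let ?H = "M\<lparr>carrier := H\<rparr>"
  have mH: "module R ?H" by (rule submodule.submodule_is_module[OF sub M'])
  have psH: "pair_sum ?H ps = pair_sum M ps" for ps by (simp add: pair_sum_def)
  have "ideal_times J ?H = carrier ?H" if J: "J \<in> ?G" for J
  proof -
    have idJ: "ideal J R" using J by (simp add: gabriel_topology_def)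
    obtain js where js: "set js \<subseteq> J" "genideal R (set js) \<in> ?G" using gabriel_fg[OF R U u J] by blast
    let ?I = "genideal R (set js)"
    have idI: "ideal ?I R" using js(2) by (simp add: gabriel_topology_def)
    have IJ: "?I \<subseteq> J" using js(1) idJ by (rule R.genideal_minimal[rotated])
    show ?thesis unfolding ideal_times_eq_iff[OF mH idJ]
    proof
      fix y assume "y \<in> carrier ?H"
      then have y: "y \<in> carrier M" "good y" by (auto simp: H_def)
      have "ideal_times ?I M = carrier M" using M js(2) by (simp add: divisible_modules_def)
      then have "\<exists>ps. set ps \<subseteq> ?I \<times> carrier M \<and> y = pair_sum M ps"
        using ideal_times_eq_iff[OF M' idI] y by blast
      then have W: "set (W y js) \<subseteq> ?I \<times> carrier M" "y = pair_sum M (W y js)"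
        unfolding W_def by (metis (mono_tags, lifting) someI_ex)+
      have "set (W y js) \<subseteq> J \<times> H"
      proof
        fix p assume p: "p \<in> set (W y js)"
        then obtain n where "p = W y js ! n" by (auto simp: in_set_conv_nth)
        then have "good (snd p)" using good_W[OF y(2)] by simp
        then show "p \<in> J \<times> H" using p W(1) IJ by (cases p) (auto simp: H_def)
      qed
      then show "\<exists>ps. set ps \<subseteq> J \<times> carrier ?H \<and> y = pair_sum ?H ps"
        using W(2) psH by auto
    qed
  qed
  then have div: "?H \<in> divisible_modules R ?G" using mH by (simp add: divisible_modules_def)
  define \<rho> where "\<rho> z = (SOME l. \<forall>s. run l (s, []) = (z # s, []))" for z
  have \<rho>: "run (\<rho> z) ([], []) = ([z], [])" if "good z" for z
    using that unfolding good_def \<rho>_def by (rule someI2_ex) simp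
  have "inj_on \<rho> H"
  proof (rule inj_onI)
    fix y z assume "y \<in> H" "z \<in> H" "\<rho> y = \<rho> z"
    have "good y" "good z" using \<open>y \<in> H\<close> \<open>z \<in> H\<close> unfolding H_def by blast+
    have "([y], []) = run (\<rho> y) ([], [])" by (rule \<rho>[OF \<open>good y\<close>, symmetric])
    also have "\<dots> = ([z], [])" unfolding \<open>\<rho> y = \<rho> z\<close> by (rule \<rho>[OF \<open>good z\<close>])
    finally show "y = z" by simp
  qed
  moreover have "x \<in> H" using x good_x by (simp add: H_def)
  ultimately show thesis using that[OF sub _ div] by blast
qed

lemma divisible_preenvelopeD:
  fixes C :: "('r, ('r, 'm) univ) module" and M :: "('r, 'a) module"
  assumes R: "cring R" and U: "cring U" and u: "u \<in> ring_hom R U"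
    and C: "preenvelope R (divisible_modules R (gabriel_topology R U u)) (regular_module R) C \<mu>"
    and M: "M \<in> divisible_modules R (gabriel_topology R U u)"
    and f: "f \<in> module_hom R (regular_module R) M"
  shows "\<exists>g\<in>module_hom R C M. \<forall>r\<in>carrier R. g (\<mu> r) = f r"
proof -
  let ?G = "gabriel_topology R U u"
  interpret R: cring R by fact
  have reg [simp]: "carrier (regular_module R) = carrier R" "r \<odot>\<^bsub>regular_module R\<^esub> s = r \<otimes>\<^bsub>R\<^esub> s"
    "r \<oplus>\<^bsub>regular_module R\<^esub> s = r \<oplus>\<^bsub>R\<^esub> s" for r s
    by (simp_all add: regular_module_def)
  note h = module_homD[OF f, simplified]
  have M': "module R M" using M by (simp add: divisible_modules_def)
  obtain H and \<rho> :: "'a \<Rightarrow> ('r + nat) list" where H: "submodule H R M" "f \<one>\<^bsub>R\<^esub> \<in> H"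
    "M\<lparr>carrier := H\<rparr> \<in> divisible_modules R ?G" "inj_on \<rho> H"
    using divisible_hull[OF R U u M h(1)[OF R.one_closed]] by blast
  let ?H = "M\<lparr>carrier := H\<rparr>"
  define \<phi> :: "'a \<Rightarrow> ('r, 'm) univ" where "\<phi> = Inr \<circ> \<rho>"
  have mH: "module R ?H" using H(3) by (simp add: divisible_modules_def)
  have inj: "inj_on \<phi> (carrier ?H)" using H(4) by (auto simp: \<phi>_def inj_on_def)
  note c = copy_module[OF mH inj]
  have div: "copy_module \<phi> ?H \<in> divisible_modules R ?G"
    using divisible_surj[OF _ H(3) c(1,2)] c(4) by (simp add: gabriel_topology_def)
  have fH: "f r \<in> H" if "r \<in> carrier R" for r
    using h(3)[of r "\<one>\<^bsub>R\<^esub>"] that submodule.smult_closed[OF H(1) that H(2)] by simp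
  then have "f \<in> module_hom R (regular_module R) ?H" using h by (intro module_homI) auto
  from module_hom_comp[OF this c(2)] have "\<phi> \<circ> f \<in> module_hom R (regular_module R) (copy_module \<phi> ?H)" .
  then have "\<exists>g\<in>module_hom R C (copy_module \<phi> ?H). \<forall>r\<in>carrier (regular_module R). g (\<mu> r) = (\<phi> \<circ> f) r"
    using C[unfolded preenvelope_def] div by blast
  then obtain g where
    g: "g \<in> module_hom R C (copy_module \<phi> ?H)" "\<And>r. r \<in> carrier R \<Longrightarrow> g (\<mu> r) = \<phi> (f r)"
    by auto
  have incl: "(\<lambda>a. a) \<in> module_hom R ?H M"
    using module.submoduleE(1)[OF M' H(1)] by (intro module_homI) auto
  let ?g = "(\<lambda>a. a) \<circ> (inv_into H \<phi> \<circ> g)"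
  have "?g \<in> module_hom R C M"
    using module_hom_comp[OF module_hom_comp[OF g(1) c(3)] incl] by simp
  moreover have "?g (\<mu> r) = f r" if "r \<in> carrier R" for r
    using that g(2) inv_into_f_f[OF inj, of "f r"] fH by simp
  ultimately show ?thesis by blast
qed

end

theory Submission
  imports Defs
begin

text \<open>
  Let \<open>\<mu> : R \<rightarrow> D\<close> be the envelope and \<open>J \<in> \<G>\<close>. As \<open>JD = D\<close>, write \<open>\<mu> 1 = \<Sum> a\<^sub>i x\<^sub>i\<close> with \<open>a\<^sub>i \<in> J\<close>; the
  preenvelope property gives endomorphisms \<open>g\<^sub>i\<close> of \<open>D\<close> with \<open>g\<^sub>i (\<mu> 1) = x\<^sub>i\<close>, and \<open>\<Sum> a\<^sub>i g\<^sub>i\<close> fixes \<open>\<mu> 1\<close>, hence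
  is an automorphism. So no nonzero element of \<open>D\<close> is killed by \<open>J\<close>. Since for \<open>v \<in> U\<close> the ideal
  \<open>{r. rv \<in> R}\<close> belongs to \<open>\<G>\<close> (this is where flatness and the epimorphism property enter), \<open>\<mu>\<close> extends
  to \<open>U\<close>. Hence for every divisible \<open>M\<close> and \<open>m \<in> M\<close> some homomorphism \<open>U \<rightarrow> M\<close> maps \<open>1\<close> to \<open>m\<close>, and
  every extension of \<open>U\<close> by a divisible module splits.

  Now let \<open>\<Omega>\<close> be the kernel of a free cover \<open>F \<rightarrow> U\<close> and \<open>A = R\<^sup>(\<^sup>I\<^sup>)\<close> a free module onto \<open>\<Omega>\<close> with kernel \<open>N\<close>.
  The module \<open>A\<close> embeds in \<open>B = U\<^sup>(\<^sup>I\<^sup>)\<close>, and \<open>B / N\<close> is divisible, so the inclusion of \<open>\<Omega> = A / N\<close> into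
  \<open>B / N\<close> extends to \<open>F\<close>. A lifting \<open>F \<rightarrow> B\<close> of this extension maps \<open>\<Omega>\<close> into \<open>A\<close> and splits \<open>A \<rightarrow> \<Omega>\<close>,
  so \<open>\<Omega>\<close> is projective.
\<close>

section \<open>Module homomorphisms, quotients and products\<close>

lemma (in abelian_group) a_inv_zero: "\<ominus> \<zero> = \<zero>"
  using minus_equality[of \<zero> \<zero>] by simp

lemma (in abelian_group) minus_eq_zero_iff:
  assumes "x \<in> carrier G" "y \<in> carrier G"
  shows "x \<ominus> y = \<zero> \<longleftrightarrow> x = y"
proof
  assume "x \<ominus> y = \<zero>"
  moreover have "x \<ominus> y \<oplus> y = x" using assms by (simp add: a_minus_def a_assoc l_neg)
  ultimately show "x = y" using assms by simp
qed (use assms in \<open>simp add: a_minus_def r_neg\<close>)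

section \<open>Linear combinations of homomorphisms, images and kernels\<close>

lemma module_hom_const_zero:
  assumes "module R N"
  shows "(\<lambda>_. \<zero>\<^bsub>N\<^esub>) \<in> module_hom R M N"
proof -
  interpret module R N by fact
  show ?thesis by (rule module_homI) auto
qed

lemma module_hom_add:
  assumes "module R N" "f \<in> module_hom R M N" "g \<in> module_hom R M N"
  shows "(\<lambda>x. f x \<oplus>\<^bsub>N\<^esub> g x) \<in> module_hom R M N"
proof -
  interpret module R N by fact
  note h = module_homD[OF assms(2)] module_homD[OF assms(3)]
  show ?thesis by (rule module_homI) (auto simp: h M.a_ac smult_r_distr)
qed

lemma module_hom_uminus:
  assumes "module R N" "f \<in> module_hom R M N"
  shows "(\<lambda>x. \<ominus>\<^bsub>N\<^esub> f x) \<in> module_hom R M N"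
proof -
  interpret module R N by fact
  note h = module_homD[OF assms(2)]
  show ?thesis by (rule module_homI) (auto simp: h M.minus_add smult_r_minus)
qed

lemma module_hom_diff:
  assumes "module R N" "f \<in> module_hom R M N" "g \<in> module_hom R M N"
  shows "(\<lambda>x. f x \<ominus>\<^bsub>N\<^esub> g x) \<in> module_hom R M N"
  using module_hom_add[OF assms(1,2) module_hom_uminus[OF assms(1,3)]] by (simp add: a_minus_def)

lemma module_hom_smult:
  assumes "module R N" "f \<in> module_hom R M N" "r \<in> carrier R"
  shows "(\<lambda>x. r \<odot>\<^bsub>N\<^esub> f x) \<in> module_hom R M N"
proof -
  interpret module R N by fact
  note h = module_homD[OF assms(2)]
  show ?thesis
    by (rule module_homI)
      (use assms(3) in \<open>auto simp: h smult_r_distr R.m_comm simp flip: smult_assoc1\<close>)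
qed

lemma module_hom_inv:
  assumes "module R M" "module R N" "f \<in> module_hom R M N" "x \<in> carrier M"
  shows "f (\<ominus>\<^bsub>M\<^esub> x) = \<ominus>\<^bsub>N\<^esub> f x"
proof -
  interpret M: module R M by fact
  interpret N: module R N by fact
  have "f ((\<ominus>\<^bsub>R\<^esub> \<one>\<^bsub>R\<^esub>) \<odot>\<^bsub>M\<^esub> x) = (\<ominus>\<^bsub>R\<^esub> \<one>\<^bsub>R\<^esub>) \<odot>\<^bsub>N\<^esub> f x"
    using assms by (intro module_homD(3)) auto
  then show ?thesis
    using assms module_homD(1)[OF assms(3,4)] by (simp add: M.smult_l_minus N.smult_l_minus)
qed

lemma module_hom_minus:
  assumes "module R M" "module R N" "f \<in> module_hom R M N" "x \<in> carrier M" "y \<in> carrier M"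
  shows "f (x \<ominus>\<^bsub>M\<^esub> y) = f x \<ominus>\<^bsub>N\<^esub> f y"
proof -
  interpret M: module R M by fact
  show ?thesis using assms by (simp add: a_minus_def module_homD(2)[OF assms(3)] module_hom_inv[OF assms(1-3)])
qed

lemma submodule_hom_image:
  assumes "module R M" "module R N" "f \<in> module_hom R M N"
  shows "submodule (f ` carrier M) R N"
proof -
  interpret M: module R M by fact
  interpret N: module R N by fact
  note h = module_homD[OF assms(3)]
  show ?thesis
  proof (rule N.submoduleI)
    show "\<zero>\<^bsub>N\<^esub> \<in> f ` carrier M" using module_hom_zero[OF assms] by (intro image_eqI[of _ _ "\<zero>\<^bsub>M\<^esub>"]) auto
    show "\<ominus>\<^bsub>N\<^esub> y \<in> f ` carrier M" if "y \<in> f ` carrier M" for y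
      using that module_hom_inv[OF assms, symmetric] by auto
    show "y \<oplus>\<^bsub>N\<^esub> z \<in> f ` carrier M" if "y \<in> f ` carrier M" "z \<in> f ` carrier M" for y z
      using that h(2)[symmetric] by auto
    show "r \<odot>\<^bsub>N\<^esub> y \<in> f ` carrier M" if "r \<in> carrier R" "y \<in> f ` carrier M" for r y
      using that h(3)[symmetric] by auto
  qed (use h in auto)
qed

lemma submodule_hom_kernel:
  assumes "module R M" "module R N" "f \<in> module_hom R M N"
  shows "submodule {x \<in> carrier M. f x = \<zero>\<^bsub>N\<^esub>} R M"
proof -
  interpret M: module R M by fact
  interpret N: module R N by fact
  show ?thesis
    by (rule M.submoduleI)
      (auto simp: module_homD[OF assms(3)] module_hom_zero[OF assms] module_hom_inv[OF assms])
qed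

text \<open>Representatives instead of cosets keep the quotient on the type of the module.\<close>

definition class_rep :: "('r, 'a) module \<Rightarrow> 'a set \<Rightarrow> 'a \<Rightarrow> 'a" where
  "class_rep M N x = (SOME y. y \<in> carrier M \<and> x \<ominus>\<^bsub>M\<^esub> y \<in> N)"

definition quotient_module :: "('r, 'a) module \<Rightarrow> 'a set \<Rightarrow> ('r, 'a) module" where
  "quotient_module M N = \<lparr>carrier = class_rep M N ` carrier M, monoid.mult = undefined, one = undefined,
     ring.zero = class_rep M N \<zero>\<^bsub>M\<^esub>, add = (\<lambda>x y. class_rep M N (x \<oplus>\<^bsub>M\<^esub> y)),
     smult = (\<lambda>r x. class_rep M N (r \<odot>\<^bsub>M\<^esub> x))\<rparr>"

lemma quotient_module:
  assumes M: "module R M" and N: "submodule N R M"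
  shows module_quotient: "module R (quotient_module M N)"
    and quotient_hom: "class_rep M N \<in> module_hom R M (quotient_module M N)"
    and quotient_carrier: "carrier (quotient_module M N) = class_rep M N ` carrier M"
    and class_rep_eq_iff:
      "x \<in> carrier M \<Longrightarrow> y \<in> carrier M \<Longrightarrow> class_rep M N x = class_rep M N y \<longleftrightarrow> x \<ominus>\<^bsub>M\<^esub> y \<in> N"
    and class_rep: "x \<in> carrier M \<Longrightarrow> class_rep M N x \<in> carrier M"
      "x \<in> carrier M \<Longrightarrow> x \<ominus>\<^bsub>M\<^esub> class_rep M N x \<in> N"
proof -
  interpret M: module R M by fact
  note E = M.submoduleE[OF N] and Z = subgroup.one_closed[OF submodule.axioms(1)[OF N], simplified]
  let ?c = "class_rep M N" and ?Q = "quotient_module M N"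
  have rep: "?c x \<in> carrier M \<and> x \<ominus>\<^bsub>M\<^esub> ?c x \<in> N" if x: "x \<in> carrier M" for x
    unfolding class_rep_def
    by (rule someI[of _ x]) (use x Z in \<open>simp add: a_minus_def M.r_neg\<close>)
  then have rep1 [simp]: "?c x \<in> carrier M" if "x \<in> carrier M" for x
    using that by blast
  show "x \<in> carrier M \<Longrightarrow> ?c x \<in> carrier M" "x \<in> carrier M \<Longrightarrow> x \<ominus>\<^bsub>M\<^esub> ?c x \<in> N"
    using rep by auto
  have sym: "y \<ominus>\<^bsub>M\<^esub> x \<in> N" if "x \<ominus>\<^bsub>M\<^esub> y \<in> N" "x \<in> carrier M" "y \<in> carrier M" for x y
    using E(3)[OF that(1)] that by (simp add: a_minus_def M.minus_add M.a_comm)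
  have trans: "x \<ominus>\<^bsub>M\<^esub> z \<in> N"
    if "x \<ominus>\<^bsub>M\<^esub> y \<in> N" "y \<ominus>\<^bsub>M\<^esub> z \<in> N" "x \<in> carrier M" "y \<in> carrier M" "z \<in> carrier M" for x y z
  proof -
    have "x \<ominus>\<^bsub>M\<^esub> z = (x \<ominus>\<^bsub>M\<^esub> y) \<oplus>\<^bsub>M\<^esub> (y \<ominus>\<^bsub>M\<^esub> z)"
      using that(3-5) by (simp add: a_minus_def M.a_assoc) (simp add: M.l_neg flip: M.a_assoc)
    then show ?thesis using E(5)[OF that(1,2)] by simp
  qed
  have eq: "?c x = ?c y \<longleftrightarrow> x \<ominus>\<^bsub>M\<^esub> y \<in> N" if "x \<in> carrier M" "y \<in> carrier M" for x y
  proof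
    assume "?c x = ?c y"
    then have "?c x \<ominus>\<^bsub>M\<^esub> y \<in> N" using sym[of y "?c y"] rep that by simp
    then show "x \<ominus>\<^bsub>M\<^esub> y \<in> N" using trans[of x "?c x" y] rep that by simp
  next
    assume xy: "x \<ominus>\<^bsub>M\<^esub> y \<in> N"
    have "x \<ominus>\<^bsub>M\<^esub> z \<in> N \<longleftrightarrow> y \<ominus>\<^bsub>M\<^esub> z \<in> N" if "z \<in> carrier M" for z
      using trans[OF xy] trans[OF sym[OF xy]] that \<open>x \<in> carrier M\<close> \<open>y \<in> carrier M\<close> by blast
    then show "?c x = ?c y" unfolding class_rep_def by (metis (lifting))
  qed
  then show "x \<in> carrier M \<Longrightarrow> y \<in> carrier M \<Longrightarrow> ?c x = ?c y \<longleftrightarrow> x \<ominus>\<^bsub>M\<^esub> y \<in> N" .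
  have cc: "?c (?c x) = ?c x" if "x \<in> carrier M" for x
    using eq[of "?c x" x] sym[of x "?c x"] rep that by auto
  have ca: "?c (x \<oplus>\<^bsub>M\<^esub> y) = ?c (x' \<oplus>\<^bsub>M\<^esub> y')"
    if "?c x = ?c x'" "?c y = ?c y'" "x \<in> carrier M" "x' \<in> carrier M" "y \<in> carrier M" "y' \<in> carrier M"
    for x x' y y'
  proof -
    have "(x \<oplus>\<^bsub>M\<^esub> y) \<ominus>\<^bsub>M\<^esub> (x' \<oplus>\<^bsub>M\<^esub> y') = (x \<ominus>\<^bsub>M\<^esub> x') \<oplus>\<^bsub>M\<^esub> (y \<ominus>\<^bsub>M\<^esub> y')"
      using that(3-6) by (simp add: a_minus_def M.minus_add M.a_ac)
    then show ?thesis using that eq E(5) by simp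
  qed
  have cs: "?c (r \<odot>\<^bsub>M\<^esub> x) = ?c (r \<odot>\<^bsub>M\<^esub> x')"
    if "?c x = ?c x'" "x \<in> carrier M" "x' \<in> carrier M" "r \<in> carrier R" for r x x'
  proof -
    have "r \<odot>\<^bsub>M\<^esub> x \<ominus>\<^bsub>M\<^esub> r \<odot>\<^bsub>M\<^esub> x' = r \<odot>\<^bsub>M\<^esub> (x \<ominus>\<^bsub>M\<^esub> x')"
      using that(2-4) by (simp add: a_minus_def M.smult_r_distr M.smult_r_minus)
    then show ?thesis using that eq E(4) by simp
  qed
  have [simp]: "carrier ?Q = ?c ` carrier M" "\<zero>\<^bsub>?Q\<^esub> = ?c \<zero>\<^bsub>M\<^esub>"
    "x \<oplus>\<^bsub>?Q\<^esub> y = ?c (x \<oplus>\<^bsub>M\<^esub> y)" "r \<odot>\<^bsub>?Q\<^esub> x = ?c (r \<odot>\<^bsub>M\<^esub> x)" for x y r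
    by (simp_all add: quotient_module_def)
  have add: "?c (?c x \<oplus>\<^bsub>M\<^esub> ?c y) = ?c (x \<oplus>\<^bsub>M\<^esub> y)" if "x \<in> carrier M" "y \<in> carrier M" for x y
    using that by (intro ca) (auto simp: cc)
  have add1: "?c (?c x \<oplus>\<^bsub>M\<^esub> y) = ?c (x \<oplus>\<^bsub>M\<^esub> y)" if "x \<in> carrier M" "y \<in> carrier M" for x y
    using that by (intro ca) (auto simp: cc)
  have add2: "?c (x \<oplus>\<^bsub>M\<^esub> ?c y) = ?c (x \<oplus>\<^bsub>M\<^esub> y)" if "x \<in> carrier M" "y \<in> carrier M" for x y
    using that by (intro ca) (auto simp: cc)
  have smult: "?c (r \<odot>\<^bsub>M\<^esub> ?c x) = ?c (r \<odot>\<^bsub>M\<^esub> x)" if "x \<in> carrier M" "r \<in> carrier R" for r x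
    using that by (intro cs) (auto simp: cc)
  have ab: "abelian_group ?Q"
  proof (rule abelian_groupI)
    fix x assume "x \<in> carrier ?Q"
    then obtain a where "a \<in> carrier M" "x = ?c a" by auto
    then show "\<exists>y\<in>carrier ?Q. y \<oplus>\<^bsub>?Q\<^esub> x = \<zero>\<^bsub>?Q\<^esub>"
      by (intro bexI[of _ "?c (\<ominus>\<^bsub>M\<^esub> a)"]) (auto simp: add M.l_neg)
  qed ((auto simp: add1 add2 cc)[5], simp_all add: M.a_ac)
  show "module R ?Q"
    by (rule moduleI)
      (auto simp: ab M.R.is_cring add1 add2 smult cc M.smult_r_distr simp flip: M.smult_l_distr M.smult_assoc1)
  show "?c \<in> module_hom R M ?Q" by (rule module_homI) (auto simp: add smult)
  show "carrier ?Q = ?c ` carrier M" by simp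
qed

text \<open>Since \<open>f\<close> is constant on classes modulo \<open>N\<close> and the elements
  of the quotient are chosen representatives, the induced map on the quotient is literally
  \<open>f\<close>.\<close>

lemma quotient_hom_factor:
  assumes M: "module R M" and N: "submodule N R M" and L: "module R L"
    and f: "f \<in> module_hom R M L" and fN: "\<And>x. x \<in> N \<Longrightarrow> f x = \<zero>\<^bsub>L\<^esub>"
  shows "f \<in> module_hom R (quotient_module M N) L" and "x \<in> carrier M \<Longrightarrow> f (class_rep M N x) = f x"
proof -
  interpret M: module R M by fact
  interpret L: module R L by fact
  have key: "f (class_rep M N x) = f x" if x: "x \<in> carrier M" for x
  proof -
    have "f x \<ominus>\<^bsub>L\<^esub> f (class_rep M N x) = \<zero>\<^bsub>L\<^esub>"
      using fN[OF class_rep(2)[OF M N x]] x class_rep(1)[OF M N x]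
      by (simp add: module_hom_minus[OF M L f])
    then show ?thesis using x class_rep(1)[OF M N x] module_homD(1)[OF f]
      by (simp add: L.M.minus_eq_zero_iff)
  qed
  then show "x \<in> carrier M \<Longrightarrow> f (class_rep M N x) = f x" .
  show "f \<in> module_hom R (quotient_module M N) L"
    unfolding quotient_module_def
    by (rule module_homI) (auto simp: key class_rep(1)[OF M N] module_homD[OF f])
qed

section \<open>Products of two modules\<close>

definition prod_module :: "('r, 'a) module \<Rightarrow> ('r, 'b) module \<Rightarrow> ('r, 'a \<times> 'b) module" where
  "prod_module M N = \<lparr>carrier = carrier M \<times> carrier N, monoid.mult = undefined, one = undefined,
     ring.zero = (\<zero>\<^bsub>M\<^esub>, \<zero>\<^bsub>N\<^esub>), add = (\<lambda>(a, b) (c, d). (a \<oplus>\<^bsub>M\<^esub> c, b \<oplus>\<^bsub>N\<^esub> d)),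
     smult = (\<lambda>r (a, b). (r \<odot>\<^bsub>M\<^esub> a, r \<odot>\<^bsub>N\<^esub> b))\<rparr>"

lemma prod_module_simps [simp]:
  "carrier (prod_module M N) = carrier M \<times> carrier N"
  "\<zero>\<^bsub>prod_module M N\<^esub> = (\<zero>\<^bsub>M\<^esub>, \<zero>\<^bsub>N\<^esub>)"
  "(a, b) \<oplus>\<^bsub>prod_module M N\<^esub> (c, d) = (a \<oplus>\<^bsub>M\<^esub> c, b \<oplus>\<^bsub>N\<^esub> d)"
  "r \<odot>\<^bsub>prod_module M N\<^esub> (a, b) = (r \<odot>\<^bsub>M\<^esub> a, r \<odot>\<^bsub>N\<^esub> b)"
  by (simp_all add: prod_module_def)

lemma module_prod_module:
  assumes "module R M" "module R N"
  shows "module R (prod_module M N)"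
proof -
  interpret M: module R M by fact
  interpret N: module R N by fact
  have "abelian_group (prod_module M N)"
  proof (rule abelian_groupI)
    fix x assume "x \<in> carrier (prod_module M N)"
    then show "\<exists>y\<in>carrier (prod_module M N). y \<oplus>\<^bsub>prod_module M N\<^esub> x = \<zero>\<^bsub>prod_module M N\<^esub>"
      by (intro bexI[of _ "(\<ominus>\<^bsub>M\<^esub> fst x, \<ominus>\<^bsub>N\<^esub> snd x)"]) (auto simp: M.M.l_neg N.M.l_neg)
  qed (auto simp: M.M.a_ac N.M.a_ac)
  then show ?thesis
    by (rule moduleI[OF M.R.is_cring])
      (auto simp: M.smult_l_distr M.smult_r_distr M.smult_assoc1 N.smult_l_distr N.smult_r_distr N.smult_assoc1)
qed

text \<open>Negatives are given by a description and not componentwise, so the pair of negatives is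
  identified through uniqueness of inverses.\<close>

lemma prod_module_minus:
  assumes "module R M" "module R N" "a \<in> carrier M" "c \<in> carrier M" "b \<in> carrier N" "d \<in> carrier N"
  shows "(a, b) \<ominus>\<^bsub>prod_module M N\<^esub> (c, d) = (a \<ominus>\<^bsub>M\<^esub> c, b \<ominus>\<^bsub>N\<^esub> d)"
proof -
  interpret M: module R M by fact
  interpret N: module R N by fact
  interpret P: module R "prod_module M N" by (rule module_prod_module[OF assms(1,2)])
  have "(\<ominus>\<^bsub>M\<^esub> c, \<ominus>\<^bsub>N\<^esub> d) = \<ominus>\<^bsub>prod_module M N\<^esub> (c, d)"
    using assms by (intro P.M.minus_equality[symmetric]) (auto simp: M.M.l_neg N.M.l_neg)
  then show ?thesis using assms by (simp add: a_minus_def flip: \<open>_ = \<ominus>\<^bsub>prod_module M N\<^esub> (c, d)\<close>)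
qed

lemma module_hom_pair:
  assumes "f \<in> module_hom R L M" "g \<in> module_hom R L N"
  shows "(\<lambda>x. (f x, g x)) \<in> module_hom R L (prod_module M N)"
  by (rule module_homI) (auto simp: module_homD[OF assms(1)] module_homD[OF assms(2)])

section \<open>Projective modules\<close>

definition free_gen :: "'r ring \<Rightarrow> 'p \<Rightarrow> 'p \<Rightarrow> 'r" where
  "free_gen R x y = (if y = x then \<one>\<^bsub>R\<^esub> else \<zero>\<^bsub>R\<^esub>)"

lemma free_gen_closed: "cring R \<Longrightarrow> x \<in> V \<Longrightarrow> free_gen R x \<in> carrier (free_module R V)"
proof -
  assume "cring R" "x \<in> V"
  interpret cring R by fact
  show ?thesis using \<open>x \<in> V\<close> by (auto simp: free_gen_def free_module_def)
qed

lemma free_eval_gen: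
  assumes "module R A" "\<phi> \<in> V \<rightarrow> carrier A" "x \<in> V"
  shows "free_eval R A \<phi> (free_gen R x) = \<phi> x"
proof -
  interpret module R A by fact
  have "\<phi> x \<in> carrier A" using assms by auto
  then show ?thesis using assms
    by (subst free_eval_superset[OF assms(1) free_gen_closed[OF R.is_cring assms(3)] assms(2), of "{x}"])
      (auto simp: free_gen_def Pi_def)
qed

text \<open>By induction over finite sets, the sum over \<open>S\<close> of the basis vectors
  weighted by \<open>c\<close> is \<open>c\<close> cut off outside \<open>S\<close>; the support of
  \<open>c\<close> is one such \<open>S\<close>.\<close>

lemma free_module_expansion:
  assumes "cring R" and c: "c \<in> carrier (free_module R V)"
  shows "free_eval R (free_module R V) (free_gen R) c = c"
proof -
  let ?F = "free_module R V"
  interpret F: module R ?F by (rule module_free_module[OF assms(1)])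
  let ?T = "{x. c x \<noteq> \<zero>\<^bsub>R\<^esub>}"
  have T: "finite ?T" "?T \<subseteq> V" "\<And>x. c x \<in> carrier R" using c by (auto simp: free_module_def)
  have g: "free_gen R x \<in> carrier ?F" if "x \<in> V" for x using free_gen_closed[OF assms(1) that] .
  have "(\<Oplus>\<^bsub>?F\<^esub>x\<in>S. c x \<odot>\<^bsub>?F\<^esub> free_gen R x) = (\<lambda>y. if y \<in> S then c y else \<zero>\<^bsub>R\<^esub>)" if "finite S" "S \<subseteq> V" for S
    using that
  proof (induction S)
    case (insert x S)
    have m: "c z \<odot>\<^bsub>?F\<^esub> free_gen R z \<in> carrier ?F" if "z \<in> insert x S" for z
      using that insert.prems T(3) g by (intro F.smult_closed) auto
    have "(\<Oplus>\<^bsub>?F\<^esub>z\<in>insert x S. c z \<odot>\<^bsub>?F\<^esub> free_gen R z) =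
        c x \<odot>\<^bsub>?F\<^esub> free_gen R x \<oplus>\<^bsub>?F\<^esub> (\<Oplus>\<^bsub>?F\<^esub>z\<in>S. c z \<odot>\<^bsub>?F\<^esub> free_gen R z)"
      using insert.hyps m by (intro F.M.finsum_insert) auto
    also have "\<dots> = (\<lambda>y. if y \<in> insert x S then c y else \<zero>\<^bsub>R\<^esub>)"
      using insert T(3) by (auto simp: free_module_def free_gen_def fun_eq_iff)
    finally show ?case .
  qed (use F.M.finsum_empty in \<open>simp add: free_module_def\<close>)
  from this[OF T(1,2)] show ?thesis unfolding free_eval_def by auto
qed

text \<open>A preimage chosen for the image of each basis vector extends linearly to the lift; the
  expansion in basis vectors shows that it lifts \<open>f\<close> everywhere.\<close>

lemma projective_free_module:
  assumes R: "cring R"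
  shows "projective_module R (free_module R V)"
  unfolding projective_module_def
proof (intro conjI allI ballI impI)
  let ?F = "free_module R V"
  show mF: "module R ?F" by (rule module_free_module[OF R])
  fix A :: "('a, ('b \<Rightarrow> 'a) \<Rightarrow> 'a) module" and B :: "('a, 'b \<Rightarrow> 'a) module" and g f
  assume g: "g \<in> module_hom R A B" and f: "f \<in> module_hom R ?F B" and A: "module R A" and B: "module R B"
    and surj: "g ` carrier A = carrier B"
  interpret A: module R A by fact
  interpret B: module R B by fact
  interpret F: module R ?F by fact
  define \<phi> where "\<phi> x = inv_into (carrier A) g (f (free_gen R x))" for x
  have \<phi>: "\<phi> x \<in> carrier A" "g (\<phi> x) = f (free_gen R x)" if "x \<in> V" for x
  proof -
    have "f (free_gen R x) \<in> g ` carrier A"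
      using surj module_homD(1)[OF f] free_gen_closed[OF R that] by simp
    then show "\<phi> x \<in> carrier A" "g (\<phi> x) = f (free_gen R x)"
      unfolding \<phi>_def by (rule inv_into_into, rule f_inv_into_f)
  qed
  have "g (free_eval R A \<phi> c) = f c" if c: "c \<in> carrier ?F" for c
  proof -
    let ?T = "{x. c x \<noteq> \<zero>\<^bsub>R\<^esub>}"
    have T: "finite ?T" "?T \<subseteq> V" "\<And>x. c x \<in> carrier R" using c by (auto simp: free_module_def)
    have gen: "free_gen R x \<in> carrier ?F" if "x \<in> V" for x using free_gen_closed[OF R that] .
    have "g (free_eval R A \<phi> c) = (\<Oplus>\<^bsub>B\<^esub>x\<in>?T. g (c x \<odot>\<^bsub>A\<^esub> \<phi> x))"
      unfolding free_eval_def using T \<phi> by (intro module_hom_finsum[OF A B g]) auto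
    also have "\<dots> = (\<Oplus>\<^bsub>B\<^esub>x\<in>?T. f (c x \<odot>\<^bsub>?F\<^esub> free_gen R x))"
    proof (rule B.M.finsum_cong'[OF refl])
      show "(\<lambda>x. f (c x \<odot>\<^bsub>?F\<^esub> free_gen R x)) \<in> ?T \<rightarrow> carrier B"
        using T gen by (auto intro!: module_homD(1)[OF f] F.smult_closed)
      fix x assume "x \<in> ?T"
      then have x: "x \<in> V" using T(2) by auto
      show "g (c x \<odot>\<^bsub>A\<^esub> \<phi> x) = f (c x \<odot>\<^bsub>?F\<^esub> free_gen R x)"
        using \<phi>[OF x] T(3) gen[OF x] by (simp add: module_homD(3)[OF f] module_homD(3)[OF g])
    qed
    also have "\<dots> = f (free_eval R ?F (free_gen R) c)"
      unfolding free_eval_def using T gen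
      by (intro module_hom_finsum[OF mF B f, symmetric]) (auto intro!: F.smult_closed)
    finally show ?thesis using free_module_expansion[OF R c] by simp
  qed
  moreover have "free_eval R A \<phi> \<in> module_hom R ?F A" using A \<phi>(1) by (intro free_eval_hom) auto
  ultimately show "\<exists>h\<in>module_hom R ?F A. \<forall>x\<in>carrier ?F. g (h x) = f x" by blast
qed

text \<open>A lift of \<open>f \<circ> p\<close> to \<open>P\<close>, composed with
  \<open>s\<close>, lifts \<open>f\<close> since \<open>p\<close> undoes \<open>s\<close>.
  \<open>P\<close> and \<open>Q\<close> may live on different types, so the test modules for
  \<open>Q\<close> are not those in the definition for \<open>P\<close>;
  \<open>projective_moduleD\<close> bridges this.\<close>

lemma projective_module_retract:
  fixes P :: "('r, 'p) module" and Q :: "('r, 'q) module"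
  assumes P: "projective_module R P" and Q: "module R Q"
    and s: "s \<in> module_hom R Q P" and p: "p \<in> module_hom R P Q"
    and ps: "\<And>x. x \<in> carrier Q \<Longrightarrow> p (s x) = x"
  shows "projective_module R Q"
  unfolding projective_module_def
proof (intro conjI allI ballI impI)
  show "module R Q" by fact
  fix A :: "('r, 'q \<Rightarrow> 'r) module" and B :: "('r, 'q) module" and g f
  assume g: "g \<in> module_hom R A B" and f: "f \<in> module_hom R Q B" and A: "module R A" and B: "module R B"
    and surj: "g ` carrier A = carrier B"
  obtain h where h: "h \<in> module_hom R P A" "\<And>x. x \<in> carrier P \<Longrightarrow> g (h x) = (f \<circ> p) x"
    using projective_moduleD[OF P A B g module_hom_comp[OF p f] surj] by blast
  show "\<exists>h\<in>module_hom R Q A. \<forall>x\<in>carrier Q. g (h x) = f x"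
    using module_hom_comp[OF s h(1)] h(2) module_homD(1)[OF s] ps by (intro bexI[of _ "h \<circ> s"]) auto
qed

section \<open>Endomorphism rings of abelian groups\<close>

text \<open>Endomorphisms are normalised outside the carrier by extensionality, so that ring
  equations, which are equalities of functions, only have to be checked on the carrier.\<close>

definition endo_ring :: "('a, 'b) monoid_scheme \<Rightarrow> ('a \<Rightarrow> 'a) ring" where
  "endo_ring G = \<lparr>carrier = hom G G \<inter> extensional (carrier G),
     monoid.mult = (\<lambda>f g. \<lambda>x\<in>carrier G. f (g x)), one = (\<lambda>x\<in>carrier G. x),
     ring.zero = (\<lambda>x\<in>carrier G. \<one>\<^bsub>G\<^esub>), add = (\<lambda>f g. \<lambda>x\<in>carrier G. f x \<otimes>\<^bsub>G\<^esub> g x)\<rparr>"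

text \<open>Commutativity makes pointwise products and inverses of endomorphisms endomorphisms
  again; distributivity on one side is the homomorphism law.\<close>

lemma (in comm_group) ring_endo_ring: "ring (endo_ring G)"
proof -
  have closed: "f x \<in> carrier G" if "f \<in> hom G G" "x \<in> carrier G" for f x
    using that by (auto simp: hom_def)
  have mult: "f (x \<otimes> y) = f x \<otimes> f y" if "f \<in> hom G G" "x \<in> carrier G" "y \<in> carrier G" for f x y
    using that by (auto simp: hom_def)
  have one: "f \<one> = \<one>" if "f \<in> hom G G" for f
    using that by (simp add: hom_one is_group)
  have restrict_cong: "restrict f (carrier G) = restrict g (carrier G) \<longleftrightarrow> (\<forall>x\<in>carrier G. f x = g x)" for f g
    by (metis restrict_apply' restrict_ext)
  have ext: "f = restrict g (carrier G) \<longleftrightarrow> (\<forall>x\<in>carrier G. f x = g x)" "restrict g (carrier G) = f \<longleftrightarrow> (\<forall>x\<in>carrier G. g x = f x)"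
    if "f \<in> extensional (carrier G)" for f g
    using restrict_cong[of f g] extensional_restrict[OF that] by auto
  have hom: "restrict f (carrier G) \<in> hom G G \<longleftrightarrow> f \<in> hom G G" for f
    by (auto simp: hom_def Pi_iff)
  have add_hom: "(\<lambda>x. f x \<otimes> g x) \<in> hom G G" if "f \<in> hom G G" "g \<in> hom G G" for f g
    by (rule homI) (use that in \<open>auto simp: closed mult m_ac\<close>)
  have comp_hom: "(\<lambda>x. f (g x)) \<in> hom G G" if "f \<in> hom G G" "g \<in> hom G G" for f g
    by (rule homI) (use that in \<open>auto simp: closed mult\<close>)
  have inv_hom: "(\<lambda>x. inv (f x)) \<in> hom G G" if "f \<in> hom G G" for f
    by (rule homI) (use that in \<open>auto simp: closed mult inv_mult m_comm\<close>)
  have id_hom: "(\<lambda>x. x) \<in> hom G G" "(\<lambda>x. \<one>) \<in> hom G G" by (auto simp: hom_def)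
  show ?thesis
  proof (rule ringI)
    show "abelian_group (endo_ring G)"
    proof (rule abelian_groupI)
      fix f assume "f \<in> carrier (endo_ring G)"
      then show "\<exists>g\<in>carrier (endo_ring G). g \<oplus>\<^bsub>endo_ring G\<^esub> f = \<zero>\<^bsub>endo_ring G\<^esub>"
        by (intro bexI[of _ "\<lambda>x\<in>carrier G. inv (f x)"])
          (auto simp: endo_ring_def hom inv_hom restrict_cong closed)
    qed (auto simp: endo_ring_def hom add_hom id_hom restrict_cong closed ext m_ac)
    show "monoid (endo_ring G)"
      by (rule monoidI) (auto simp: endo_ring_def hom comp_hom id_hom restrict_cong closed ext)
  qed (auto simp: endo_ring_def restrict_cong closed mult)
qed

section \<open>Endomorphisms of quotients of free abelian groups\<close>

lemma frag_extend_of_compose: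
  "frag_extend (frag_of \<circ> \<phi>) (frag_extend (frag_of \<circ> \<psi>) c) = frag_extend (frag_of \<circ> (\<phi> \<circ> \<psi>)) c"
  by (simp add: frag_extend_compose comp_assoc)

lemma frag_extend_frag_of: "frag_extend (frag_of \<circ> (\<lambda>x. x)) c = c"
  using frag_expansion[of c] by (simp add: comp_def)

lemma keys_frag_extend_of:
  assumes "Poly_Mapping.keys c \<subseteq> S" "\<phi> ` S \<subseteq> T"
  shows "Poly_Mapping.keys (frag_extend (frag_of \<circ> \<phi>) c) \<subseteq> T"
  using keys_frag_extend[of "frag_of \<circ> \<phi>" c] assms by fastforce

text \<open>The linear extension of \<open>\<phi>\<close>, followed by the projection to
  \<open>F Mod K\<close>, is a homomorphism that kills \<open>K\<close>, so it factors through the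
  quotient.\<close>

lemma endo_ring_lift:
  fixes S :: "'s set"
  defines "F \<equiv> free_Abelian_group S"
  assumes K: "subgroup K F" and \<phi>: "\<phi> ` S \<subseteq> S"
    and \<phi>K: "\<And>c. c \<in> K \<Longrightarrow> frag_extend (frag_of \<circ> \<phi>) c \<in> K"
  shows "\<exists>h\<in>carrier (endo_ring (F Mod K)). \<forall>c\<in>carrier F. h (K #>\<^bsub>F\<^esub> c) = K #>\<^bsub>F\<^esub> frag_extend (frag_of \<circ> \<phi>) c"
proof -
  interpret F: comm_group F unfolding F_def by (rule abelian_free_Abelian_group)
  interpret N: normal K F using F.subgroup_imp_normal[OF K] .
  interpret Q: comm_group "F Mod K" by (rule F.abelian_FactGroup[OF K])
  let ?h = "\<lambda>c. K #>\<^bsub>F\<^esub> frag_extend (frag_of \<circ> \<phi>) c"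
  have closed: "frag_extend (frag_of \<circ> \<phi>) c \<in> carrier F" if "c \<in> carrier F" for c
    using keys_frag_extend_of[of c S \<phi> S] that \<phi> by (simp add: F_def)
  have hom: "?h \<in> hom F (F Mod K)"
  proof (rule homI)
    fix c d assume c: "c \<in> carrier F" and d: "d \<in> carrier F"
    show "?h c \<in> carrier (F Mod K)" using closed[OF c] by (auto simp: carrier_FactGroup)
    show "?h (c \<otimes>\<^bsub>F\<^esub> d) = ?h c \<otimes>\<^bsub>F Mod K\<^esub> ?h d"
      using N.rcos_sum[OF closed[OF c] closed[OF d]] by (simp add: F_def frag_extend_add)
  qed
  interpret group_hom F "F Mod K" ?h
    using hom by (intro group_hom.intro group_hom_axioms.intro) (auto intro: F.is_group Q.is_group)
  have "K \<subseteq> kernel F (F Mod K) ?h"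
  proof
    fix c assume c: "c \<in> K"
    have "?h c = K" by (rule F.coset_join2[OF _ K \<phi>K[OF c]]) (use closed N.subset c in blast)
    then show "c \<in> kernel F (F Mod K) ?h" using c N.subset by (auto simp: kernel_def)
  qed
  then obtain g where g: "g \<in> hom (F Mod K) (F Mod K)" "\<And>c. c \<in> carrier F \<Longrightarrow> g (K #>\<^bsub>F\<^esub> c) = ?h c"
    using FactGroup_universal_kernel[OF N.normal_axioms] by metis
  \<comment> \<open>\<open>g\<close> is restricted because the endomorphism ring contains
    extensional functions only.\<close>
  have "restrict g (carrier (F Mod K)) \<in> carrier (endo_ring (F Mod K))"
    using g(1) Q.m_closed by (auto simp: endo_ring_def hom_def Pi_iff simp del: mult_FactGroup)
  then show ?thesis using g(2) by (intro bexI) (auto simp: carrier_FactGroup)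
qed

section \<open>Conductors lie in the Gabriel topology\<close>

lemma tensor_kernel_subgroup:
  assumes A: "module R A" and M: "module R M"
  shows "subgroup (tensor_kernel R A M) (free_Abelian_group (carrier A \<times> carrier M))"
  by (rule group.subgroupI)
    (use tensor_kernel_props[OF A M] in \<open>auto intro!: exI[of _ 0]\<close>)

lemma tensor_kernel_rels:
  assumes A: "module R A" and M: "module R M"
  shows "x \<in> carrier A \<Longrightarrow> x' \<in> carrier A \<Longrightarrow> y \<in> carrier M \<Longrightarrow>
      frag_of (x \<oplus>\<^bsub>A\<^esub> x', y) - frag_of (x, y) - frag_of (x', y) \<in> tensor_kernel R A M"
    and "x \<in> carrier A \<Longrightarrow> y \<in> carrier M \<Longrightarrow> y' \<in> carrier M \<Longrightarrow>
      frag_of (x, y \<oplus>\<^bsub>M\<^esub> y') - frag_of (x, y) - frag_of (x, y') \<in> tensor_kernel R A M"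
    and "r \<in> carrier R \<Longrightarrow> x \<in> carrier A \<Longrightarrow> y \<in> carrier M \<Longrightarrow>
      frag_of (r \<odot>\<^bsub>A\<^esub> x, y) - frag_of (x, r \<odot>\<^bsub>M\<^esub> y) \<in> tensor_kernel R A M"
  by (rule tensor_kernel_rel[OF A M]; unfold tensor_relations_def; blast)+

text \<open>Left and right multiplication are two ring homomorphisms from \<open>U\<close> to the endomorphism ring of
  the abelian group \<open>U \<otimes>\<^sub>R U\<close> that agree on \<open>R\<close>.\<close>

lemma epimorphism_tensor:
  fixes R :: "'r ring" and U :: "'u ring"
  assumes R: "cring R" and U: "cring U" and epi: "ring_epimorphism R U u" and v: "v \<in> carrier U"
  shows "frag_of (v, \<one>\<^bsub>U\<^esub>) - frag_of (\<one>\<^bsub>U\<^esub>, v)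
    \<in> tensor_kernel R (restrict_scalars U u) (restrict_scalars U u)"
proof -
  interpret U: cring U by fact
  have u: "u \<in> ring_hom R U" using epi by (simp add: ring_epimorphism_def)
  note uc = ring_hom_closed[OF u]
  let ?U = "restrict_scalars U u"
  have M: "module R ?U" by (rule module_restrict_scalars[OF R U u])
  define F where "F = free_Abelian_group (carrier U \<times> carrier U)"
  define K where "K = tensor_kernel R ?U ?U"
  note props = tensor_kernel_props[OF M M, folded K_def, simplified]
  note rels = tensor_kernel_rels[OF M M, folded K_def, simplified]
  have K: "subgroup K F"
    using tensor_kernel_subgroup[OF M M] by (simp add: K_def F_def)
  interpret F: comm_group F unfolding F_def by (rule abelian_free_Abelian_group)
  interpret N: normal K F using F.subgroup_imp_normal[OF K] .
  interpret Q: comm_group "F Mod K" by (rule F.abelian_FactGroup[OF K])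
  have coset_eq: "K #>\<^bsub>F\<^esub> c = K #>\<^bsub>F\<^esub> d" if "c - d \<in> K" "c \<in> carrier F" "d \<in> carrier F" for c d
  proof (rule F.repr_independence[OF _ _ K, symmetric])
    show "c \<in> K #>\<^bsub>F\<^esub> d" using that(1) by (auto simp: r_coset_def F_def intro: bexI[of _ "c - d"])
  qed (rule that(3))
  have coset_eqD: "c - d \<in> K" if "K #>\<^bsub>F\<^esub> c = K #>\<^bsub>F\<^esub> d" "c \<in> carrier F" for c d
  proof -
    have "c \<in> K #>\<^bsub>F\<^esub> d" using F.rcos_self[OF that(2) K] that(1) by simp
    then show ?thesis by (auto simp: r_coset_def F_def)
  qed
  let ?S = "endo_ring (F Mod K)"
  interpret S: ring ?S by (rule Q.ring_endo_ring)
  \<comment> \<open>The actions of \<open>x\<close> on the first and on the second tensor factor,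
    given on basis pairs. Their linear extensions preserve the tensor relations and so descend to
    \<open>U \<otimes> U\<close>.\<close>
  define L where "L x = (\<lambda>(a :: 'u, b :: 'u). (x \<otimes>\<^bsub>U\<^esub> a, b))" for x
  define P where "P x = (\<lambda>(a :: 'u, b :: 'u). (a, x \<otimes>\<^bsub>U\<^esub> b))" for x
  let ?e = "\<lambda>\<phi>. frag_extend (frag_of \<circ> \<phi>) :: ('u \<times> 'u \<Rightarrow>\<^sub>0 int) \<Rightarrow> _"
  have eC: "?e \<phi> c \<in> carrier F"
    if "c \<in> carrier F" "\<phi> ` (carrier U \<times> carrier U) \<subseteq> carrier U \<times> carrier U" for \<phi> c
    using keys_frag_extend_of[of c _ \<phi>] that by (simp add: F_def)
  have maps: "L x ` (carrier U \<times> carrier U) \<subseteq> carrier U \<times> carrier U"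
    "P x ` (carrier U \<times> carrier U) \<subseteq> carrier U \<times> carrier U" if "x \<in> carrier U" for x
    using that by (auto simp: L_def P_def)
  \<comment> \<open>The scalar relations at \<open>(x a, b)\<close> and at \<open>(a, x b)\<close>;
    commutativity of \<open>U\<close> moves \<open>u r\<close> past \<open>x\<close>.\<close>
  have rel3: "frag_of (x \<otimes>\<^bsub>U\<^esub> (u r \<otimes>\<^bsub>U\<^esub> a), b) - frag_of (x \<otimes>\<^bsub>U\<^esub> a, u r \<otimes>\<^bsub>U\<^esub> b) \<in> K"
    "frag_of (u r \<otimes>\<^bsub>U\<^esub> a, x \<otimes>\<^bsub>U\<^esub> b) - frag_of (a, x \<otimes>\<^bsub>U\<^esub> (u r \<otimes>\<^bsub>U\<^esub> b)) \<in> K"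
    if "r \<in> carrier R" "x \<in> carrier U" "a \<in> carrier U" "b \<in> carrier U" for r x a b
    using that rels(3)[of r "x \<otimes>\<^bsub>U\<^esub> a" b] rels(3)[of r a "x \<otimes>\<^bsub>U\<^esub> b"] uc[of r]
      U.m_lcomm[of "u r" x a] U.m_lcomm[of "u r" x b] by simp_all
  have LK: "?e (L x) c \<in> K" if "x \<in> carrier U" "c \<in> K" for x c
    using M M that(2)[unfolded K_def]
  proof (induction rule: tensor_kernel_induct)
    case (rel c)
    then show ?case unfolding tensor_relations_def
      using that(1) rels rel3 uc
      by (auto simp: frag_extend_diff L_def U.r_distr)
  qed (use props in \<open>auto simp: frag_extend_minus frag_extend_add\<close>)
  have PK: "?e (P x) c \<in> K" if "x \<in> carrier U" "c \<in> K" for x c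
    using M M that(2)[unfolded K_def]
  proof (induction rule: tensor_kernel_induct)
    case (rel c)
    then show ?case unfolding tensor_relations_def
      using that(1) rels rel3 uc
      by (auto simp: frag_extend_diff P_def U.r_distr)
  qed (use props in \<open>auto simp: frag_extend_minus frag_extend_add\<close>)
  obtain f where f: "\<And>x. x \<in> carrier U \<Longrightarrow> f x \<in> carrier ?S"
    "\<And>x c. x \<in> carrier U \<Longrightarrow> c \<in> carrier F \<Longrightarrow> f x (K #>\<^bsub>F\<^esub> c) = K #>\<^bsub>F\<^esub> ?e (L x) c"
  proof -
    have "\<forall>x\<in>carrier U. \<exists>h. h \<in> carrier ?S \<and> (\<forall>c\<in>carrier F. h (K #>\<^bsub>F\<^esub> c) = K #>\<^bsub>F\<^esub> ?e (L x) c)"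
      using endo_ring_lift[OF K[unfolded F_def] maps(1) LK, folded F_def, unfolded Bex_def] by (intro ballI)
    from bchoice[OF this] show thesis using that by blast
  qed
  obtain g where g: "\<And>x. x \<in> carrier U \<Longrightarrow> g x \<in> carrier ?S"
    "\<And>x c. x \<in> carrier U \<Longrightarrow> c \<in> carrier F \<Longrightarrow> g x (K #>\<^bsub>F\<^esub> c) = K #>\<^bsub>F\<^esub> ?e (P x) c"
  proof -
    have "\<forall>x\<in>carrier U. \<exists>h. h \<in> carrier ?S \<and> (\<forall>c\<in>carrier F. h (K #>\<^bsub>F\<^esub> c) = K #>\<^bsub>F\<^esub> ?e (P x) c)"
      using endo_ring_lift[OF K[unfolded F_def] maps(2) PK, folded F_def, unfolded Bex_def] by (intro ballI)
    from bchoice[OF this] show thesis using that by blast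
  qed
  have ext: "h = h'" if "h \<in> carrier ?S" "h' \<in> carrier ?S"
    "\<And>c. c \<in> carrier F \<Longrightarrow> h (K #>\<^bsub>F\<^esub> c) = h' (K #>\<^bsub>F\<^esub> c)" for h h'
    by (rule extensionalityI[of _ "carrier (F Mod K)"])
      (use that in \<open>auto simp: endo_ring_def carrier_FactGroup\<close>)
  have coset_in: "K #>\<^bsub>F\<^esub> c \<in> carrier (F Mod K)" if "c \<in> carrier F" for c
    using that by (auto simp: carrier_FactGroup)
  \<comment> \<open>A congruence modulo \<open>K\<close> between linear extensions need only be
    checked on basis pairs, since \<open>K\<close> is closed under differences;
    \<open>e_ind3\<close> is the version used for additivity in \<open>x\<close>.\<close>
  have e_ind: "?e \<phi> c - ?e \<psi> c \<in> K"
    if c: "c \<in> carrier F" and "\<And>a b. a \<in> carrier U \<Longrightarrow> b \<in> carrier U \<Longrightarrow> frag_of (\<phi> (a, b)) - frag_of (\<psi> (a, b)) \<in> K"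
    for \<phi> \<psi> c
    using c[unfolded F_def carrier_free_Abelian_group_iff]
  proof (induction c rule: frag_induction)
    case (diff c d)
    then show ?case using props(5)[OF diff(1) props(4)[OF diff(2)]] by (simp add: frag_extend_diff algebra_simps)
  qed (use that(2) props(2) in auto)
  have e_ind3: "?e \<phi> c - (?e \<psi> c + ?e \<chi> c) \<in> K"
    if c: "c \<in> carrier F" and "\<And>a b. a \<in> carrier U \<Longrightarrow> b \<in> carrier U \<Longrightarrow>
      frag_of (\<phi> (a, b)) - frag_of (\<psi> (a, b)) - frag_of (\<chi> (a, b)) \<in> K"
    for \<phi> \<psi> \<chi> c
    using c[unfolded F_def carrier_free_Abelian_group_iff]
  proof (induction c rule: frag_induction)
    case (diff c d)
    then show ?case using props(5)[OF diff(1) props(4)[OF diff(2)]] by (simp add: frag_extend_diff algebra_simps)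
  next
    case (one x)
    then show ?case using that(2) by (cases x) (auto simp: diff_diff_eq)
  qed (use props(2) in auto)
  \<comment> \<open>One argument for both actions \<open>L\<close> and \<open>P\<close>: the unit
    and products are respected already on basis pairs, sums only modulo \<open>K\<close>.\<close>
  have ringhom: "h \<in> ring_hom U ?S"
    if h: "\<And>x. x \<in> carrier U \<Longrightarrow> h x \<in> carrier ?S"
      "\<And>x c. x \<in> carrier U \<Longrightarrow> c \<in> carrier F \<Longrightarrow> h x (K #>\<^bsub>F\<^esub> c) = K #>\<^bsub>F\<^esub> ?e (T x) c"
      and T: "\<And>x. x \<in> carrier U \<Longrightarrow> T x ` (carrier U \<times> carrier U) \<subseteq> carrier U \<times> carrier U"
      "\<And>a b. a \<in> carrier U \<Longrightarrow> b \<in> carrier U \<Longrightarrow> T \<one>\<^bsub>U\<^esub> (a, b) = (a, b)"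
      "\<And>x y a b. x \<in> carrier U \<Longrightarrow> y \<in> carrier U \<Longrightarrow> a \<in> carrier U \<Longrightarrow> b \<in> carrier U \<Longrightarrow>
        T (x \<otimes>\<^bsub>U\<^esub> y) (a, b) = T x (T y (a, b))"
      "\<And>x y a b. x \<in> carrier U \<Longrightarrow> y \<in> carrier U \<Longrightarrow> a \<in> carrier U \<Longrightarrow> b \<in> carrier U \<Longrightarrow>
        frag_of (T (x \<oplus>\<^bsub>U\<^esub> y) (a, b)) - frag_of (T x (a, b)) - frag_of (T y (a, b)) \<in> K"
    for h T
  proof (rule ring_hom_memI)
    fix x y assume x: "x \<in> carrier U" and y: "y \<in> carrier U"
    show "h x \<in> carrier ?S" by (rule h(1)[OF x])
    show "h (x \<otimes>\<^bsub>U\<^esub> y) = h x \<otimes>\<^bsub>?S\<^esub> h y"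
    proof (rule ext)
      fix c assume c: "c \<in> carrier F"
      have "?e (T (x \<otimes>\<^bsub>U\<^esub> y)) c = ?e (T x) (?e (T y) c)"
        unfolding frag_extend_of_compose
        using c x y T(3) by (intro frag_extend_eq) (auto simp: F_def)
      then show "h (x \<otimes>\<^bsub>U\<^esub> y) (K #>\<^bsub>F\<^esub> c) = (h x \<otimes>\<^bsub>?S\<^esub> h y) (K #>\<^bsub>F\<^esub> c)"
        using c x y by (simp add: h(2) eC T(1)) (simp add: endo_ring_def coset_in h(2) eC T(1))
    qed (use x y h(1) in auto)
    show "h (x \<oplus>\<^bsub>U\<^esub> y) = h x \<oplus>\<^bsub>?S\<^esub> h y"
    proof (rule ext)
      fix c assume c: "c \<in> carrier F"
      note cC = eC[OF c T(1)[OF x]] eC[OF c T(1)[OF y]]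
      have "(h x \<oplus>\<^bsub>?S\<^esub> h y) (K #>\<^bsub>F\<^esub> c) = (K #>\<^bsub>F\<^esub> ?e (T x) c) \<otimes>\<^bsub>F Mod K\<^esub> (K #>\<^bsub>F\<^esub> ?e (T y) c)"
        using c x y by (simp add: endo_ring_def coset_in h(2))
      also have "\<dots> = K #>\<^bsub>F\<^esub> (?e (T x) c + ?e (T y) c)"
        using N.rcos_sum[OF cC] by (simp add: F_def)
      also have "\<dots> = K #>\<^bsub>F\<^esub> ?e (T (x \<oplus>\<^bsub>U\<^esub> y)) c"
        using e_ind3[of c "T (x \<oplus>\<^bsub>U\<^esub> y)" "T x" "T y", OF c T(4)[OF x y]] eC[OF c T(1)] F.m_closed[OF cC] x y
        by (intro coset_eq[symmetric]) (auto simp: F_def)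
      finally show "h (x \<oplus>\<^bsub>U\<^esub> y) (K #>\<^bsub>F\<^esub> c) = (h x \<oplus>\<^bsub>?S\<^esub> h y) (K #>\<^bsub>F\<^esub> c)"
        using c x y by (simp add: h(2))
    qed (use x y h(1) in auto)
  next
    show "h \<one>\<^bsub>U\<^esub> = \<one>\<^bsub>?S\<^esub>"
    proof (rule ext)
      fix c assume c: "c \<in> carrier F"
      have "?e (T \<one>\<^bsub>U\<^esub>) c = ?e (\<lambda>x. x) c"
        using c T(2) by (intro frag_extend_eq) (auto simp: F_def)
      then show "h \<one>\<^bsub>U\<^esub> (K #>\<^bsub>F\<^esub> c) = \<one>\<^bsub>?S\<^esub> (K #>\<^bsub>F\<^esub> c)"
        using c by (simp add: h(2) frag_extend_frag_of) (simp add: endo_ring_def coset_in)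
    qed (use h(1) in auto)
  qed
  have "f \<in> ring_hom U ?S"
    by (rule ringhom[of f L])
      (use f maps rels in \<open>auto simp: L_def U.m_assoc U.l_distr\<close>)
  moreover have "g \<in> ring_hom U ?S"
    by (rule ringhom[of g P])
      (use g maps rels in \<open>auto simp: P_def U.m_assoc U.l_distr\<close>)
  moreover have "\<forall>r\<in>carrier R. f (u r) = g (u r)"
  proof
    fix r assume r: "r \<in> carrier R"
    show "f (u r) = g (u r)"
    proof (rule ext)
      fix c assume c: "c \<in> carrier F"
      \<comment> \<open>Moving a scalar of \<open>R\<close> across the tensor sign is a defining
        relation.\<close>
      have "?e (L (u r)) c - ?e (P (u r)) c \<in> K"
        by (rule e_ind[OF c]) (use r rels(3) in \<open>auto simp: L_def P_def\<close>)
      then show "f (u r) (K #>\<^bsub>F\<^esub> c) = g (u r) (K #>\<^bsub>F\<^esub> c)"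
        using c r uc eC maps by (simp add: f(2) g(2) coset_eq)
    qed (use f(1) g(1) uc r in auto)
  qed
  \<comment> \<open>The test ring consists of maps between cosets, so the epimorphism property is
    used in the form that admits test rings on any type.\<close>
  ultimately have "f v = g v"
    by (rule ring_epimorphismD[OF epi U.ring_axioms S.ring_axioms _ _ _ v])
  moreover have one: "frag_of (\<one>\<^bsub>U\<^esub>, \<one>\<^bsub>U\<^esub>) \<in> carrier F" by (simp add: F_def)
  \<comment> \<open>Both endomorphisms are evaluated at the class of
    \<open>1 \<otimes> 1\<close>.\<close>
  ultimately have "K #>\<^bsub>F\<^esub> frag_of (v, \<one>\<^bsub>U\<^esub>) = K #>\<^bsub>F\<^esub> frag_of (\<one>\<^bsub>U\<^esub>, v)"
    using f(2)[OF v one] g(2)[OF v one] v by (simp add: L_def P_def)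
  from coset_eqD[OF this] v show ?thesis by (simp add: K_def F_def)
qed

section \<open>Submodules \<open>JM\<close> and conductor ideals\<close>

lemma submodule_ideal_times:
  assumes M: "module R M" and J: "ideal J R"
  shows "submodule (ideal_times J M) R M"
proof -
  interpret M: module R M by fact
  interpret J: ideal J R by fact
  note iff = ideal_times_iff[OF M J]
  have JR: "J \<subseteq> carrier R" by (rule J.a_subset)
  have sm: "r \<odot>\<^bsub>M\<^esub> y \<in> ideal_times J M" if r: "r \<in> carrier R" and y: "y \<in> ideal_times J M" for r y
  proof -
    obtain ps where ps: "set ps \<subseteq> J \<times> carrier M" "y = pair_sum M ps" using y iff by blast
    moreover have "set ps \<subseteq> carrier R \<times> carrier M" using ps(1) JR by auto
    ultimately have "r \<odot>\<^bsub>M\<^esub> y = pair_sum M (map (\<lambda>(s, x). (r \<otimes>\<^bsub>R\<^esub> s, x)) ps)"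
      using pair_sum_smult[OF M _ r] by simp
    moreover have "set (map (\<lambda>(s, x). (r \<otimes>\<^bsub>R\<^esub> s, x)) ps) \<subseteq> J \<times> carrier M"
      using ps(1) r J.I_l_closed by auto
    ultimately show ?thesis using iff by blast
  qed
  have carr: "ideal_times J M \<subseteq> carrier M"
  proof
    fix y assume "y \<in> ideal_times J M"
    then obtain ps where ps: "set ps \<subseteq> J \<times> carrier M" "y = pair_sum M ps" using iff by blast
    then have "set ps \<subseteq> carrier R \<times> carrier M" using JR by auto
    then show "y \<in> carrier M" using pair_sum_closed[OF M] ps(2) by simp
  qed
  show ?thesis
  proof (rule M.submoduleI)
    show "\<zero>\<^bsub>M\<^esub> \<in> ideal_times J M" using iff by (force intro: exI[of _ "[]"])
    show "\<ominus>\<^bsub>M\<^esub> y \<in> ideal_times J M" if "y \<in> ideal_times J M" for y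
    proof -
      have "\<ominus>\<^bsub>M\<^esub> y = (\<ominus>\<^bsub>R\<^esub> \<one>\<^bsub>R\<^esub>) \<odot>\<^bsub>M\<^esub> y"
        using subsetD[OF carr that] by (simp add: M.smult_l_minus)
      then show ?thesis using sm[OF _ that, of "\<ominus>\<^bsub>R\<^esub> \<one>\<^bsub>R\<^esub>"] by simp
    qed
    show "y \<oplus>\<^bsub>M\<^esub> z \<in> ideal_times J M" if "y \<in> ideal_times J M" "z \<in> ideal_times J M" for y z
    proof -
      obtain ps qs where "set ps \<subseteq> J \<times> carrier M" "y = pair_sum M ps"
        "set qs \<subseteq> J \<times> carrier M" "z = pair_sum M qs"
        using \<open>y \<in> _\<close> \<open>z \<in> _\<close> iff by blast
      moreover from this have "set ps \<subseteq> carrier R \<times> carrier M" "set qs \<subseteq> carrier R \<times> carrier M"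
        using JR by auto
      ultimately show ?thesis using pair_sum_append[OF M, of ps qs]
        by (intro iffD2[OF iff] exI[of _ "ps @ qs"]) auto
    qed
  qed (use carr sm in auto)
qed

lemma restrict_scalars_minus [simp]:
  "\<ominus>\<^bsub>restrict_scalars U u\<^esub> x = \<ominus>\<^bsub>U\<^esub> x" "x \<ominus>\<^bsub>restrict_scalars U u\<^esub> y = x \<ominus>\<^bsub>U\<^esub> y"
  by (simp_all add: a_inv_def a_minus_def m_inv_def restrict_scalars_def)

text \<open>The colon ideal of the image of \<open>R\<close> by \<open>v\<close>, that is, the ideal
  of denominators of \<open>v\<close>.\<close>

definition conductor :: "'r ring \<Rightarrow> 'u ring \<Rightarrow> ('r \<Rightarrow> 'u) \<Rightarrow> 'u \<Rightarrow> 'r set" where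
  "conductor R U u v = {r \<in> carrier R. u r \<otimes>\<^bsub>U\<^esub> v \<in> u ` carrier R}"

lemma conductorI:
  "r \<in> carrier R \<Longrightarrow> s \<in> carrier R \<Longrightarrow> u r \<otimes>\<^bsub>U\<^esub> v = u s \<Longrightarrow> r \<in> conductor R U u v"
  by (auto simp: conductor_def)

lemma ideal_conductor:
  assumes R: "cring R" and U: "cring U" and u: "u \<in> ring_hom R U" and v: "v \<in> carrier U"
  shows "ideal (conductor R U u v) R"
proof -
  interpret R: cring R by fact
  interpret U: cring U by fact
  let ?U = "restrict_scalars U u"
  note h = ring_hom_closed[OF u] ring_hom_add[OF u] ring_hom_mult[OF u]
  interpret h: ring_hom_ring R U u
    by (rule ring_hom_ringI2) (use R.ring_axioms U.ring_axioms u in auto)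
  show ?thesis
  proof (rule idealI)
    show "subgroup (conductor R U u v) (add_monoid R)"
    proof (rule R.add.subgroupI)
      show "conductor R U u v \<noteq> {}"
        using v by (auto simp: conductor_def intro!: exI[of _ "\<zero>\<^bsub>R\<^esub>"] image_eqI[of _ _ "\<zero>\<^bsub>R\<^esub>"])
      fix a assume a: "a \<in> conductor R U u v"
      then obtain b where b: "a \<in> carrier R" "b \<in> carrier R" "u a \<otimes>\<^bsub>U\<^esub> v = u b"
        by (auto simp: conductor_def)
      then have "u (\<ominus>\<^bsub>R\<^esub> a) \<otimes>\<^bsub>U\<^esub> v = u (\<ominus>\<^bsub>R\<^esub> b)" using v by (simp add: U.l_minus)
      then show "\<ominus>\<^bsub>R\<^esub> a \<in> conductor R U u v" using b by (intro conductorI[of _ _ "\<ominus>\<^bsub>R\<^esub> b"]) auto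
      fix c assume "c \<in> conductor R U u v"
      then obtain d where d: "c \<in> carrier R" "d \<in> carrier R" "u c \<otimes>\<^bsub>U\<^esub> v = u d"
        by (auto simp: conductor_def)
      then have "u (a \<oplus>\<^bsub>R\<^esub> c) \<otimes>\<^bsub>U\<^esub> v = u (b \<oplus>\<^bsub>R\<^esub> d)" using b v by (simp add: U.l_distr)
      then show "a \<oplus>\<^bsub>R\<^esub> c \<in> conductor R U u v" using b d by (intro conductorI[of _ _ "b \<oplus>\<^bsub>R\<^esub> d"]) auto
    qed (auto simp: conductor_def)
    fix a x assume a: "a \<in> conductor R U u v" and x: "x \<in> carrier R"
    then obtain b where b: "a \<in> carrier R" "b \<in> carrier R" "u a \<otimes>\<^bsub>U\<^esub> v = u b"
      by (auto simp: conductor_def)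
    then have "u (x \<otimes>\<^bsub>R\<^esub> a) \<otimes>\<^bsub>U\<^esub> v = u (x \<otimes>\<^bsub>R\<^esub> b)" using v x by (simp add: U.m_assoc)
    then show "x \<otimes>\<^bsub>R\<^esub> a \<in> conductor R U u v" using b x by (intro conductorI[of _ _ "x \<otimes>\<^bsub>R\<^esub> b"]) auto
    then show "a \<otimes>\<^bsub>R\<^esub> x \<in> conductor R U u v" using b x by (simp add: R.m_comm)
  qed (rule R.ring_axioms)
qed

text \<open>By flatness \<open>v \<otimes> 1 = 1 \<otimes> v\<close> already holds in \<open>(R + Rv) \<otimes>\<^sub>R U\<close>, which maps to \<open>U / JU\<close>,
  \<open>J\<close> the conductor of \<open>v\<close>, by \<open>(r + sv) \<otimes> w \<mapsto> sw\<close>. The image of that equality is \<open>1 = 0\<close>.\<close>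

lemma conductor_in_gabriel_topology:
  fixes R :: "'r ring" and U :: "'u ring"
  assumes R: "cring R" and U: "cring U" and fe: "flat_injective_ring_epimorphism R U u"
    and v: "v \<in> carrier U"
  shows "conductor R U u v \<in> gabriel_topology R U u"
proof -
  interpret R: cring R by fact
  interpret U: cring U by fact
  have epi: "ring_epimorphism R U u" and inj: "inj_on u (carrier R)"
    and flat: "flat_module R (restrict_scalars U u)"
    using fe by (auto simp: flat_injective_ring_epimorphism_def)
  have u: "u \<in> ring_hom R U" using epi by (simp add: ring_epimorphism_def)
  interpret h: ring_hom_ring R U u
    by (rule ring_hom_ringI2) (use R.ring_axioms U.ring_axioms u in auto)
  let ?U = "restrict_scalars U u" and ?J = "conductor R U u v"
  have M: "module R ?U" by (rule module_restrict_scalars[OF R U u])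
  interpret M: module R ?U by fact
  have J: "ideal ?J R" by (rule ideal_conductor[OF R U u v])
  define N where "N = ideal_times ?J ?U"
  have N: "submodule N R ?U" unfolding N_def by (rule submodule_ideal_times[OF M J])
  have JN: "u s \<otimes>\<^bsub>U\<^esub> w \<in> N" if "s \<in> ?J" "w \<in> carrier U" for s w
  proof -
    have "s \<in> carrier R" using that by (simp add: conductor_def)
    then have "u s \<otimes>\<^bsub>U\<^esub> w = pair_sum ?U [(s, w)]" using that by simp
    then show ?thesis unfolding N_def ideal_times_iff[OF M J] using that
      by (intro exI[of _ "[(s, w)]"]) auto
  qed
  define Q where "Q = quotient_module ?U N"
  let ?q = "class_rep ?U N"
  have Q: "module R Q" and q: "?q \<in> module_hom R ?U Q"
    unfolding Q_def by (rule module_quotient[OF M N], rule quotient_hom[OF M N])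
  interpret Q: module R Q by fact
  note q_eq = class_rep_eq_iff[OF M N, simplified] and qh = module_homD[OF q, simplified]
  define A where "A = {u r \<oplus>\<^bsub>U\<^esub> u s \<otimes>\<^bsub>U\<^esub> v | r s. r \<in> carrier R \<and> s \<in> carrier R}"
  have A_U: "A \<subseteq> carrier U" using v by (auto simp: A_def)
  have A_mem: "u r \<oplus>\<^bsub>U\<^esub> u s \<otimes>\<^bsub>U\<^esub> v \<in> A" if "r \<in> carrier R" "s \<in> carrier R" for r s
    using that by (auto simp: A_def)
  have add_eq: "(u r \<oplus>\<^bsub>U\<^esub> u s \<otimes>\<^bsub>U\<^esub> v) \<oplus>\<^bsub>U\<^esub> (u r' \<oplus>\<^bsub>U\<^esub> u s' \<otimes>\<^bsub>U\<^esub> v) = u (r \<oplus>\<^bsub>R\<^esub> r') \<oplus>\<^bsub>U\<^esub> u (s \<oplus>\<^bsub>R\<^esub> s') \<otimes>\<^bsub>U\<^esub> v"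
    if "r \<in> carrier R" "s \<in> carrier R" "r' \<in> carrier R" "s' \<in> carrier R" for r s r' s'
    using that v by (simp add: U.l_distr U.a_ac)
  have smult_eq: "u t \<otimes>\<^bsub>U\<^esub> (u r \<oplus>\<^bsub>U\<^esub> u s \<otimes>\<^bsub>U\<^esub> v) = u (t \<otimes>\<^bsub>R\<^esub> r) \<oplus>\<^bsub>U\<^esub> u (t \<otimes>\<^bsub>R\<^esub> s) \<otimes>\<^bsub>U\<^esub> v"
    if "r \<in> carrier R" "s \<in> carrier R" "t \<in> carrier R" for r s t
    using that v by (simp add: U.r_distr U.m_assoc)
  have smA: "u t \<otimes>\<^bsub>U\<^esub> a \<in> A" if "t \<in> carrier R" "a \<in> A" for t a
  proof -
    obtain r s where rs: "r \<in> carrier R" "s \<in> carrier R" "a = u r \<oplus>\<^bsub>U\<^esub> u s \<otimes>\<^bsub>U\<^esub> v"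
      using \<open>a \<in> A\<close> by (auto simp: A_def)
    show ?thesis unfolding rs(3) smult_eq[OF rs(1,2) that(1)] using rs(1,2) that(1) by (intro A_mem) auto
  qed
  have A: "submodule A R ?U"
  proof (rule M.submoduleI)
    show "A \<subseteq> carrier ?U" using A_U by simp
    show "\<zero>\<^bsub>?U\<^esub> \<in> A" using A_mem[of "\<zero>\<^bsub>R\<^esub>" "\<zero>\<^bsub>R\<^esub>"] v by simp
    show "\<ominus>\<^bsub>?U\<^esub> a \<in> A" if "a \<in> A" for a
    proof -
      have "\<ominus>\<^bsub>?U\<^esub> a = (\<ominus>\<^bsub>R\<^esub> \<one>\<^bsub>R\<^esub>) \<odot>\<^bsub>?U\<^esub> a"
        using subsetD[OF A_U that] by (subst M.smult_l_minus) auto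
      then show ?thesis using smA[OF _ that, of "\<ominus>\<^bsub>R\<^esub> \<one>\<^bsub>R\<^esub>"] by simp
    qed
    show "a \<oplus>\<^bsub>?U\<^esub> b \<in> A" if "a \<in> A" "b \<in> A" for a b
    proof -
      obtain r s r' s' where rs: "r \<in> carrier R" "s \<in> carrier R" "r' \<in> carrier R" "s' \<in> carrier R"
        "a = u r \<oplus>\<^bsub>U\<^esub> u s \<otimes>\<^bsub>U\<^esub> v" "b = u r' \<oplus>\<^bsub>U\<^esub> u s' \<otimes>\<^bsub>U\<^esub> v"
        using \<open>a \<in> A\<close> \<open>b \<in> A\<close> by (auto simp: A_def)
      show ?thesis
        unfolding rs(5,6) restrict_scalars_simps add_eq[OF rs(1-4)] using rs(1-4) by (intro A_mem) auto
    qed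
  qed (use smA in auto)
  let ?A = "?U\<lparr>carrier := A\<rparr>"
  have mA: "module R ?A" by (rule submodule.submodule_is_module[OF A M])
  \<comment> \<open>A chosen coefficient of \<open>v\<close> for each element of
    \<open>R + Rv\<close>; it is determined only modulo the conductor.\<close>
  define \<sigma> where "\<sigma> a = (SOME s. s \<in> carrier R \<and> (\<exists>r\<in>carrier R. a = u r \<oplus>\<^bsub>U\<^esub> u s \<otimes>\<^bsub>U\<^esub> v))" for a
  have \<sigma>: "\<sigma> a \<in> carrier R \<and> (\<exists>r\<in>carrier R. a = u r \<oplus>\<^bsub>U\<^esub> u (\<sigma> a) \<otimes>\<^bsub>U\<^esub> v)" if "a \<in> A" for a
    unfolding \<sigma>_def by (rule someI_ex) (use that in \<open>auto simp: A_def\<close>)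
  define \<beta> where "\<beta> = (\<lambda>(a, w). ?q (u (\<sigma> a) \<otimes>\<^bsub>U\<^esub> w))"
  \<comment> \<open>Two coefficients \<open>s\<close> and \<open>s'\<close> for the same element
    satisfy \<open>(s' - s) v = r - r'\<close>, which is in \<open>R\<close>. Hence
    \<open>s' - s\<close> lies in the conductor, and \<open>s w\<close> and \<open>s' w\<close>
    agree modulo \<open>JU\<close>.\<close>
  have \<beta>: "\<beta> (u r \<oplus>\<^bsub>U\<^esub> u s \<otimes>\<^bsub>U\<^esub> v, w) = ?q (u s \<otimes>\<^bsub>U\<^esub> w)"
    if r: "r \<in> carrier R" and s: "s \<in> carrier R" and w: "w \<in> carrier U" for r s w
  proof -
    let ?a = "u r \<oplus>\<^bsub>U\<^esub> u s \<otimes>\<^bsub>U\<^esub> v"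
    obtain r' where r': "r' \<in> carrier R" "?a = u r' \<oplus>\<^bsub>U\<^esub> u (\<sigma> ?a) \<otimes>\<^bsub>U\<^esub> v" and \<sigma>': "\<sigma> ?a \<in> carrier R"
      using \<sigma>[OF A_mem[OF r s]] by blast
    define s' where "s' = \<sigma> ?a"
    have s': "s' \<in> carrier R" "?a = u r' \<oplus>\<^bsub>U\<^esub> u s' \<otimes>\<^bsub>U\<^esub> v" using \<sigma>' r'(2) by (auto simp: s'_def)
    have "u (s' \<ominus>\<^bsub>R\<^esub> s) \<otimes>\<^bsub>U\<^esub> v = u s' \<otimes>\<^bsub>U\<^esub> v \<ominus>\<^bsub>U\<^esub> u s \<otimes>\<^bsub>U\<^esub> v"
      using s s' v by (simp add: a_minus_def U.l_distr U.l_minus)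
    also have "\<dots> = (u r' \<oplus>\<^bsub>U\<^esub> u s' \<otimes>\<^bsub>U\<^esub> v) \<ominus>\<^bsub>U\<^esub> u r' \<ominus>\<^bsub>U\<^esub> u s \<otimes>\<^bsub>U\<^esub> v"
      using s s' r' v by (simp add: a_minus_def U.a_ac U.r_neg U.r_neg1 U.r_neg2)
    also have "\<dots> = u r \<ominus>\<^bsub>U\<^esub> u r'"
      unfolding s'(2)[symmetric] using r r'(1) s v
      by (simp add: a_minus_def U.a_ac U.r_neg U.r_neg1 U.r_neg2)
    also have "\<dots> = u (r \<ominus>\<^bsub>R\<^esub> r')" using r r' by (simp add: a_minus_def)
    finally have "s' \<ominus>\<^bsub>R\<^esub> s \<in> ?J" using r r' s s' by (intro conductorI[of _ _ "r \<ominus>\<^bsub>R\<^esub> r'"]) auto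
    from JN[OF this w] have "u s' \<otimes>\<^bsub>U\<^esub> w \<ominus>\<^bsub>U\<^esub> u s \<otimes>\<^bsub>U\<^esub> w \<in> N"
      using s s'(1) w by (simp add: a_minus_def U.l_distr U.l_minus)
    then show ?thesis using s s'(1) w by (simp add: \<beta>_def q_eq flip: s'_def)
  qed
  let ?F = "free_Abelian_group (A \<times> carrier U)"
  have "\<beta> ` (A \<times> carrier U) \<subseteq> carrier (add_monoid Q)"
    using \<sigma> qh(1) by (auto simp: \<beta>_def)
  then obtain h where h: "h \<in> hom ?F (add_monoid Q)" "\<And>x. x \<in> A \<times> carrier U \<Longrightarrow> h (frag_of x) = \<beta> x"
    using comm_group.free_Abelian_group_universal[OF Q.M.a_comm_group] by metis
  interpret h': group_hom ?F "add_monoid Q" h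
    by (intro group_hom.intro group_hom_axioms.intro) (use h(1) Q.M.a_group in auto)
  have h_add: "h (c + d) = h c \<oplus>\<^bsub>Q\<^esub> h d" if "Poly_Mapping.keys c \<subseteq> A \<times> carrier U" "Poly_Mapping.keys d \<subseteq> A \<times> carrier U" for c d
    using h'.hom_mult[of c d] that by simp
  have h_neg: "h (- c) = \<ominus>\<^bsub>Q\<^esub> h c" if "Poly_Mapping.keys c \<subseteq> A \<times> carrier U" for c
    using h'.hom_inv[of c] that by (simp add: a_inv_def)
  have h_zero: "h 0 = \<zero>\<^bsub>Q\<^esub>" using h'.hom_one by simp
  have h_diff: "h (c - d) = h c \<ominus>\<^bsub>Q\<^esub> h d" if "Poly_Mapping.keys c \<subseteq> A \<times> carrier U" "Poly_Mapping.keys d \<subseteq> A \<times> carrier U" for c d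
    using h_add[of c "- d"] h_neg[of d] that by (simp add: a_minus_def)
  \<comment> \<open>\<open>h\<close> kills every tensor relation, so it factors through
    \<open>A \<otimes> U\<close>. The support is carried along in the induction because
    \<open>h\<close> is additive only on chains supported in \<open>A \<times> U\<close>.\<close>
  have hK: "h c = \<zero>\<^bsub>Q\<^esub> \<and> Poly_Mapping.keys c \<subseteq> A \<times> carrier U" if "c \<in> tensor_kernel R ?A ?U" for c
    using mA M that
  proof (induction rule: tensor_kernel_induct)
    case (rel c)
    have key: "Poly_Mapping.keys c \<subseteq> A \<times> carrier U"
      using tensor_kernel_keys[OF mA M tensor_kernel_rel[OF mA M rel]] by simp
    have d2: "h (frag_of x - frag_of y) = \<beta> x \<ominus>\<^bsub>Q\<^esub> \<beta> y" if "x \<in> A \<times> carrier U" "y \<in> A \<times> carrier U" for x y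
      using that by (simp add: h_diff h(2))
    have d3: "h (frag_of x - frag_of y - frag_of z) = \<beta> x \<ominus>\<^bsub>Q\<^esub> \<beta> y \<ominus>\<^bsub>Q\<^esub> \<beta> z"
      if "x \<in> A \<times> carrier U" "y \<in> A \<times> carrier U" "z \<in> A \<times> carrier U" for x y z
    proof -
      have "Poly_Mapping.keys (frag_of x - frag_of y) \<subseteq> A \<times> carrier U"
        using keys_frag_of_diff2[of x y] that by blast
      then show ?thesis using h_diff[of "frag_of x - frag_of y" "frag_of z"] that d2[of x y] by (simp add: h(2))
    qed
    have cancel: "(a \<oplus>\<^bsub>Q\<^esub> b) \<ominus>\<^bsub>Q\<^esub> a \<ominus>\<^bsub>Q\<^esub> b = \<zero>\<^bsub>Q\<^esub>" if "a \<in> carrier Q" "b \<in> carrier Q" for a b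
    proof -
      have "(a \<oplus>\<^bsub>Q\<^esub> b) \<ominus>\<^bsub>Q\<^esub> a \<ominus>\<^bsub>Q\<^esub> b = (a \<oplus>\<^bsub>Q\<^esub> \<ominus>\<^bsub>Q\<^esub> a) \<oplus>\<^bsub>Q\<^esub> (b \<oplus>\<^bsub>Q\<^esub> \<ominus>\<^bsub>Q\<^esub> b)"
        using that by (simp add: a_minus_def Q.M.a_ac)
      then show ?thesis using that by (simp add: Q.M.r_neg)
    qed
    from rel have "h c = \<zero>\<^bsub>Q\<^esub>" unfolding tensor_relations_def
    proof (elim UnE CollectE exE conjE)
      fix x x' w assume c: "c = frag_of (x \<oplus>\<^bsub>?A\<^esub> x', w) - frag_of (x, w) - frag_of (x', w)"
        and "x \<in> carrier ?A" "x' \<in> carrier ?A" and w: "w \<in> carrier ?U"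
      then obtain r s r' s' where rs: "r \<in> carrier R" "s \<in> carrier R" "r' \<in> carrier R" "s' \<in> carrier R"
        "x = u r \<oplus>\<^bsub>U\<^esub> u s \<otimes>\<^bsub>U\<^esub> v" "x' = u r' \<oplus>\<^bsub>U\<^esub> u s' \<otimes>\<^bsub>U\<^esub> v"
        by (auto simp: A_def)
      have w': "w \<in> carrier U" using w by simp
      have "\<beta> (x \<oplus>\<^bsub>U\<^esub> x', w) = ?q (u (s \<oplus>\<^bsub>R\<^esub> s') \<otimes>\<^bsub>U\<^esub> w)"
        unfolding rs(5,6) add_eq[OF rs(1-4)] by (rule \<beta>) (use rs w in auto)
      also have "\<dots> = \<beta> (x, w) \<oplus>\<^bsub>Q\<^esub> \<beta> (x', w)"
        using rs(1-4) w' by (simp add: rs(5,6) \<beta> U.l_distr qh)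
      finally have "\<beta> (x \<oplus>\<^bsub>U\<^esub> x', w) = \<beta> (x, w) \<oplus>\<^bsub>Q\<^esub> \<beta> (x', w)" .
      moreover have "\<beta> (x, w) \<in> carrier Q" "\<beta> (x', w) \<in> carrier Q"
        using rs(1-4) w' by (simp_all add: rs(5,6) \<beta> qh)
      moreover have "x \<in> A" "x' \<in> A" "x \<oplus>\<^bsub>U\<^esub> x' \<in> A"
        unfolding rs(5,6) add_eq[OF rs(1-4)] by (rule A_mem; simp add: rs(1-4))+
      ultimately show "h c = \<zero>\<^bsub>Q\<^esub>" unfolding c using w' by (simp add: d3 cancel)
    next
      fix x w w' assume c: "c = frag_of (x, w \<oplus>\<^bsub>?U\<^esub> w') - frag_of (x, w) - frag_of (x, w')"
        and "x \<in> carrier ?A" and w: "w \<in> carrier ?U" "w' \<in> carrier ?U"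
      then obtain r s where rs: "r \<in> carrier R" "s \<in> carrier R" "x = u r \<oplus>\<^bsub>U\<^esub> u s \<otimes>\<^bsub>U\<^esub> v"
        by (auto simp: A_def)
      have "\<beta> (x, w \<oplus>\<^bsub>U\<^esub> w') = \<beta> (x, w) \<oplus>\<^bsub>Q\<^esub> \<beta> (x, w')" "\<beta> (x, w) \<in> carrier Q" "\<beta> (x, w') \<in> carrier Q"
        using rs(1-2) w by (simp_all add: rs(3) \<beta> U.r_distr qh)
      moreover have "x \<in> A" unfolding rs(3) using rs(1,2) by (rule A_mem)
      ultimately show "h c = \<zero>\<^bsub>Q\<^esub>" unfolding c using w by (simp add: d3 cancel)
    next
      fix t x w assume c: "c = frag_of (t \<odot>\<^bsub>?A\<^esub> x, w) - frag_of (x, t \<odot>\<^bsub>?U\<^esub> w)"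
        and "x \<in> carrier ?A" and w: "w \<in> carrier ?U" and t: "t \<in> carrier R"
      then obtain r s where rs: "r \<in> carrier R" "s \<in> carrier R" "x = u r \<oplus>\<^bsub>U\<^esub> u s \<otimes>\<^bsub>U\<^esub> v"
        by (auto simp: A_def)
      have "\<beta> (u t \<otimes>\<^bsub>U\<^esub> x, w) = ?q (u (t \<otimes>\<^bsub>R\<^esub> s) \<otimes>\<^bsub>U\<^esub> w)"
        unfolding rs(3) smult_eq[OF rs(1,2) t] by (rule \<beta>) (use rs w t in auto)
      also have "\<dots> = \<beta> (x, u t \<otimes>\<^bsub>U\<^esub> w)"
        using rs(1,2) w t by (simp add: rs(3) \<beta> U.m_ac)
      finally have "\<beta> (u t \<otimes>\<^bsub>U\<^esub> x, w) = \<beta> (x, u t \<otimes>\<^bsub>U\<^esub> w)" .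
      moreover have "\<beta> (x, u t \<otimes>\<^bsub>U\<^esub> w) \<in> carrier Q"
        using rs(1,2) w t by (simp add: rs(3) \<beta> qh)
      moreover have "x \<in> A" unfolding rs(3) using rs(1,2) by (rule A_mem)
      ultimately show "h c = \<zero>\<^bsub>Q\<^esub>"
        unfolding c using w t smA[OF t, of x] by (simp add: d2 a_minus_def Q.M.r_neg)
    qed
    then show ?case using key by simp
  next
    case (add c d)
    then show ?case using keys_add[of c d] by (auto simp: h_add)
  qed (auto simp: h_zero h_neg)
  have one: "\<one>\<^bsub>U\<^esub> \<in> A" "v \<in> A"
    using A_mem[of "\<one>\<^bsub>R\<^esub>" "\<zero>\<^bsub>R\<^esub>"] A_mem[of "\<zero>\<^bsub>R\<^esub>" "\<one>\<^bsub>R\<^esub>"] v by simp_all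
  \<comment> \<open>In terms of the coefficients \<open>(r, s)\<close>, \<open>v\<close> is
    \<open>(0, 1)\<close> and \<open>1\<close> is \<open>(1, 0)\<close>.\<close>
  have \<beta>1: "\<beta> (v, \<one>\<^bsub>U\<^esub>) = ?q \<one>\<^bsub>U\<^esub>" "\<beta> (\<one>\<^bsub>U\<^esub>, v) = ?q \<zero>\<^bsub>U\<^esub>"
    using \<beta>[of "\<zero>\<^bsub>R\<^esub>" "\<one>\<^bsub>R\<^esub>" "\<one>\<^bsub>U\<^esub>"] \<beta>[of "\<one>\<^bsub>R\<^esub>" "\<zero>\<^bsub>R\<^esub>" v] v by simp_all
  have incl: "(\<lambda>x. x) \<in> module_hom R ?A ?U" using A_U by (intro module_homI) auto
  let ?c = "frag_of (v, \<one>\<^bsub>U\<^esub>) - frag_of (\<one>\<^bsub>U\<^esub>, v)"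
  \<comment> \<open>Flatness is applied to the inclusion of \<open>R + Rv\<close> into
    \<open>U\<close>: a chain supported over \<open>R + Rv\<close> that vanishes in
    \<open>U \<otimes> U\<close> vanishes already in \<open>A \<otimes> U\<close>.\<close>
  have "inj_on (tensor_map R ?U ?U (\<lambda>x. x)) (carrier (tensor_product R ?A ?U))"
    by (rule flat_moduleD[OF flat mA M incl]) simp
  moreover have "tensor_push (\<lambda>x. x) ?c \<in> tensor_kernel R ?U ?U"
    using epimorphism_tensor[OF R U epi v] by (simp add: tensor_push_id)
  moreover have "Poly_Mapping.keys ?c \<subseteq> carrier ?A \<times> carrier ?U"
    using one v by (intro order_trans[OF keys_frag_of_diff2]) auto
  ultimately have "?c \<in> tensor_kernel R ?A ?U"
    unfolding inj_on_tensor_map_iff[OF mA M M incl] by blast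
  then have "h ?c = \<zero>\<^bsub>Q\<^esub>" using hK by blast
  then have "?q \<one>\<^bsub>U\<^esub> \<ominus>\<^bsub>Q\<^esub> ?q \<zero>\<^bsub>U\<^esub> = \<zero>\<^bsub>Q\<^esub>"
    using one v by (simp add: h_diff h(2) \<beta>1)
  then have "?q \<one>\<^bsub>U\<^esub> = ?q \<zero>\<^bsub>U\<^esub>" using qh(1) by (simp add: Q.M.minus_eq_zero_iff)
  then have "\<one>\<^bsub>U\<^esub> \<ominus>\<^bsub>?U\<^esub> \<zero>\<^bsub>?U\<^esub> \<in> N" by (simp add: q_eq)
  then have "\<one>\<^bsub>U\<^esub> \<in> N" by (simp add: a_minus_def)
  then obtain ps where ps: "set ps \<subseteq> ?J \<times> carrier U" "\<one>\<^bsub>U\<^esub> = pair_sum ?U ps"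
    unfolding N_def using ideal_times_iff[OF M J] by auto
  \<comment> \<open>A combination representing \<open>1\<close>, multiplied by \<open>y\<close>,
    represents \<open>y\<close>.\<close>
  have "ideal_times ?J ?U = carrier ?U"
    unfolding ideal_times_eq_iff[OF M J]
  proof
    fix y assume "y \<in> carrier ?U"
    then have y: "y \<in> carrier U" by simp
    have hom: "(\<lambda>w. w \<otimes>\<^bsub>U\<^esub> y) \<in> module_hom R ?U ?U"
      using y by (intro module_homI) (auto simp: U.l_distr U.m_assoc)
    have "set ps \<subseteq> carrier R \<times> carrier ?U" using ps(1) by (auto simp: conductor_def)
    from pair_sum_hom[OF M M hom this]
    have "y = pair_sum ?U (map (\<lambda>(s, x). (s, x \<otimes>\<^bsub>U\<^esub> y)) ps)" using y by (simp flip: ps(2))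
    moreover have "set (map (\<lambda>(s, x). (s, x \<otimes>\<^bsub>U\<^esub> y)) ps) \<subseteq> ?J \<times> carrier ?U"
      using ps(1) y by auto
    ultimately show "\<exists>ps. set ps \<subseteq> ?J \<times> carrier ?U \<and> y = pair_sum ?U ps" by blast
  qed
  then show ?thesis using J by (simp add: gabriel_topology_def)
qed

section \<open>Envelopes of the regular module\<close>

lemma regular_module_simps [simp]:
  "carrier (regular_module R) = carrier R" "x \<oplus>\<^bsub>regular_module R\<^esub> y = x \<oplus>\<^bsub>R\<^esub> y"
  "r \<odot>\<^bsub>regular_module R\<^esub> x = r \<otimes>\<^bsub>R\<^esub> x"
  by (simp_all add: regular_module_def)

lemma regular_module_hom:
  assumes "module R M" "m \<in> carrier M"
  shows "(\<lambda>r. r \<odot>\<^bsub>M\<^esub> m) \<in> module_hom R (regular_module R) M"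
proof -
  interpret module R M by fact
  show ?thesis using assms(2) by (intro module_homI) (auto simp: smult_l_distr smult_assoc1)
qed

text \<open>Supplies the endomorphism \<open>\<Sum> a\<^sub>i g\<^sub>i\<close> of the envelope;
  \<open>ps\<close> pairs each coefficient with the index of its homomorphism.\<close>

lemma pair_sum_module_hom:
  assumes "module R N" "\<And>a x. (a, x) \<in> set ps \<Longrightarrow> a \<in> carrier R \<and> g x \<in> module_hom R M N"
  shows "(\<lambda>y. pair_sum N (map (\<lambda>(a, x). (a, g x y)) ps)) \<in> module_hom R M N"
  using assms(2)
proof (induction ps)
  case Nil
  show ?case using module_hom_const_zero[OF assms(1)] by simp
next
  case (Cons p ps)
  obtain a x where p: "p = (a, x)" by (cases p)
  have "a \<in> carrier R" "g x \<in> module_hom R M N" using Cons.prems[of a x] p by auto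
  moreover have "(\<lambda>y. pair_sum N (map (\<lambda>(a, x). (a, g x y)) ps)) \<in> module_hom R M N"
    using Cons by auto
  ultimately show ?case
    using module_hom_add[OF assms(1) module_hom_smult[OF assms(1)]] by (simp add: p)
qed

lemma pair_sum_zero:
  assumes "module R M" "\<And>a x. (a, x) \<in> set ps \<Longrightarrow> a \<odot>\<^bsub>M\<^esub> x = \<zero>\<^bsub>M\<^esub>"
  shows "pair_sum M ps = \<zero>\<^bsub>M\<^esub>"
proof -
  interpret module R M by fact
  show ?thesis using assms(2) by (induction ps) auto
qed

section \<open>Torsion-freeness of the envelope and its extension to \<open>U\<close>\<close>

text \<open>A combination of endomorphisms with coefficients in \<open>J\<close> vanishes on
  whatever \<open>J\<close> kills. Divisibility and the preenvelope property produce such a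
  combination that fixes the image of \<open>1\<close>; the envelope property makes it an
  automorphism, hence injective.\<close>

lemma divisible_envelope_torsion_free:
  assumes \<G>: "\<And>J. J \<in> \<G> \<Longrightarrow> ideal J R"
    and R: "cring R" and env: "envelope R (divisible_modules R \<G>) (regular_module R) C \<mu>"
    and J: "J \<in> \<G>" and y: "y \<in> carrier C" and tors: "\<And>r. r \<in> J \<Longrightarrow> r \<odot>\<^bsub>C\<^esub> y = \<zero>\<^bsub>C\<^esub>"
  shows "y = \<zero>\<^bsub>C\<^esub>"
proof -
  interpret R: cring R by fact
  have C: "C \<in> divisible_modules R \<G>" and \<mu>: "\<mu> \<in> module_hom R (regular_module R) C"
    and pre: "\<And>f. f \<in> module_hom R (regular_module R) C \<Longrightarrow> \<exists>g\<in>module_hom R C C. \<forall>r\<in>carrier R. g (\<mu> r) = f r"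
    and aut: "\<And>f. f \<in> module_hom R C C \<Longrightarrow> (\<And>r. r \<in> carrier R \<Longrightarrow> f (\<mu> r) = \<mu> r) \<Longrightarrow>
      bij_betw f (carrier C) (carrier C)"
    using env by (auto simp: envelope_def preenvelope_def)
  have M: "module R C" using C by (simp add: divisible_modules_def)
  interpret C: module R C by fact
  note h\<mu> = module_homD[OF \<mu>, simplified]
  have JR: "J \<subseteq> carrier R" using additive_subgroup.a_subset[OF ideal.axioms(1)[OF \<G>[OF J]]] .
  define d where "d = \<mu> \<one>\<^bsub>R\<^esub>"
  have d: "d \<in> carrier C" by (simp add: d_def h\<mu>)
  have \<mu>d: "\<mu> r = r \<odot>\<^bsub>C\<^esub> d" if "r \<in> carrier R" for r
    using h\<mu>(3)[OF that, of "\<one>\<^bsub>R\<^esub>"] that by (simp add: d_def)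
  have "ideal_times J C = carrier C" using C J by (simp add: divisible_modules_def)
  then obtain ps where ps: "set ps \<subseteq> J \<times> carrier C" "d = pair_sum C ps"
    using ideal_times_eq_iff[OF M \<G>[OF J]] d by blast
  \<comment> \<open>The homomorphism \<open>r \<mapsto> r x\<close> factors through
    \<open>\<mu>\<close>, so every \<open>x\<close> is the value at \<open>d\<close> of some
    endomorphism of \<open>C\<close>.\<close>
  have "\<forall>x\<in>carrier C. \<exists>g. g \<in> module_hom R C C \<and> g d = x"
  proof
    fix x assume x: "x \<in> carrier C"
    obtain g where "g \<in> module_hom R C C" "g (\<mu> \<one>\<^bsub>R\<^esub>) = \<one>\<^bsub>R\<^esub> \<odot>\<^bsub>C\<^esub> x"
      using pre[OF regular_module_hom[OF M x]] by blast
    then show "\<exists>g. g \<in> module_hom R C C \<and> g d = x" using x by (auto simp: d_def)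
  qed
  from bchoice[OF this] obtain g where g: "\<And>x. x \<in> carrier C \<Longrightarrow> g x \<in> module_hom R C C \<and> g x d = x"
    by blast
  define \<alpha> where "\<alpha> y = pair_sum C (map (\<lambda>(a, x). (a, g x y)) ps)" for y
  have \<alpha>: "\<alpha> \<in> module_hom R C C"
    unfolding \<alpha>_def using ps(1) JR g by (intro pair_sum_module_hom[OF M]) auto
  \<comment> \<open>Replacing each \<open>x\<close> by \<open>g x d\<close> changes nothing, so
    \<open>\<alpha> d\<close> is the combination that represents \<open>d\<close>.\<close>
  have "map (\<lambda>(a, x). (a, g x d)) ps = ps"
    using ps(1) g by (intro map_idI) auto
  then have "\<alpha> d = d" by (simp add: \<alpha>_def ps(2))
  then have "\<alpha> (\<mu> r) = \<mu> r" if "r \<in> carrier R" for r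
    using that d by (simp add: \<mu>d module_homD(3)[OF \<alpha>])
  then have bij: "bij_betw \<alpha> (carrier C) (carrier C)" using aut[OF \<alpha>] by blast
  have "\<alpha> y = \<zero>\<^bsub>C\<^esub>" unfolding \<alpha>_def
  proof (rule pair_sum_zero[OF M])
    fix a z assume "(a, z) \<in> set (map (\<lambda>(a, x). (a, g x y)) ps)"
    then obtain x where x: "(a, x) \<in> set ps" "z = g x y" by auto
    then have gx: "g x \<in> module_hom R C C" "a \<in> J" "a \<in> carrier R" using ps(1) g JR by auto
    have "a \<odot>\<^bsub>C\<^esub> z = g x (a \<odot>\<^bsub>C\<^esub> y)" using x(2) gx y by (simp add: module_homD(3)[OF gx(1)])
    then show "a \<odot>\<^bsub>C\<^esub> z = \<zero>\<^bsub>C\<^esub>" using tors[OF gx(2)] module_hom_zero[OF M M gx(1)] by simp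
  qed
  then have "\<alpha> y = \<alpha> \<zero>\<^bsub>C\<^esub>" using module_hom_zero[OF M M \<alpha>] by simp
  then show ?thesis using bij y by (auto simp: bij_betw_def dest: inj_onD)
qed

text \<open>If \<open>\<mu> 1 = \<Sum> a\<^sub>i x\<^sub>i\<close> with \<open>a\<^sub>i\<close> in the conductor of \<open>v\<close>, the image of \<open>v\<close> is \<open>\<Sum> (a\<^sub>i v) x\<^sub>i\<close>.\<close>

lemma divisible_envelope_extends:
  fixes R :: "'r ring" and U :: "'u ring"
  assumes R: "cring R" and U: "cring U" and fe: "flat_injective_ring_epimorphism R U u"
    and env: "envelope R (divisible_modules R (gabriel_topology R U u)) (regular_module R) C \<mu>"
  shows "\<exists>h\<in>module_hom R (restrict_scalars U u) C. h \<one>\<^bsub>U\<^esub> = \<mu> \<one>\<^bsub>R\<^esub>"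
proof -
  interpret R: cring R by fact
  interpret U: cring U by fact
  let ?G = "gabriel_topology R U u" and ?J = "conductor R U u"
  have inj: "inj_on u (carrier R)" and u: "u \<in> ring_hom R U"
    using fe by (auto simp: flat_injective_ring_epimorphism_def ring_epimorphism_def)
  note hu = ring_hom_closed[OF u] ring_hom_add[OF u] ring_hom_mult[OF u] ring_hom_one[OF u]
  have idG: "ideal J R" if "J \<in> ?G" for J using that by (simp add: gabriel_topology_def)
  note JG = conductor_in_gabriel_topology[OF R U fe]
  have C: "C \<in> divisible_modules R ?G" and \<mu>: "\<mu> \<in> module_hom R (regular_module R) C"
    using env by (auto simp: envelope_def preenvelope_def)
  have M: "module R C" using C by (simp add: divisible_modules_def)
  interpret C: module R C by fact
  note tf = divisible_envelope_torsion_free[OF idG R env]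
  define d where "d = \<mu> \<one>\<^bsub>R\<^esub>"
  have d: "d \<in> carrier C" using module_homD(1)[OF \<mu>, of "\<one>\<^bsub>R\<^esub>"] by (simp add: d_def)
  \<comment> \<open>\<open>good v y\<close> says that \<open>y\<close> behaves like
    \<open>v d\<close>: whenever \<open>r v = s\<close> is in \<open>R\<close>, then
    \<open>r y = s d\<close>.\<close>
  define good where "good v y \<longleftrightarrow> y \<in> carrier C \<and> (\<forall>r\<in>carrier R. \<forall>s\<in>carrier R.
    u r \<otimes>\<^bsub>U\<^esub> v = u s \<longrightarrow> r \<odot>\<^bsub>C\<^esub> y = s \<odot>\<^bsub>C\<^esub> d)" for v y
  have ex: "\<exists>y. good v y" if v: "v \<in> carrier U" for v
  proof -
    have JR: "?J v \<subseteq> carrier R" by (auto simp: conductor_def)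
    have "ideal_times (?J v) C = carrier C" using C JG[OF v] by (simp add: divisible_modules_def)
    then obtain ps where ps: "set ps \<subseteq> ?J v \<times> carrier C" "d = pair_sum C ps"
      using ideal_times_eq_iff[OF M idG[OF JG[OF v]]] d by blast
    \<comment> \<open>\<open>\<tau> a\<close> is the product of \<open>a\<close> and
      \<open>v\<close>, read back as an element of \<open>R\<close>.\<close>
    define \<tau> where "\<tau> a = inv_into (carrier R) u (u a \<otimes>\<^bsub>U\<^esub> v)" for a
    have \<tau>: "\<tau> a \<in> carrier R" "u (\<tau> a) = u a \<otimes>\<^bsub>U\<^esub> v" if "a \<in> ?J v" for a
    proof -
      have "u a \<otimes>\<^bsub>U\<^esub> v \<in> u ` carrier R" using that by (simp add: conductor_def)
      then show "\<tau> a \<in> carrier R" "u (\<tau> a) = u a \<otimes>\<^bsub>U\<^esub> v"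
        unfolding \<tau>_def by (rule inv_into_into, rule f_inv_into_f)
    qed
    define qs where "qs = map (\<lambda>(a, x). (\<tau> a, x)) ps"
    have qs: "set qs \<subseteq> carrier R \<times> carrier C" using ps(1) \<tau> by (auto simp: qs_def)
    have psR: "set ps \<subseteq> carrier R \<times> carrier C" using ps(1) JR by auto
    have "good v (pair_sum C qs)"
      unfolding good_def
    proof (intro conjI ballI impI)
      show "pair_sum C qs \<in> carrier C" by (rule pair_sum_closed[OF M qs])
      fix r s assume r: "r \<in> carrier R" and s: "s \<in> carrier R" and rs: "u r \<otimes>\<^bsub>U\<^esub> v = u s"
      \<comment> \<open>Both sides map to \<open>a r v\<close> in \<open>U\<close>; injectivity of
        \<open>u\<close> brings the equation back to \<open>R\<close>.\<close>
      have eq: "r \<otimes>\<^bsub>R\<^esub> \<tau> a = s \<otimes>\<^bsub>R\<^esub> a" if a: "a \<in> ?J v" for a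
      proof (rule inj_onD[OF inj])
        have aR: "a \<in> carrier R" using a JR by auto
        show "r \<otimes>\<^bsub>R\<^esub> \<tau> a \<in> carrier R" "s \<otimes>\<^bsub>R\<^esub> a \<in> carrier R" using r s aR \<tau>[OF a] by auto
        have "u (r \<otimes>\<^bsub>R\<^esub> \<tau> a) = u a \<otimes>\<^bsub>U\<^esub> (u r \<otimes>\<^bsub>U\<^esub> v)"
          using r aR v \<tau>[OF a] by (simp add: hu U.m_lcomm)
        also have "\<dots> = u (s \<otimes>\<^bsub>R\<^esub> a)" using s aR unfolding rs by (simp add: hu U.m_comm)
        finally show "u (r \<otimes>\<^bsub>R\<^esub> \<tau> a) = u (s \<otimes>\<^bsub>R\<^esub> a)" .
      qed
      have "r \<odot>\<^bsub>C\<^esub> pair_sum C qs = pair_sum C (map (\<lambda>(a, x). (r \<otimes>\<^bsub>R\<^esub> a, x)) qs)"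
        by (rule pair_sum_smult[OF M qs r])
      also have "map (\<lambda>(a, x). (r \<otimes>\<^bsub>R\<^esub> a, x)) qs = map (\<lambda>(a, x). (s \<otimes>\<^bsub>R\<^esub> a, x)) ps"
        using ps(1) eq by (auto simp: qs_def)
      also have "pair_sum C \<dots> = s \<odot>\<^bsub>C\<^esub> d"
        unfolding ps(2) by (rule pair_sum_smult[OF M psR s, symmetric])
      finally show "r \<odot>\<^bsub>C\<^esub> pair_sum C qs = s \<odot>\<^bsub>C\<^esub> d" .
    qed
    then show ?thesis by blast
  qed
  define h where "h v = (SOME y. good v y)" for v
  have "good v (h v)" if "v \<in> carrier U" for v
    unfolding h_def using ex[OF that] by (rule someI_ex)
  then have h: "h v \<in> carrier C"
    "\<And>r s. r \<in> carrier R \<Longrightarrow> s \<in> carrier R \<Longrightarrow> u r \<otimes>\<^bsub>U\<^esub> v = u s \<Longrightarrow> r \<odot>\<^bsub>C\<^esub> h v = s \<odot>\<^bsub>C\<^esub> d"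
    if "v \<in> carrier U" for v
    using that unfolding good_def by blast+
  \<comment> \<open>The conductor of \<open>v\<close> lies in the Gabriel topology and kills
    \<open>y - z\<close>, so torsion-freeness of \<open>C\<close> gives equality.\<close>
  have uniq: "y = z"
    if v: "v \<in> carrier U" and y: "y \<in> carrier C" and z: "z \<in> carrier C"
      and *: "\<And>r s. r \<in> carrier R \<Longrightarrow> s \<in> carrier R \<Longrightarrow> u r \<otimes>\<^bsub>U\<^esub> v = u s \<Longrightarrow> r \<odot>\<^bsub>C\<^esub> y = r \<odot>\<^bsub>C\<^esub> z" for v y z
  proof -
    have "y \<ominus>\<^bsub>C\<^esub> z = \<zero>\<^bsub>C\<^esub>"
    proof (rule tf[OF _ JG[OF v]])
      fix r assume "r \<in> ?J v"
      then obtain s where "r \<in> carrier R" "s \<in> carrier R" "u r \<otimes>\<^bsub>U\<^esub> v = u s" by (auto simp: conductor_def)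
      with *[OF this] y z show "r \<odot>\<^bsub>C\<^esub> (y \<ominus>\<^bsub>C\<^esub> z) = \<zero>\<^bsub>C\<^esub>"
        by (simp add: a_minus_def C.smult_r_distr C.smult_r_minus C.M.r_neg)
    qed (use y z in auto)
    then show ?thesis using y z by (simp add: C.M.minus_eq_zero_iff)
  qed
  have "h \<in> module_hom R (restrict_scalars U u) C"
  proof (rule module_homI; unfold restrict_scalars_simps)
    fix v w assume v: "v \<in> carrier U" and w: "w \<in> carrier U"
    show "h v \<in> carrier C" by (rule h(1)[OF v])
    \<comment> \<open>Denominators \<open>r\<close> of \<open>v\<close> and \<open>r'\<close> of
      \<open>w\<close> are tested in turn, since it is their product that is sure to be a
      denominator of \<open>v + w\<close>.\<close>
    show "h (v \<oplus>\<^bsub>U\<^esub> w) = h v \<oplus>\<^bsub>C\<^esub> h w"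
    proof (rule uniq[OF v])
      fix r s assume r: "r \<in> carrier R" and s: "s \<in> carrier R" and rs: "u r \<otimes>\<^bsub>U\<^esub> v = u s"
      show "r \<odot>\<^bsub>C\<^esub> h (v \<oplus>\<^bsub>U\<^esub> w) = r \<odot>\<^bsub>C\<^esub> (h v \<oplus>\<^bsub>C\<^esub> h w)"
      proof (rule uniq[OF w])
        fix r' s' assume r': "r' \<in> carrier R" and s': "s' \<in> carrier R" and rs': "u r' \<otimes>\<^bsub>U\<^esub> w = u s'"
        have "u (r' \<otimes>\<^bsub>R\<^esub> r) \<otimes>\<^bsub>U\<^esub> (v \<oplus>\<^bsub>U\<^esub> w) = u r' \<otimes>\<^bsub>U\<^esub> (u r \<otimes>\<^bsub>U\<^esub> v) \<oplus>\<^bsub>U\<^esub> u r \<otimes>\<^bsub>U\<^esub> (u r' \<otimes>\<^bsub>U\<^esub> w)"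
          using r r' v w by (simp add: hu U.r_distr U.m_ac)
        also have "\<dots> = u (r' \<otimes>\<^bsub>R\<^esub> s \<oplus>\<^bsub>R\<^esub> r \<otimes>\<^bsub>R\<^esub> s')" using r r' s s' by (simp add: rs rs' hu)
        finally have "(r' \<otimes>\<^bsub>R\<^esub> r) \<odot>\<^bsub>C\<^esub> h (v \<oplus>\<^bsub>U\<^esub> w) = (r' \<otimes>\<^bsub>R\<^esub> s \<oplus>\<^bsub>R\<^esub> r \<otimes>\<^bsub>R\<^esub> s') \<odot>\<^bsub>C\<^esub> d"
          using r r' s s' v w by (intro h(2)) auto
        also have "\<dots> = r' \<odot>\<^bsub>C\<^esub> (s \<odot>\<^bsub>C\<^esub> d) \<oplus>\<^bsub>C\<^esub> r \<odot>\<^bsub>C\<^esub> (s' \<odot>\<^bsub>C\<^esub> d)"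
          using r r' s s' d by (simp add: C.smult_l_distr C.smult_assoc1)
        also have "\<dots> = r' \<odot>\<^bsub>C\<^esub> (r \<odot>\<^bsub>C\<^esub> h v) \<oplus>\<^bsub>C\<^esub> r \<odot>\<^bsub>C\<^esub> (r' \<odot>\<^bsub>C\<^esub> h w)"
          using h(2)[OF v r s rs] h(2)[OF w r' s' rs'] by simp
        also have "\<dots> = r' \<odot>\<^bsub>C\<^esub> (r \<odot>\<^bsub>C\<^esub> (h v \<oplus>\<^bsub>C\<^esub> h w))"
          using r r' h(1)[OF v] h(1)[OF w]
          by (simp add: C.smult_r_distr R.m_comm flip: C.smult_assoc1)
        finally show "r' \<odot>\<^bsub>C\<^esub> (r \<odot>\<^bsub>C\<^esub> h (v \<oplus>\<^bsub>U\<^esub> w)) = r' \<odot>\<^bsub>C\<^esub> (r \<odot>\<^bsub>C\<^esub> (h v \<oplus>\<^bsub>C\<^esub> h w))"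
          using r r' v w h(1) by (simp add: C.smult_assoc1)
      qed (use r v w h(1) in auto)
    qed (use v w h(1) in auto)
  next
    fix t v assume t: "t \<in> carrier R" and v: "v \<in> carrier U"
    show "h (u t \<otimes>\<^bsub>U\<^esub> v) = t \<odot>\<^bsub>C\<^esub> h v"
    proof (rule uniq[OF v])
      fix r s assume r: "r \<in> carrier R" and s: "s \<in> carrier R" and rs: "u r \<otimes>\<^bsub>U\<^esub> v = u s"
      have "u r \<otimes>\<^bsub>U\<^esub> (u t \<otimes>\<^bsub>U\<^esub> v) = u t \<otimes>\<^bsub>U\<^esub> (u r \<otimes>\<^bsub>U\<^esub> v)"
        using r t v by (simp add: hu U.m_lcomm)
      also have "\<dots> = u (t \<otimes>\<^bsub>R\<^esub> s)" using t s by (simp add: rs hu)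
      finally have "r \<odot>\<^bsub>C\<^esub> h (u t \<otimes>\<^bsub>U\<^esub> v) = (t \<otimes>\<^bsub>R\<^esub> s) \<odot>\<^bsub>C\<^esub> d"
        using r s t v hu(1) by (intro h(2)) auto
      also have "\<dots> = t \<odot>\<^bsub>C\<^esub> (r \<odot>\<^bsub>C\<^esub> h v)" using h(2)[OF v r s rs] t s d by (simp add: C.smult_assoc1)
      also have "\<dots> = r \<odot>\<^bsub>C\<^esub> (t \<odot>\<^bsub>C\<^esub> h v)"
        using t r h(1)[OF v] by (simp add: R.m_comm flip: C.smult_assoc1)
      finally show "r \<odot>\<^bsub>C\<^esub> h (u t \<otimes>\<^bsub>U\<^esub> v) = r \<odot>\<^bsub>C\<^esub> (t \<odot>\<^bsub>C\<^esub> h v)" .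
    qed (use t v h(1) hu(1) in auto)
  qed
  \<comment> \<open>This is the defining property of \<open>h\<close> with \<open>r = s = 1\<close>,
    as \<open>1\<close> is a denominator of \<open>1\<close>.\<close>
  moreover have "h \<one>\<^bsub>U\<^esub> = d"
    using h(2)[of "\<one>\<^bsub>U\<^esub>" "\<one>\<^bsub>R\<^esub>" "\<one>\<^bsub>R\<^esub>"] h(1)[of "\<one>\<^bsub>U\<^esub>"] d by (simp add: hu)
  ultimately show ?thesis by (auto simp: d_def)
qed

text \<open>The extension of \<open>\<mu>\<close> to \<open>U\<close>, followed by a factorisation
  of \<open>r \<mapsto> r m\<close> through \<open>\<mu>\<close>. The carrier type of
  \<open>M\<close> is arbitrary thanks to \<open>divisible_preenvelopeD\<close>.\<close>

lemma divisible_module_hom_from_epimorphism: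
  fixes C :: "('r, ('r, 'm) univ) module" and M :: "('r, 'a) module"
  assumes R: "cring R" and U: "cring U" and fe: "flat_injective_ring_epimorphism R U u"
    and env: "envelope R (divisible_modules R (gabriel_topology R U u)) (regular_module R) C \<mu>"
    and M: "M \<in> divisible_modules R (gabriel_topology R U u)" and m: "m \<in> carrier M"
  shows "\<exists>h\<in>module_hom R (restrict_scalars U u) M. h \<one>\<^bsub>U\<^esub> = m"
proof -
  have M': "module R M" using M by (simp add: divisible_modules_def)
  interpret module R M by fact
  have u: "u \<in> ring_hom R U"
    using fe by (auto simp: flat_injective_ring_epimorphism_def ring_epimorphism_def)
  obtain h where h: "h \<in> module_hom R (restrict_scalars U u) C" "h \<one>\<^bsub>U\<^esub> = \<mu> \<one>\<^bsub>R\<^esub>"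
    using divisible_envelope_extends[OF R U fe env] by blast
  have "preenvelope R (divisible_modules R (gabriel_topology R U u)) (regular_module R) C \<mu>"
    using env by (simp add: envelope_def)
  from divisible_preenvelopeD[OF R U u this M regular_module_hom[OF M' m]]
  obtain g where g: "g \<in> module_hom R C M" "\<And>r. r \<in> carrier R \<Longrightarrow> g (\<mu> r) = r \<odot>\<^bsub>M\<^esub> m" by blast
  show ?thesis using module_hom_comp[OF h(1) g(1)] h(2) g(2)[of "\<one>\<^bsub>R\<^esub>"] m
    by (intro bexI[of _ "g \<circ> h"]) auto
qed

section \<open>Rigidity of \<open>U\<close>\<close>

text \<open>\<open>f\<close> fixes the image of \<open>R\<close>, so the conductor of
  \<open>v\<close> kills \<open>w = f v - v\<close>. As \<open>1\<close> is a combination with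
  coefficients in the conductor, multiplying it by \<open>w\<close> gives
  \<open>w = 0\<close>.\<close>

lemma epimorphism_endomorphism_id:
  assumes R: "cring R" and U: "cring U" and fe: "flat_injective_ring_epimorphism R U u"
    and f: "f \<in> module_hom R (restrict_scalars U u) (restrict_scalars U u)" and f1: "f \<one>\<^bsub>U\<^esub> = \<one>\<^bsub>U\<^esub>"
    and v: "v \<in> carrier U"
  shows "f v = v"
proof -
  interpret R: cring R by fact
  interpret U: cring U by fact
  let ?U = "restrict_scalars U u" and ?J = "conductor R U u v"
  have u: "u \<in> ring_hom R U"
    using fe by (auto simp: flat_injective_ring_epimorphism_def ring_epimorphism_def)
  note hu = ring_hom_closed[OF u]
  have M: "module R ?U" by (rule module_restrict_scalars[OF R U u])
  note hf = module_homD[OF f, simplified]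
  have fu: "f (u s) = u s" if "s \<in> carrier R" for s
    using hf(3)[OF that U.one_closed] f1 hu[OF that] by simp
  define w where "w = f v \<ominus>\<^bsub>U\<^esub> v"
  have w: "w \<in> carrier U" using hf(1)[OF v] v by (simp add: w_def)
  have Jw: "u r \<otimes>\<^bsub>U\<^esub> w = \<zero>\<^bsub>U\<^esub>" if "r \<in> ?J" for r
  proof -
    obtain s where s: "r \<in> carrier R" "s \<in> carrier R" "u r \<otimes>\<^bsub>U\<^esub> v = u s"
      using \<open>r \<in> ?J\<close> by (auto simp: conductor_def)
    have "u r \<otimes>\<^bsub>U\<^esub> w = u r \<otimes>\<^bsub>U\<^esub> f v \<ominus>\<^bsub>U\<^esub> u r \<otimes>\<^bsub>U\<^esub> v"
      using s(1) hu hf(1)[OF v] v by (simp add: w_def a_minus_def U.r_distr U.r_minus)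
    also have "u r \<otimes>\<^bsub>U\<^esub> f v = u r \<otimes>\<^bsub>U\<^esub> v" using hf(3)[OF s(1) v] fu[OF s(2)] s(3) by simp
    finally show ?thesis using s(1) hu v by (simp add: a_minus_def U.r_neg)
  qed
  have J: "?J \<in> gabriel_topology R U u" by (rule conductor_in_gabriel_topology[OF R U fe v])
  then have idJ: "ideal ?J R" and "ideal_times ?J ?U = carrier ?U" by (auto simp: gabriel_topology_def)
  then have "\<exists>ps. set ps \<subseteq> ?J \<times> carrier ?U \<and> \<one>\<^bsub>U\<^esub> = pair_sum ?U ps"
    unfolding ideal_times_eq_iff[OF M idJ] by (rule_tac bspec) auto
  then obtain ps where ps: "set ps \<subseteq> ?J \<times> carrier U" "\<one>\<^bsub>U\<^esub> = pair_sum ?U ps" by auto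
  have "set ps \<subseteq> carrier R \<times> carrier ?U" using ps(1) by (auto simp: conductor_def)
  moreover have "(\<lambda>x. x \<otimes>\<^bsub>U\<^esub> w) \<in> module_hom R ?U ?U"
    using w hu by (intro module_homI) (auto simp: U.l_distr U.m_assoc)
  ultimately have "pair_sum ?U ps \<otimes>\<^bsub>U\<^esub> w = pair_sum ?U (map (\<lambda>(s, x). (s, x \<otimes>\<^bsub>U\<^esub> w)) ps)"
    by (rule pair_sum_hom[OF M M, rotated])
  also have "\<dots> = \<zero>\<^bsub>?U\<^esub>"
  proof (rule pair_sum_zero[OF M])
    fix a y assume "(a, y) \<in> set (map (\<lambda>(s, x). (s, x \<otimes>\<^bsub>U\<^esub> w)) ps)"
    then obtain x where x: "a \<in> ?J" "x \<in> carrier U" "y = x \<otimes>\<^bsub>U\<^esub> w" using ps(1) by auto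
    moreover have "u a \<in> carrier U" using x(1) hu by (simp add: conductor_def)
    ultimately show "a \<odot>\<^bsub>?U\<^esub> y = \<zero>\<^bsub>?U\<^esub>" using w Jw[OF x(1)] U.m_lcomm[of "u a" x w] by simp
  qed
  finally have "w = \<zero>\<^bsub>U\<^esub>" using w by (simp flip: ps(2))
  then show ?thesis using hf(1)[OF v] v by (simp add: w_def U.minus_eq_zero_iff)
qed

section \<open>Divisible modules\<close>

text \<open>A combination representing \<open>p y\<close> is lifted to \<open>Q\<close>. The error
  lies in the image of \<open>B\<close>, where divisibility writes it as a second combination;
  together they represent \<open>y\<close>.\<close>

lemma divisible_extension:
  assumes \<G>: "\<And>J. J \<in> \<G> \<Longrightarrow> ideal J R" and Q: "module R Q"
    and B: "B \<in> divisible_modules R \<G>" and C: "C \<in> divisible_modules R \<G>"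
    and i: "i \<in> module_hom R B Q" and p: "p \<in> module_hom R Q C" and surj: "p ` carrier Q = carrier C"
    and exact: "\<And>x. x \<in> carrier Q \<Longrightarrow> p x = \<zero>\<^bsub>C\<^esub> \<Longrightarrow> x \<in> i ` carrier B"
  shows "Q \<in> divisible_modules R \<G>"
proof -
  have mB: "module R B" and mC: "module R C" using B C by (auto simp: divisible_modules_def)
  interpret B: module R B by fact
  interpret C: module R C by fact
  interpret Q: module R Q by fact
  have "ideal_times J Q = carrier Q" if J: "J \<in> \<G>" for J
    unfolding ideal_times_eq_iff[OF Q \<G>[OF J]]
  proof
    fix y assume y: "y \<in> carrier Q"
    have JR: "J \<subseteq> carrier R" using additive_subgroup.a_subset[OF ideal.axioms(1)[OF \<G>[OF J]]] .
    have "ideal_times J C = carrier C" "ideal_times J B = carrier B"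
      using B C J by (auto simp: divisible_modules_def)
    then have pairsB: "\<forall>b\<in>carrier B. \<exists>ps. set ps \<subseteq> J \<times> carrier B \<and> b = pair_sum B ps"
      and pairsC: "\<forall>c\<in>carrier C. \<exists>ps. set ps \<subseteq> J \<times> carrier C \<and> c = pair_sum C ps"
      unfolding ideal_times_eq_iff[OF mB \<G>[OF J]] ideal_times_eq_iff[OF mC \<G>[OF J]] by blast+
    obtain ps where ps: "set ps \<subseteq> J \<times> carrier C" "p y = pair_sum C ps"
      using pairsC module_homD(1)[OF p y] by blast
    define lft where "lft = inv_into (carrier Q) p"
    have lift: "lft c \<in> carrier Q" "p (lft c) = c" if "c \<in> carrier C" for c
      using that surj unfolding lft_def by (auto intro: inv_into_into f_inv_into_f)
    define qs where "qs = map (\<lambda>(a, c). (a, lft c)) ps"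
    have qs: "set qs \<subseteq> J \<times> carrier Q" using ps(1) lift by (auto simp: qs_def)
    then have qsR: "set qs \<subseteq> carrier R \<times> carrier Q" using JR by auto
    have s: "pair_sum Q qs \<in> carrier Q" by (rule pair_sum_closed[OF Q qsR])
    have "p (pair_sum Q qs) = pair_sum C (map (\<lambda>(a, x). (a, p x)) qs)" by (rule pair_sum_hom[OF Q mC p qsR])
    also have "map (\<lambda>(a, x). (a, p x)) qs = ps"
      unfolding qs_def map_map by (rule map_idI) (use ps(1) lift in auto)
    finally have "p (y \<ominus>\<^bsub>Q\<^esub> pair_sum Q qs) = \<zero>\<^bsub>C\<^esub>"
      using module_homD(1)[OF p y] by (simp add: module_hom_minus[OF Q mC p y s] ps(2) C.M.minus_eq_zero_iff)
    then obtain b where b: "b \<in> carrier B" "y \<ominus>\<^bsub>Q\<^esub> pair_sum Q qs = i b"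
      using exact[of "y \<ominus>\<^bsub>Q\<^esub> pair_sum Q qs"] y s by auto
    obtain rs where rs: "set rs \<subseteq> J \<times> carrier B" "b = pair_sum B rs" using pairsB b(1) by blast
    define ts where "ts = map (\<lambda>(a, x). (a, i x)) rs"
    have ts: "set ts \<subseteq> J \<times> carrier Q" using rs(1) module_homD(1)[OF i] by (auto simp: ts_def)
    have "set rs \<subseteq> carrier R \<times> carrier B" "set ts \<subseteq> carrier R \<times> carrier Q" using rs(1) ts JR by auto
    then have "pair_sum Q (ts @ qs) = (y \<ominus>\<^bsub>Q\<^esub> pair_sum Q qs) \<oplus>\<^bsub>Q\<^esub> pair_sum Q qs"
      using qsR unfolding b(2) rs(2)
      by (simp add: pair_sum_append[OF Q] pair_sum_hom[OF mB Q i] ts_def)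
    then have "y = pair_sum Q (ts @ qs)" using y s by (simp add: a_minus_def Q.M.a_assoc Q.M.l_neg)
    then show "\<exists>ps. set ps \<subseteq> J \<times> carrier Q \<and> y = pair_sum Q ps" using ts qs by (intro exI[of _ "ts @ qs"]) auto
  qed
  then show ?thesis using Q by (simp add: divisible_modules_def)
qed

section \<open>Restriction of scalars for modules over \<open>U\<close>\<close>

text \<open>Counterpart of \<open>restrict_scalars\<close> for an arbitrary module over
  \<open>U\<close> instead of the ring itself; it is applied to free modules over
  \<open>U\<close>.\<close>

definition pull_module :: "('r \<Rightarrow> 'u) \<Rightarrow> ('u, 'a) module \<Rightarrow> ('r, 'a) module" where
  "pull_module u M = \<lparr>carrier = carrier M, monoid.mult = undefined, one = undefined,
     ring.zero = \<zero>\<^bsub>M\<^esub>, add = add M, smult = (\<lambda>r x. u r \<odot>\<^bsub>M\<^esub> x)\<rparr>"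

lemma pull_module_simps [simp]:
  "carrier (pull_module u M) = carrier M" "\<zero>\<^bsub>pull_module u M\<^esub> = \<zero>\<^bsub>M\<^esub>"
  "x \<oplus>\<^bsub>pull_module u M\<^esub> y = x \<oplus>\<^bsub>M\<^esub> y" "r \<odot>\<^bsub>pull_module u M\<^esub> x = u r \<odot>\<^bsub>M\<^esub> x"
  by (simp_all add: pull_module_def)

lemma module_pull_module:
  assumes "cring R" "u \<in> ring_hom R U" "module U M"
  shows "module R (pull_module u M)"
proof -
  interpret module U M by fact
  have "abelian_group (pull_module u M)"
  proof (rule abelian_groupI)
    fix x assume "x \<in> carrier (pull_module u M)"
    then show "\<exists>y\<in>carrier (pull_module u M). y \<oplus>\<^bsub>pull_module u M\<^esub> x = \<zero>\<^bsub>pull_module u M\<^esub>"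
      by (intro bexI[of _ "\<ominus>\<^bsub>M\<^esub> x"]) (auto simp: M.l_neg)
  qed (auto simp: M.a_ac)
  then show ?thesis
    by (rule moduleI[OF assms(1)])
      (use assms(2) in \<open>auto simp: ring_hom_closed ring_hom_add ring_hom_mult ring_hom_one
        smult_l_distr smult_r_distr smult_assoc1\<close>)
qed

text \<open>If \<open>1 = \<Sum> a\<^sub>i x\<^sub>i\<close> in \<open>U\<close> with coefficients
  in \<open>J\<close>, then \<open>y = \<Sum> a\<^sub>i (x\<^sub>i y)\<close>.\<close>

lemma divisible_pull_module:
  assumes R: "cring R" and U: "cring U" and u: "u \<in> ring_hom R U" and M: "module U M"
  shows "pull_module u M \<in> divisible_modules R (gabriel_topology R U u)"
proof -
  let ?U = "restrict_scalars U u" and ?M = "pull_module u M"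
  interpret U: cring U by fact
  interpret module U M by fact
  have mU: "module R ?U" by (rule module_restrict_scalars[OF R U u])
  have mM: "module R ?M" by (rule module_pull_module[OF R u M])
  have "ideal_times J ?M = carrier ?M" if "J \<in> gabriel_topology R U u" for J
  proof -
    have J: "ideal J R" "ideal_times J ?U = carrier ?U" using that by (auto simp: gabriel_topology_def)
    have JR: "J \<subseteq> carrier R" using additive_subgroup.a_subset[OF ideal.axioms(1)[OF J(1)]] .
    have "\<exists>ps. set ps \<subseteq> J \<times> carrier ?U \<and> \<one>\<^bsub>U\<^esub> = pair_sum ?U ps"
      using J(2) unfolding ideal_times_eq_iff[OF mU J(1)] by (rule_tac bspec) auto
    then obtain ps where ps: "set ps \<subseteq> J \<times> carrier U" "\<one>\<^bsub>U\<^esub> = pair_sum ?U ps" by auto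
    have psR: "set ps \<subseteq> carrier R \<times> carrier ?U" using ps(1) JR by auto
    show ?thesis unfolding ideal_times_eq_iff[OF mM J(1)]
    proof
      fix y assume "y \<in> carrier ?M"
      then have y: "y \<in> carrier M" by simp
      have "(\<lambda>x. x \<odot>\<^bsub>M\<^esub> y) \<in> module_hom R ?U ?M"
        using y ring_hom_closed[OF u] by (intro module_homI) (auto simp: smult_l_distr smult_assoc1)
      from pair_sum_hom[OF mU mM this psR]
      have "y = pair_sum ?M (map (\<lambda>(a, x). (a, x \<odot>\<^bsub>M\<^esub> y)) ps)" using y by (simp flip: ps(2))
      moreover have "set (map (\<lambda>(a, x). (a, x \<odot>\<^bsub>M\<^esub> y)) ps) \<subseteq> J \<times> carrier ?M" using ps(1) y by auto
      ultimately show "\<exists>ps. set ps \<subseteq> J \<times> carrier ?M \<and> y = pair_sum ?M ps" by blast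
    qed
  qed
  then show ?thesis using mM by (simp add: divisible_modules_def)
qed

text \<open>The extension is divisible, so there is a homomorphism from \<open>U\<close> to it that maps \<open>1\<close> to a
  preimage of \<open>1\<close>; it is a section because homomorphisms from \<open>U\<close> to \<open>U\<close> are determined by the
  image of \<open>1\<close>.\<close>

lemma extension_by_divisible_splits:
  fixes C :: "('r, ('r, 'm) univ) module" and Q :: "('r, 'q) module"
  assumes R: "cring R" and U: "cring U" and fe: "flat_injective_ring_epimorphism R U u"
    and env: "envelope R (divisible_modules R (gabriel_topology R U u)) (regular_module R) C \<mu>"
    and Q: "module R Q" and B: "B \<in> divisible_modules R (gabriel_topology R U u)"
    and i: "i \<in> module_hom R B Q" and p: "p \<in> module_hom R Q (restrict_scalars U u)"
    and surj: "p ` carrier Q = carrier U"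
    and exact: "\<And>x. x \<in> carrier Q \<Longrightarrow> p x = \<zero>\<^bsub>U\<^esub> \<Longrightarrow> x \<in> i ` carrier B"
  shows "\<exists>g\<in>module_hom R (restrict_scalars U u) Q. \<forall>v\<in>carrier U. p (g v) = v"
proof -
  interpret U: cring U by fact
  let ?U = "restrict_scalars U u" and ?G = "gabriel_topology R U u"
  have u: "u \<in> ring_hom R U"
    using fe by (auto simp: flat_injective_ring_epimorphism_def ring_epimorphism_def)
  have "?U \<in> divisible_modules R ?G"
    using module_restrict_scalars[OF R U u] by (auto simp: divisible_modules_def gabriel_topology_def)
  from divisible_extension[OF _ Q B this i p] have Q_div: "Q \<in> divisible_modules R ?G"
    using surj exact by (auto simp: gabriel_topology_def)
  have "\<one>\<^bsub>U\<^esub> \<in> p ` carrier Q" unfolding surj by (rule U.one_closed)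
  then obtain e where e: "e \<in> carrier Q" "p e = \<one>\<^bsub>U\<^esub>" by auto
  obtain g where g: "g \<in> module_hom R ?U Q" "g \<one>\<^bsub>U\<^esub> = e"
    using divisible_module_hom_from_epimorphism[OF R U fe env Q_div e(1)] by blast
  have "(p \<circ> g) v = v" if "v \<in> carrier U" for v
    by (rule epimorphism_endomorphism_id[OF R U fe module_hom_comp[OF g(1) p] _ that]) (simp add: g(2) e(2))
  then show ?thesis using g(1) by auto
qed

section \<open>Projective dimension at most one\<close>

text \<open>\<open>Q\<close> is the pushout of \<open>F\<close> and \<open>B\<close> over \<open>A\<close>, an extension of \<open>W\<close> by a quotient of \<open>B\<close>. A
  splitting \<open>g\<close> gives the map \<open>x \<mapsto> x - g (\<epsilon> x)\<close> from \<open>F\<close> to that quotient. Its lifting to \<open>B\<close> takes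
  the kernel of \<open>\<epsilon>\<close> to \<open>\<iota> A\<close>.\<close>

lemma kernel_projective:
  fixes W :: "('r, 'w) module" and F :: "('r, 'f) module" and A :: "('r, 'a) module" and B :: "('r, 'b) module"
  assumes F: "projective_module R F" and A: "projective_module R A" and W: "module R W" and B: "module R B"
    and \<epsilon>: "\<epsilon> \<in> module_hom R F W" "\<epsilon> ` carrier F = carrier W"
    and \<pi>: "\<pi> \<in> module_hom R A F" "\<pi> ` carrier A = {x \<in> carrier F. \<epsilon> x = \<zero>\<^bsub>W\<^esub>}"
    and \<iota>: "\<iota> \<in> module_hom R A B" "inj_on \<iota> (carrier A)"
    and split: "\<And>(Q :: ('r, 'b \<times> 'f) module) i p. module R Q \<Longrightarrow> i \<in> module_hom R B Q \<Longrightarrow>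
      p \<in> module_hom R Q W \<Longrightarrow> p ` carrier Q = carrier W \<Longrightarrow>
      (\<And>x. x \<in> carrier Q \<Longrightarrow> p x = \<zero>\<^bsub>W\<^esub> \<Longrightarrow> x \<in> i ` carrier B) \<Longrightarrow>
      \<exists>g\<in>module_hom R W Q. \<forall>w\<in>carrier W. p (g w) = w"
  shows "projective_module R (F\<lparr>carrier := {x \<in> carrier F. \<epsilon> x = \<zero>\<^bsub>W\<^esub>}\<rparr>)"
proof -
  have mF: "module R F" and mA: "module R A" using F A by (auto simp: projective_module_def)
  interpret F: module R F by fact
  interpret A: module R A by fact
  interpret B: module R B by fact
  interpret W: module R W by fact
  define \<Omega> where "\<Omega> = {x \<in> carrier F. \<epsilon> x = \<zero>\<^bsub>W\<^esub>}"
  have sub\<Omega>: "submodule \<Omega> R F" unfolding \<Omega>_def by (rule submodule_hom_kernel[OF mF W \<epsilon>(1)])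
  have m\<Omega>: "module R (F\<lparr>carrier := \<Omega>\<rparr>)" by (rule submodule.submodule_is_module[OF sub\<Omega> mF])
  have \<epsilon>\<pi>: "\<epsilon> (\<pi> a) = \<zero>\<^bsub>W\<^esub>" "\<pi> a \<in> carrier F" if "a \<in> carrier A" for a
    using \<pi>(2) that by auto
  note \<iota>h = module_homD[OF \<iota>(1)] and \<pi>h = module_homD[OF \<pi>(1)] and \<epsilon>h = module_homD[OF \<epsilon>(1)]
  define V where "V = prod_module B F"
  have V: "module R V" unfolding V_def by (rule module_prod_module[OF B mF])
  interpret V: module R V by fact
  have Vc: "carrier V = carrier B \<times> carrier F" by (simp add: V_def)
  \<comment> \<open>The relations of the pushout: \<open>\<iota> a\<close> in \<open>B\<close> is
    identified with \<open>\<pi> a\<close> in \<open>F\<close>.\<close>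
  define n where "n a = (\<iota> a, \<ominus>\<^bsub>F\<^esub> \<pi> a)" for a
  have n: "n \<in> module_hom R A V"
    unfolding n_def V_def by (rule module_hom_pair[OF \<iota>(1) module_hom_uminus[OF mF \<pi>(1)]])
  define N where "N = n ` carrier A"
  have N: "submodule N R V" unfolding N_def by (rule submodule_hom_image[OF mA V n])
  \<comment> \<open>The quotient stays on the type of \<open>B \<times> F\<close>, which is why
    \<open>split\<close> is only asked for modules on that type.\<close>
  define Q where "Q = quotient_module V N"
  define q where "q = class_rep V N"
  have Q: "module R Q" and q: "q \<in> module_hom R V Q" and Qc: "carrier Q = q ` carrier V"
    unfolding Q_def q_def
    by (rule module_quotient[OF V N], rule quotient_hom[OF V N], rule quotient_carrier[OF V N])
  interpret Q: module R Q by fact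
  have q_eq: "q (b, x) = q (c, y) \<longleftrightarrow> (b \<ominus>\<^bsub>B\<^esub> c, x \<ominus>\<^bsub>F\<^esub> y) \<in> N"
    if "b \<in> carrier B" "c \<in> carrier B" "x \<in> carrier F" "y \<in> carrier F" for b c x y
    using class_rep_eq_iff[OF V N, of "(b, x)" "(c, y)"] that
    by (simp add: q_def V_def prod_module_minus[OF B mF])
  define i where "i b = q (b, \<zero>\<^bsub>F\<^esub>)" for b
  have i: "i \<in> module_hom R B Q"
  proof -
    have "(\<lambda>b. b) \<in> module_hom R B B" by (rule module_homI) auto
    from module_hom_comp[OF module_hom_pair[OF this module_hom_const_zero[OF mF]] q[unfolded V_def]]
    show ?thesis by (simp add: i_def[abs_def] comp_def)
  qed
  define j where "j x = q (\<zero>\<^bsub>B\<^esub>, x)" for x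
  have j: "j \<in> module_hom R F Q"
  proof -
    have "(\<lambda>b. b) \<in> module_hom R F F" by (rule module_homI) auto
    from module_hom_comp[OF module_hom_pair[OF module_hom_const_zero[OF B] this] q[unfolded V_def]]
    show ?thesis by (simp add: j_def[abs_def] comp_def)
  qed
  define p where "p = (\<lambda>x :: 'b \<times> 'f. \<epsilon> (snd x))"
  have "p \<in> module_hom R V W" unfolding p_def V_def by (rule module_homI) (auto simp: \<epsilon>h)
  moreover have "p x = \<zero>\<^bsub>W\<^esub>" if "x \<in> N" for x
    using that \<epsilon>\<pi> module_hom_inv[OF mF W \<epsilon>(1)] by (auto simp: N_def n_def p_def)
  ultimately have p: "p \<in> module_hom R Q W" and pq: "p (q x) = p x" if "x \<in> carrier V" for x
    using that unfolding Q_def q_def by (auto intro: quotient_hom_factor[OF V N W])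
  \<comment> \<open>The premise \<open>x \<in> carrier V\<close> came along with \<open>p\<close>
    and is discharged at zero.\<close>
  have p: "p \<in> module_hom R Q W" using p[OF V.M.zero_closed] .
  have surj: "p ` carrier Q = carrier W"
  proof
    show "p ` carrier Q \<subseteq> carrier W" using module_homD(1)[OF p] by auto
    show "carrier W \<subseteq> p ` carrier Q"
    proof
      fix w assume "w \<in> carrier W"
      then obtain x where x: "x \<in> carrier F" "w = \<epsilon> x" using \<epsilon>(2) by auto
      then have "w = p (q (\<zero>\<^bsub>B\<^esub>, x))" by (simp add: pq Vc) (simp add: p_def)
      then show "w \<in> p ` carrier Q" using x(1) by (auto simp: Qc Vc)
    qed
  qed
  \<comment> \<open>If \<open>\<epsilon> x = 0\<close> then \<open>x = \<pi> a\<close>, and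
    \<open>(b, x)\<close> differs from \<open>(b + \<iota> a, 0)\<close> by the relation
    \<open>n (- a)\<close>.\<close>
  have exact: "y \<in> i ` carrier B" if "y \<in> carrier Q" "p y = \<zero>\<^bsub>W\<^esub>" for y
  proof -
    obtain b x where bx: "b \<in> carrier B" "x \<in> carrier F" "y = q (b, x)"
      using \<open>y \<in> carrier Q\<close> by (auto simp: Qc Vc)
    have "\<epsilon> x = \<zero>\<^bsub>W\<^esub>" using that(2) bx by (simp add: pq Vc) (simp add: p_def)
    then obtain a where a: "a \<in> carrier A" "x = \<pi> a" using \<pi>(2) bx(2) by (auto dest: equalityD2)
    have "b \<ominus>\<^bsub>B\<^esub> (b \<oplus>\<^bsub>B\<^esub> \<iota> a) = \<iota> (\<ominus>\<^bsub>A\<^esub> a)"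
      using bx(1) \<iota>h(1)[OF a(1)]
      by (simp add: module_hom_inv[OF mA B \<iota>(1) a(1)] a_minus_def B.M.minus_add B.M.r_neg2)
    moreover have "x \<ominus>\<^bsub>F\<^esub> \<zero>\<^bsub>F\<^esub> = \<ominus>\<^bsub>F\<^esub> \<pi> (\<ominus>\<^bsub>A\<^esub> a)"
      using bx(2) unfolding a(2) by (simp add: module_hom_inv[OF mA mF \<pi>(1) a(1)] a_minus_def F.M.a_inv_zero)
    ultimately have "(b \<ominus>\<^bsub>B\<^esub> (b \<oplus>\<^bsub>B\<^esub> \<iota> a), x \<ominus>\<^bsub>F\<^esub> \<zero>\<^bsub>F\<^esub>) \<in> N"
      using a(1) by (simp add: N_def n_def image_iff) (metis A.M.a_inv_closed)
    then have "y = i (b \<oplus>\<^bsub>B\<^esub> \<iota> a)"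
      using bx a \<iota>h(1)[OF a(1)] by (simp add: i_def q_eq)
    then show ?thesis using bx(1) \<iota>h(1)[OF a(1)] by blast
  qed
  obtain g where g: "g \<in> module_hom R W Q" "\<And>w. w \<in> carrier W \<Longrightarrow> p (g w) = w"
    using split[OF Q i p surj exact] by blast
  define \<psi> where "\<psi> x = j x \<ominus>\<^bsub>Q\<^esub> g (\<epsilon> x)" for x
  have \<psi>: "\<psi> \<in> module_hom R F Q"
    unfolding \<psi>_def using module_hom_diff[OF Q j module_hom_comp[OF \<epsilon>(1) g(1)]] by (simp add: comp_def)
  \<comment> \<open>\<open>p\<close> sends both \<open>j x\<close> and
    \<open>g (\<epsilon> x)\<close> to \<open>\<epsilon> x\<close>, so \<open>\<psi> x\<close> lies
    in the kernel of \<open>p\<close> and therefore in the image of \<open>B\<close>.\<close>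
  have \<psi>i: "\<psi> x \<in> i ` carrier B" if x: "x \<in> carrier F" for x
  proof (rule exact)
    show "\<psi> x \<in> carrier Q" by (rule module_homD(1)[OF \<psi> x])
    have "p (\<psi> x) = p (j x) \<ominus>\<^bsub>W\<^esub> p (g (\<epsilon> x))"
      unfolding \<psi>_def
      by (rule module_hom_minus[OF Q W p module_homD(1)[OF j x] module_homD(1)[OF g(1) \<epsilon>h(1)[OF x]]])
    then show "p (\<psi> x) = \<zero>\<^bsub>W\<^esub>"
      using x \<epsilon>h(1)[OF x] g(2) by (simp add: j_def pq Vc) (simp add: p_def W.M.minus_eq_zero_iff)
  qed
  \<comment> \<open>Restricting the target to the image of \<open>i\<close> makes \<open>i\<close>
    surjective, so projectivity of \<open>F\<close> lifts \<open>\<psi>\<close> to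
    \<open>B\<close>.\<close>
  let ?K = "Q\<lparr>carrier := i ` carrier B\<rparr>"
  have K: "module R ?K"
    by (rule submodule.submodule_is_module[OF submodule_hom_image[OF B Q i] Q])
  have iK: "i \<in> module_hom R B ?K" and \<psi>K: "\<psi> \<in> module_hom R F ?K"
    using module_homD[OF i] module_homD[OF \<psi>] \<psi>i by (auto intro!: module_homI)
  obtain \<phi> where \<phi>: "\<phi> \<in> module_hom R F B" "\<And>x. x \<in> carrier F \<Longrightarrow> i (\<phi> x) = \<psi> x"
    using projective_moduleD[OF F B K iK \<psi>K] by auto
  \<comment> \<open>On \<open>\<Omega>\<close> the term with \<open>g\<close> vanishes and
    \<open>i (\<phi> x) = j x\<close>, so \<open>(\<phi> x, - x)\<close> is a relation
    \<open>n a\<close>; comparing components gives \<open>\<iota> a = \<phi> x\<close> and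
    \<open>\<pi> a = x\<close>.\<close>
  have lifts: "\<exists>a\<in>carrier A. \<iota> a = \<phi> x \<and> \<pi> a = x" if x: "x \<in> \<Omega>" for x
  proof -
    have xF: "x \<in> carrier F" "\<epsilon> x = \<zero>\<^bsub>W\<^esub>" using x by (auto simp: \<Omega>_def)
    have "i (\<phi> x) = j x"
      using \<phi>(2)[OF xF(1)] module_hom_zero[OF W Q g(1)] module_homD(1)[OF j xF(1)]
      by (simp add: \<psi>_def xF(2) a_minus_def)
    then have "(\<phi> x \<ominus>\<^bsub>B\<^esub> \<zero>\<^bsub>B\<^esub>, \<zero>\<^bsub>F\<^esub> \<ominus>\<^bsub>F\<^esub> x) \<in> N"
      using q_eq[of "\<phi> x" "\<zero>\<^bsub>B\<^esub>" "\<zero>\<^bsub>F\<^esub>" x] module_homD(1)[OF \<phi>(1) xF(1)] xF(1) by (simp add: i_def j_def)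
    then obtain a where a: "a \<in> carrier A" "\<phi> x = \<iota> a" "\<ominus>\<^bsub>F\<^esub> x = \<ominus>\<^bsub>F\<^esub> \<pi> a"
      using module_homD(1)[OF \<phi>(1) xF(1)] xF(1) by (auto simp: N_def n_def a_minus_def B.M.a_inv_zero)
    have "\<pi> a = \<ominus>\<^bsub>F\<^esub> (\<ominus>\<^bsub>F\<^esub> x)" unfolding a(3) using \<epsilon>\<pi>(2)[OF a(1)] by simp
    then show ?thesis using a(1,2) xF(1) by auto
  qed
  \<comment> \<open>Injectivity of \<open>\<iota>\<close> identifies \<open>s x\<close> with the
    element just found, so \<open>s\<close> splits \<open>\<pi>\<close> over
    \<open>\<Omega>\<close>; its linearity is checked after applying \<open>\<iota>\<close>.\<close>
  define s where "s x = inv_into (carrier A) \<iota> (\<phi> x)" for x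
  have s: "s x \<in> carrier A" "\<iota> (s x) = \<phi> x" "\<pi> (s x) = x" if x: "x \<in> \<Omega>" for x
    using lifts[OF x] \<iota>(2) by (auto simp: s_def dest!: sym[of "\<iota> _"])
  note \<phi>h = module_homD[OF \<phi>(1)] and E = F.submoduleE[OF sub\<Omega>]
  have "s \<in> module_hom R (F\<lparr>carrier := \<Omega>\<rparr>) A"
  proof (rule module_homI; simp)
    fix x y assume x: "x \<in> \<Omega>" and y: "y \<in> \<Omega>"
    show "s x \<in> carrier A" by (rule s(1)[OF x])
    show "s (x \<oplus>\<^bsub>F\<^esub> y) = s x \<oplus>\<^bsub>A\<^esub> s y"
      by (rule inj_onD[OF \<iota>(2)]) (use x y s subsetD[OF E(1)] E(5) in \<open>auto simp: \<iota>h \<phi>h\<close>)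
  next
    fix r x assume r: "r \<in> carrier R" and x: "x \<in> \<Omega>"
    show "s (r \<odot>\<^bsub>F\<^esub> x) = r \<odot>\<^bsub>A\<^esub> s x"
      by (rule inj_onD[OF \<iota>(2)]) (use r x s subsetD[OF E(1)] E(4) in \<open>auto simp: \<iota>h \<phi>h\<close>)
  qed
  moreover have "\<pi> \<in> module_hom R A (F\<lparr>carrier := \<Omega>\<rparr>)"
    using \<pi>h \<epsilon>\<pi> by (intro module_homI) (auto simp: \<Omega>_def)
  ultimately show ?thesis
    using projective_module_retract[OF A m\<Omega>] s(3) by (simp add: \<Omega>_def)
qed

section \<open>Free covers and resolutions of length one\<close>

lemma free_cover_surj:
  assumes M: "module R M" and \<phi>: "\<phi> \<in> V \<rightarrow> carrier M" "carrier M \<subseteq> \<phi> ` V"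
  shows "free_eval R M \<phi> ` carrier (free_module R V) = carrier M"
proof -
  interpret module R M by fact
  have "m \<in> free_eval R M \<phi> ` carrier (free_module R V)" if "m \<in> carrier M" for m
  proof -
    obtain x where x: "x \<in> V" "m = \<phi> x" using \<phi>(2) \<open>m \<in> carrier M\<close> by blast
    show ?thesis
      using free_eval_gen[OF M \<phi>(1) x(1)] free_gen_closed[OF R.is_cring x(1)] x(2) by (metis image_eqI)
  qed
  then show ?thesis using module_homD(1)[OF free_eval_hom[OF M \<phi>(1)]] by auto
qed

text \<open>The inclusion of the kernel into the free cover is a resolution of length one.
  Generators are tagged by \<open>Inl\<close> because the definition of projective dimension fixes
  the index type \<open>'a + nat\<close>.\<close>

lemma projective_dimension_le_1:
  fixes R :: "'r ring" and M :: "('r, 'a) module"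
  defines "F \<equiv> free_module R (Inl ` carrier M) :: ('r, 'a + nat \<Rightarrow> 'r) module"
    and "\<epsilon> \<equiv> free_eval R M projl"
  assumes M: "module R M" and \<Omega>: "projective_module R (F\<lparr>carrier := {x \<in> carrier F. \<epsilon> x = \<zero>\<^bsub>M\<^esub>}\<rparr>)"
  shows "projective_dimension R M \<le> 1"
proof -
  interpret M: module R M by fact
  let ?\<Omega> = "F\<lparr>carrier := {x \<in> carrier F. \<epsilon> x = \<zero>\<^bsub>M\<^esub>}\<rparr>"
  define Z :: "('r, 'a + nat \<Rightarrow> 'r) module" where "Z = free_module R {}"
  have Z: "carrier Z = {\<zero>\<^bsub>Z\<^esub>}" by (auto simp: Z_def free_module_def)
  \<comment> \<open>The zero of both modules is the zero function, so a single constant serves as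
    all differentials from \<open>d 1\<close> on.\<close>
  have zero: "\<zero>\<^bsub>Z\<^esub> = \<zero>\<^bsub>F\<^esub>" by (simp add: Z_def F_def free_module_def)
  have pZ: "projective_module R Z" unfolding Z_def by (rule projective_free_module[OF M.R.is_cring])
  have pF: "projective_module R F" unfolding F_def by (rule projective_free_module[OF M.R.is_cring])
  have mF: "module R F" and m\<Omega>: "module R ?\<Omega>" and mZ: "module R Z"
    using pF \<Omega> pZ by (auto simp: projective_module_def)
  interpret F: module R F by fact
  have \<epsilon>: "\<epsilon> \<in> module_hom R F M" unfolding \<epsilon>_def F_def by (rule free_eval_hom[OF M]) auto
  have surj: "\<epsilon> ` carrier F = carrier M"
    unfolding \<epsilon>_def F_def by (rule free_cover_surj[OF M]) (auto simp: image_iff)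
  \<comment> \<open>The terms are the free cover, its kernel and then zero modules;
    \<open>d 0\<close> is the inclusion of the kernel.\<close>
  define P where "P n = (case n of 0 \<Rightarrow> F | Suc 0 \<Rightarrow> ?\<Omega> | Suc (Suc _) \<Rightarrow> Z)" for n
  define d :: "nat \<Rightarrow> ('a + nat \<Rightarrow> 'r) \<Rightarrow> 'a + nat \<Rightarrow> 'r"
    where "d n = (case n of 0 \<Rightarrow> \<lambda>x. x | Suc _ \<Rightarrow> \<lambda>_. \<zero>\<^bsub>F\<^esub>)" for n
  have "projective_resolution R M P \<epsilon> d"
    unfolding projective_resolution_def
  proof (intro conjI allI)
    show "projective_module R (P n)" for n
      using pF \<Omega> pZ by (auto simp: P_def split: nat.split)
    show "\<epsilon> \<in> module_hom R (P 0) M" "\<epsilon> ` carrier (P 0) = carrier M"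
      using \<epsilon> surj by (simp_all add: P_def)
    show "d n \<in> module_hom R (P (Suc n)) (P n)" for n
    proof (cases n)
      case 0
      then show ?thesis by (auto simp: P_def d_def intro: module_homI)
    next
      case (Suc m)
      have "module R (P n)" using m\<Omega> mZ by (auto simp: Suc P_def split: nat.split)
      moreover have "\<zero>\<^bsub>P n\<^esub> = \<zero>\<^bsub>F\<^esub>" using zero by (simp add: Suc P_def split: nat.split)
      ultimately show ?thesis using module_hom_const_zero[of R "P n"] by (simp add: Suc d_def)
    qed
    show "d 0 ` carrier (P 1) = {x \<in> carrier (P 0). \<epsilon> x = \<zero>\<^bsub>M\<^esub>}"
      by (simp add: P_def d_def)
    show "d (Suc n) ` carrier (P (Suc (Suc n))) = {x \<in> carrier (P (Suc n)). d n x = \<zero>\<^bsub>P n\<^esub>}" for n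
      using Z zero module_hom_zero[OF mF M \<epsilon>]
      by (cases n) (auto simp: P_def d_def split: nat.split)
  qed
  moreover have "\<forall>i>1. carrier (P i) = {\<zero>\<^bsub>P i\<^esub>}"
    using Z by (auto simp: P_def split: nat.split)
  ultimately have "enat 1 \<in> {enat n | n. \<exists>(P :: nat \<Rightarrow> ('r, 'a + nat \<Rightarrow> 'r) module) \<epsilon> d.
      projective_resolution R M P \<epsilon> d \<and> (\<forall>i>n. carrier (P i) = {\<zero>\<^bsub>P i\<^esub>})}" by blast
  then have "projective_dimension R M \<le> enat 1"
    unfolding projective_dimension_def by (rule Inf_lower)
  then show ?thesis by (simp add: one_enat_def)
qed

theorem proposition7p1:
  fixes R :: "'r ring" and U :: "'u ring" and u :: "'r \<Rightarrow> 'u"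
  assumes "cring R" and "cring U"
    and "flat_injective_ring_epimorphism R U u"
    and "u \<notin> ring_iso R U"
    and "\<exists>(C :: ('r, ('r, 'm) univ) module) \<mu>.
           envelope R (divisible_modules R (gabriel_topology R U u)) (regular_module R) C \<mu>"
  shows "projective_dimension R (restrict_scalars U u) \<le> 1"
proof -
  note R = assms(1) and U = assms(2) and fe = assms(3)
  interpret R: cring R by fact
  interpret U: cring U by fact
  obtain C :: "('r, ('r, 'm) univ) module" and \<mu> where
    env: "envelope R (divisible_modules R (gabriel_topology R U u)) (regular_module R) C \<mu>"
    using assms(5) by blast
  have u: "u \<in> ring_hom R U" and inj: "inj_on u (carrier R)"
    using fe by (auto simp: flat_injective_ring_epimorphism_def ring_epimorphism_def)
  note hu = ring_hom_closed[OF u] ring_hom_add[OF u] ring_hom_mult[OF u]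
  have u0: "u \<zero>\<^bsub>R\<^esub> = \<zero>\<^bsub>U\<^esub>" by (rule ring_hom_zero[OF u R.ring_axioms U.ring_axioms])
  let ?U = "restrict_scalars U u"
  have mU: "module R ?U" by (rule module_restrict_scalars[OF R U u])
  define F :: "('r, 'u + nat \<Rightarrow> 'r) module" where "F = free_module R (Inl ` carrier ?U)"
  define \<epsilon> where "\<epsilon> = free_eval R ?U (projl :: 'u + nat \<Rightarrow> 'u)"
  have pF: "projective_module R F" unfolding F_def by (rule projective_free_module[OF R])
  then have mF: "module R F" by (simp add: projective_module_def)
  have \<epsilon>: "\<epsilon> \<in> module_hom R F ?U" unfolding \<epsilon>_def F_def by (rule free_eval_hom[OF mU]) auto
  have \<epsilon>_surj: "\<epsilon> ` carrier F = carrier ?U"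
    unfolding \<epsilon>_def F_def by (rule free_cover_surj[OF mU]) (auto simp: image_iff)
  define \<Omega> where "\<Omega> = {x \<in> carrier F. \<epsilon> x = \<zero>\<^bsub>?U\<^esub>}"
  let ?\<Omega> = "F\<lparr>carrier := \<Omega>\<rparr>"
  have m\<Omega>: "module R ?\<Omega>"
    unfolding \<Omega>_def by (rule submodule.submodule_is_module[OF submodule_hom_kernel[OF mF mU \<epsilon>] mF])
  \<comment> \<open>The elements of \<open>\<Omega>\<close> themselves index the free module that
    covers \<open>\<Omega>\<close>.\<close>
  define \<pi> where "\<pi> = free_eval R ?\<Omega> (\<lambda>x. x)"
  have \<pi>': "\<pi> \<in> module_hom R (free_module R \<Omega>) ?\<Omega>" unfolding \<pi>_def by (rule free_eval_hom[OF m\<Omega>]) auto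
  have "(\<lambda>x. x) \<in> module_hom R ?\<Omega> F" by (rule module_homI) (auto simp: \<Omega>_def)
  from module_hom_comp[OF \<pi>' this] have \<pi>: "\<pi> \<in> module_hom R (free_module R \<Omega>) F" by (simp add: comp_def)
  have \<pi>_im: "\<pi> ` carrier (free_module R \<Omega>) = \<Omega>"
    unfolding \<pi>_def using free_cover_surj[OF m\<Omega>, of "\<lambda>x. x" \<Omega>] by auto
  \<comment> \<open>The free \<open>U\<close>-module on the same index set, viewed over
    \<open>R\<close>; like every \<open>U\<close>-module it is divisible.\<close>
  define B where "B = pull_module u (free_module U \<Omega>)"
  have B: "B \<in> divisible_modules R (gabriel_topology R U u)"
    unfolding B_def by (rule divisible_pull_module[OF R U u module_free_module[OF U]])
  then have mB: "module R B" by (simp add: divisible_modules_def)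
  \<comment> \<open>The embedding of the free \<open>R\<close>-module into the free
    \<open>U\<close>-module applies \<open>u\<close> to each coordinate; it is injective because
    \<open>u\<close> is.\<close>
  define \<iota> where "\<iota> a x = u (a x)" for a :: "('u + nat \<Rightarrow> 'r) \<Rightarrow> 'r" and x
  have \<iota>: "\<iota> \<in> module_hom R (free_module R \<Omega>) B"
  proof (rule module_homI)
    fix a assume "a \<in> carrier (free_module R \<Omega>)"
    then have a: "\<And>x. a x \<in> carrier R" "\<And>x. x \<notin> \<Omega> \<Longrightarrow> a x = \<zero>\<^bsub>R\<^esub>" "finite {x. a x \<noteq> \<zero>\<^bsub>R\<^esub>}"
      by (auto simp: free_module_def)
    have "finite {x. u (a x) \<noteq> \<zero>\<^bsub>U\<^esub>}" by (rule finite_subset[OF _ a(3)]) (auto simp: u0)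
    then show "\<iota> a \<in> carrier B" using a(1,2) by (auto simp: B_def free_module_def \<iota>_def hu u0)
  qed (auto simp: B_def free_module_def \<iota>_def hu)
  have "inj_on \<iota> (carrier (free_module R \<Omega>))"
  proof (rule inj_onI, rule ext)
    fix a b x assume "a \<in> carrier (free_module R \<Omega>)" "b \<in> carrier (free_module R \<Omega>)" "\<iota> a = \<iota> b"
    then have "a x \<in> carrier R" "b x \<in> carrier R" "u (a x) = u (b x)"
      by (auto simp: free_module_def \<iota>_def dest: fun_cong)
    then show "a x = b x" using inj by (auto dest: inj_onD)
  qed
  note \<iota>_inj = this
  have "projective_module R (F\<lparr>carrier := {x \<in> carrier F. \<epsilon> x = \<zero>\<^bsub>?U\<^esub>}\<rparr>)"
  proof (rule kernel_projective[OF pF projective_free_module[OF R] mU mB \<epsilon> \<epsilon>_surj \<pi> _ \<iota> \<iota>_inj])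
    show "\<pi> ` carrier (free_module R \<Omega>) = {x \<in> carrier F. \<epsilon> x = \<zero>\<^bsub>?U\<^esub>}"
      using \<pi>_im by (simp only: \<Omega>_def)
  next
    \<comment> \<open>The splitting hypothesis holds because \<open>B\<close> is divisible; this is
      where the envelope enters.\<close>
    fix Q :: "('r, (('u + nat \<Rightarrow> 'r) \<Rightarrow> 'u) \<times> ('u + nat \<Rightarrow> 'r)) module" and i p
    assume *: "module R Q" "i \<in> module_hom R B Q" "p \<in> module_hom R Q ?U"
      "p ` carrier Q = carrier ?U" "\<And>x. x \<in> carrier Q \<Longrightarrow> p x = \<zero>\<^bsub>?U\<^esub> \<Longrightarrow> x \<in> i ` carrier B"
    show "\<exists>g\<in>module_hom R ?U Q. \<forall>w\<in>carrier ?U. p (g w) = w"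
      using extension_by_divisible_splits[OF R U fe env *(1) B *(2,3)] *(4,5) by simp
  qed
  then show ?thesis using projective_dimension_le_1[OF mU] by (simp add: F_def \<epsilon>_def)
qed

end
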